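(* Let $\mathbf{G}=(J,\mu,E)$ be a graphing. (a) $\alpha\in\mathsf{mm}_+(\rho_{\mathbf{G}})$ is an exposed point of $\mathsf{mm}_+(\rho_{\mathbf{G}})$ if and only if $\alpha=\eta_{\mathbf{G}}|_F$ (i.e. $\alpha(A)=\eta_{\mathbf{G}}(A\cap F)$ for all Borel $A\subseteq E$) for a Borel set $F\subseteq E$ such that $(J,\mu,F)$ is a hyperfinite forest. (b) $\alpha\in\mathsf{bmm}_+(\rho_{\mathbf{G}})$ is an exposed point of $\mathsf{bmm}_+(\rho_{\mathbf{G}})$ if and only if $\alpha=\eta_{\mathbf{G}}|_F$ for a Borel set $F\subseteq E$ which is a hyperfinite essential spanning forest of $\mathbf{G}$.
   Context: A graphing $\mathbf{G}=(J,\mu,E)$: $(J,\mu)$ a standard Borel probability space, $E\subseteq\binom{J}{2}$ Borel with bounded degrees, satisfying $\int_A\deg(B,x)\,d\mu(x)=\int_B\deg(A,x)\,d\mu(x)$ for all measurable $A,B\subseteq J$ ($\deg(S,x)$ = number of edges from $x$ to $S$). Edge measure: $\eta_{\mathbf{G}}(F)=\frac12\int_J\deg_F(x)\,d\mu(x)$ for Borel $F\subseteq E$. Rank: $\rho_{\mathbf{G}}(F)=1-\int_J\frac{1}{|V(\mathbf{G}^F_x)|}\,d\mu(x)$, where $\mathbf{G}^F_x$ is the component of $x$ in $(J,\mu,F)$ and $1/\infty=0$. A graphing $(J,\mu,F)$ is hyperfinite if for every $\varepsilon>0$ there is Borel $S\subseteq F$ with $\eta_{\mathbf{G}}(S)\le\varepsilon$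 such that every component of $(J,\mu,F\setminus S)$ is finite. A forest is an acyclic edge set; an essential spanning forest of $\mathbf{G}$ is a forest $F\subseteq E$ forming a spanning tree in every finite component of $\mathbf{G}$ and having only infinite components inside infinite components of $\mathbf{G}$. All such notions are understood up to $\eta_{\mathbf{G}}$-null sets of edges. $\mathsf{mm}_+(\rho_{\mathbf{G}})$ is the set of measures $\alpha$ on $E$ with $0\le\alpha(A)\le\rho_{\mathbf{G}}(A)$ for all Borel $A$; $\mathsf{bmm}_+(\rho_{\mathbf{G}})=\{\alpha\in\mathsf{mm}_+(\rho_{\mathbf{G}}):\alpha(E)=\rho_{\mathbf{G}}(E)\}$. These measures are absolutely continuous w.r.t. $\eta_{\mathbf{G}}$ and are identified with their Radon–Nikodym derivatives in $L^1(E,\eta_{\mathbf{G}})$, equipped with the weak topology. A point $v$ of a convex set $C$ is exposed if there is a continuous linear functional $\Lambda$ with $\Lambda(y)<\Lambda(v)$ for all $y\in C\setminus\{v\}$. *)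

theory Defs
  imports "HOL-Probability.Probability" "HOL-Library.Uprod"
begin

section \<open>Unordered pairs with the quotient Borel structure\<close>

definition uprod_sets :: "('a::topological_space) uprod set set" where
  "uprod_sets = {A. (\<lambda>p. Upair (fst p) (snd p)) -` A \<in> sets borel}"

section \<open>Graph notions for an edge set of unordered pairs\<close>

definition adj :: "'a uprod set \<Rightarrow> ('a \<times> 'a) set" where
  "adj F = {(a, b). Upair a b \<in> F}"

text \<open>vertex set of the component of x in the graph with edge set F\<close>
definition comp :: "'a uprod set \<Rightarrow> 'a \<Rightarrow> 'a set" where
  "comp F x = {y. (x, y) \<in> (adj F)\<^sup>*}"

text \<open>number of edges from x to S\<close>
definition deg :: "'a uprod set \<Rightarrow> 'a set \<Rightarrow> 'a \<Rightarrow> nat" where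
  "deg E S x = card {y \<in> S. Upair x y \<in> E}"

definition graphing :: "('a::polish_space) measure \<Rightarrow> 'a uprod set \<Rightarrow> bool" where
  "graphing M E \<longleftrightarrow>
     prob_space M \<and> sets M = sets borel \<and>
     E \<in> uprod_sets \<and>
     (\<forall>e\<in>E. \<exists>x y. x \<noteq> y \<and> e = Upair x y) \<and>
     (\<exists>D::nat. \<forall>x. finite {y. Upair x y \<in> E} \<and> card {y. Upair x y \<in> E} \<le> D) \<and>
     (\<forall>A\<in>sets M. \<forall>B\<in>sets M.
        (\<integral>\<^sup>+x\<in>A. ennreal (real (deg E B x)) \<partial>M) = (\<integral>\<^sup>+x\<in>B. ennreal (real (deg E A x)) \<partial>M))"

text \<open>edge measure eta_G(F) = 1/2 * integral of deg_F\<close>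
definition eta :: "('a::polish_space) measure \<Rightarrow> 'a uprod set \<Rightarrow> 'a uprod measure" where
  "eta M E = measure_of UNIV uprod_sets
     (\<lambda>F. (\<integral>\<^sup>+x. ennreal (real (card {y. Upair x y \<in> F \<inter> E})) \<partial>M) / 2)"

text \<open>rank rho_G(F) = 1 - integral of 1/|V(G^F_x)|, with 1/infinity = 0\<close>
definition rho :: "('a::polish_space) measure \<Rightarrow> 'a uprod set \<Rightarrow> 'a uprod set \<Rightarrow> real" where
  "rho M E F = 1 - (\<integral>x. (if finite (comp (F \<inter> E) x) then 1 / real (card (comp (F \<inter> E) x)) else 0) \<partial>M)"

section \<open>The convex sets mm_+ and bmm_+, as sets of densities in L^1(E, eta)\<close>

definition mm_plus :: "('a::polish_space) measure \<Rightarrow> 'a uprod set \<Rightarrow> ('a uprod \<Rightarrow> real) set" where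
  "mm_plus M E = {f. integrable (eta M E) f \<and>
     (\<forall>A\<in>sets (eta M E). A \<subseteq> E \<longrightarrow>
        0 \<le> (\<integral>e\<in>A. f e \<partial>eta M E) \<and> (\<integral>e\<in>A. f e \<partial>eta M E) \<le> rho M E A)}"

definition bmm_plus :: "('a::polish_space) measure \<Rightarrow> 'a uprod set \<Rightarrow> ('a uprod \<Rightarrow> real) set" where
  "bmm_plus M E = {f \<in> mm_plus M E. (\<integral>e\<in>E. f e \<partial>eta M E) = rho M E E}"

text \<open>the measure with density f equals eta restricted to F\<close>
definition is_restriction :: "'e measure \<Rightarrow> ('e \<Rightarrow> real) \<Rightarrow> 'e set \<Rightarrow> bool" where
  "is_restriction N f F \<longleftrightarrow> (\<forall>A\<in>sets N. (\<integral>e\<in>A. f e \<partial>N) = measure N (A \<inter> F))"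

section \<open>L^1 with its weak topology, and exposed points\<close>

definition L1_linear :: "'e measure \<Rightarrow> (('e \<Rightarrow> real) \<Rightarrow> real) \<Rightarrow> bool" where
  "L1_linear N \<Lambda> \<longleftrightarrow>
     (\<forall>f g. integrable N f \<longrightarrow> integrable N g \<longrightarrow> \<Lambda> (\<lambda>x. f x + g x) = \<Lambda> f + \<Lambda> g) \<and>
     (\<forall>c f. integrable N f \<longrightarrow> \<Lambda> (\<lambda>x. c * f x) = c * \<Lambda> f)"

text \<open>norm-continuous (bounded) linear functionals on L^1\<close>
definition L1_bounded_functional :: "'e measure \<Rightarrow> (('e \<Rightarrow> real) \<Rightarrow> real) \<Rightarrow> bool" where
  "L1_bounded_functional N \<Lambda> \<longleftrightarrow> L1_linear N \<Lambda> \<and>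
     (\<exists>K. \<forall>f. integrable N f \<longrightarrow> \<bar>\<Lambda> f\<bar> \<le> K * (\<integral>x. \<bar>f x\<bar> \<partial>N))"

text \<open>weak topology on L^1 (on representatives; a.e.-equal functions are indistinguishable)\<close>
definition weak_L1 :: "'e measure \<Rightarrow> ('e \<Rightarrow> real) topology" where
  "weak_L1 N = topology_generated_by
     {{f. integrable N f \<and> \<Lambda> f \<in> U} | \<Lambda> U. L1_bounded_functional N \<Lambda> \<and> open U}"

definition exposed_point_L1 :: "'e measure \<Rightarrow> ('e \<Rightarrow> real) set \<Rightarrow> ('e \<Rightarrow> real) \<Rightarrow> bool" where
  "exposed_point_L1 N C v \<longleftrightarrow> v \<in> C \<and>
     (\<exists>\<Lambda>. L1_linear N \<Lambda> \<and> continuous_map (weak_L1 N) euclideanreal \<Lambda> \<and>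
        (\<forall>y\<in>C. \<not> (AE x in N. y x = v x) \<longrightarrow> \<Lambda> y < \<Lambda> v))"

section \<open>Forests, hyperfiniteness, essential spanning forests (up to null sets)\<close>

definition cycle_edge :: "'a uprod set \<Rightarrow> 'a uprod \<Rightarrow> bool" where
  "cycle_edge F e \<longleftrightarrow> e \<in> F \<and> (\<exists>a b. e = Upair a b \<and> a \<noteq> b \<and> (a, b) \<in> (adj (F - {e}))\<^sup>*)"

definition forest :: "('a::polish_space) measure \<Rightarrow> 'a uprod set \<Rightarrow> 'a uprod set \<Rightarrow> bool" where
  "forest M E F \<longleftrightarrow> (AE e in eta M E. \<not> cycle_edge F e)"

definition hyperfinite :: "('a::polish_space) measure \<Rightarrow> 'a uprod set \<Rightarrow> 'a uprod set \<Rightarrow> bool" where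
  "hyperfinite M E F \<longleftrightarrow>
     (\<forall>\<epsilon>>0. \<exists>S\<in>sets (eta M E). S \<subseteq> F \<and> emeasure (eta M E) S \<le> ennreal \<epsilon> \<and>
        (\<forall>x. finite (comp (F - S) x)))"

definition essential_spanning_forest :: "('a::polish_space) measure \<Rightarrow> 'a uprod set \<Rightarrow> 'a uprod set \<Rightarrow> bool" where
  "essential_spanning_forest M E F \<longleftrightarrow> F \<subseteq> E \<and> forest M E F \<and>
     (AE x in M. (finite (comp E x) \<longrightarrow> comp F x = comp E x) \<and>
                 (infinite (comp E x) \<longrightarrow> infinite (comp F x)))"

end

theory Submission
  imports Defs
begin

text \<open>
  The maximum of a bounded functional over \<open>mm_plus\<close> is attained by a greedy solution: order the edges by
  the density of the functional, break ties so that edges become totally ordered, and keep those edges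
  that are the largest edge leaving the finite cluster formed at one endpoint by the larger edges.
  On every superlevel set \<open>U\<close> this wired maximal spanning forest \<open>F\<close> has the same finite components as \<open>U\<close>, so
  \<open>rho U = rho (F \<inter> U) = eta (F \<inter> U)\<close> as soon as \<open>F\<close> is hyperfinite, and integrating over the levels shows
  that \<open>F\<close> beats every measure dominated by the rank. An exposed point is therefore the indicator of such an \<open>F\<close>.

  Hyperfiniteness of \<open>F\<close>: edges joining two finite clusters form an increasing union of graphs with
  bounded components. The remaining edges point from a finite cluster to an infinite one and increase
  along the resulting functional graph; by mass transport no such chain can be extended backwards
  indefinitely on a set of positive measure, so cutting the edges preceded by long chains costs little.

  Conversely, if \<open>F\<close> is hyperfinite then \<open>rho A \<le> eta A\<close> for \<open>A \<subseteq> F\<close>, and integration against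
  \<open>1\<close> on \<open>F\<close> and \<open>-1\<close> off \<open>F\<close> exposes the indicator of \<open>F\<close>.

  All measurability rests on the fact that a Borel set with finite sections of bounded size has a Borel projection.
\<close>

section \<open>Borel separation and projections with finite sections\<close>

text \<open>The forest is wired because an edge joining two infinite clusters may destroy
  hyperfiniteness, whereas one finite cluster is enough for spanning: a finite component of the
  forest that is not yet a component of \<open>U\<close> is left by finitely many edges of
  \<open>U\<close>, and the largest of these would have been kept. Acyclicity, spanning and
  finiteness after cutting therefore hold at every vertex, and an exceptional null set enters only
  to rule out endless chains. A weakly continuous functional is norm bounded, hence integration
  against a bounded density. One everywhere defined representative is fixed, so that the order of
  the edges makes sense pointwise. The two convex sets differ in the treatment of negative weights.
  In \<open>mm_plus\<close> such edges are dropped from the forest. On \<open>bmm_plus\<close> the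
  total mass is fixed, so adding a constant to the density shifts all values equally; the weights
  may be taken positive and the whole forest is kept. Rank and edge measure are compared on finite
  components: a component with n vertices has at least n - 1 edges, and spreading them evenly over
  its vertices gives the integrand 1 - 1/n of the rank.\<close>

definition borel_separable :: "'a::topological_space set \<Rightarrow> 'a set \<Rightarrow> bool" where
  "borel_separable A B \<longleftrightarrow> (\<exists>S\<in>sets borel. A \<subseteq> S \<and> S \<inter> B = {})"

text \<open>Used in contrapositive form: if two countable unions cannot be separated, then neither
  can some pair of their pieces. This is the halving step of
  \<open>borel_separation\<close>.\<close>

lemma borel_separable_UN:
  assumes "\<And>i j. borel_separable (A i) (B j)"
  shows "borel_separable (\<Union>i::nat. A i) (\<Union>j::nat. B j)"
proof -
  obtain S where S: "\<And>i j. S i j \<in> sets borel" "\<And>i j. A i \<subseteq> S i j" "\<And>i j. S i j \<inter> B j = {}"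
    using assms unfolding borel_separable_def by metis
  show ?thesis unfolding borel_separable_def
  proof (intro bexI conjI)
    show "(\<Union>i. \<Inter>j. S i j) \<in> sets borel" using S(1) by (intro sets.countable_UN sets.countable_INT) auto
    show "(\<Union>i. A i) \<subseteq> (\<Union>i. \<Inter>j. S i j)" using S(2) by blast
    show "(\<Union>i. \<Inter>j. S i j) \<inter> (\<Union>j. B j) = {}" using S(3) by blast
  qed
qed

lemma countable_cball_cover:
  obtains d :: "nat \<Rightarrow> 'a::{metric_space, second_countable_topology}"
  where "\<And>e. e > 0 \<Longrightarrow> (\<Union>i. cball (d i) e) = UNIV"
proof -
  obtain D :: "'a set" where D: "countable D" "\<And>X. open X \<Longrightarrow> X \<noteq> {} \<Longrightarrow> \<exists>d\<in>D. d \<in> X"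
    by (rule countable_dense_setE) blast
  have ne: "D \<noteq> {}" using D(2)[of UNIV] by auto
  show ?thesis
  proof
    fix e :: real assume "e > 0"
    have "\<exists>i. x \<in> cball (from_nat_into D i) e" for x
    proof -
      from D(2)[of "ball x e"] \<open>e > 0\<close> obtain y where "y \<in> D" "dist x y < e" by auto
      moreover obtain i where "from_nat_into D i = y"
        using from_nat_into_surj[OF D(1) \<open>y \<in> D\<close>] by blast
      ultimately show ?thesis by (intro exI[of _ i]) (auto simp: dist_commute)
    qed
    then show "(\<Union>i. cball (from_nat_into D i) e) = UNIV" by auto
  qed
qed

lemma nested_small_ball:
  fixes K :: "nat \<Rightarrow> ('a::metric_space) set"
  assumes K: "\<And>n. K (Suc n) \<subseteq> cball (p n) ((1/2)^n)" and x: "\<And>n. x \<in> K n" and e: "e > 0"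
  shows "\<exists>n. \<forall>m\<ge>n. K m \<subseteq> ball x e"
proof -
  obtain n where n: "(1/2::real)^n < e/2" using real_arch_pow_inv[of "e/2" "1/2"] e by auto
  show ?thesis
  proof (intro exI[of _ "Suc n"] allI impI subsetI)
    fix m y assume m: "Suc n \<le> m" and y: "y \<in> K m"
    then obtain k where k: "m = Suc k" "n \<le> k" by (cases m) auto
    have "dist (p k) y \<le> (1/2)^k" "dist (p k) x \<le> (1/2)^k" using K[of k] x[of m] y k by auto
    then have "dist x y \<le> 2 * (1/2)^k" using dist_triangle[of x y "p k"] by (simp add: dist_commute)
    also have "(1/2::real)^k \<le> (1/2)^n" using k by (intro power_decreasing) auto
    finally show "y \<in> ball x e" using n by auto
  qed
qed

lemma nested_cball_small:
  fixes L :: "nat \<Rightarrow> 'a::metric_space set"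
  assumes L: "\<And>n. L (Suc n) \<subseteq> cball (q n) ((1/2)^n)" and e: "e > 0"
  shows "\<exists>n. \<forall>x\<in>L n. \<forall>y\<in>L n. dist x y < e"
proof -
  obtain n where n: "(1/2::real)^n < e/2" using real_arch_pow_inv[of "e/2" "1/2"] e by auto
  have "dist x y < e" if "x \<in> L (Suc n)" "y \<in> L (Suc n)" for x y
  proof -
    have "dist (q n) x \<le> (1/2)^n" "dist (q n) y \<le> (1/2)^n" using that L[of n] by auto
    then show ?thesis using n dist_triangle[of x y "q n"] by (simp add: dist_commute)
  qed
  then show ?thesis by blast
qed

text \<open>Lusin separation. If the images were inseparable, cutting both closed sets by countably
  many balls of radius (1/2)^n would leave an inseparable pair of pieces at every stage. The nested
  pieces shrink to points \<open>x\<close> and \<open>y\<close> with distinct images, and by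
  continuity disjoint neighbourhoods of these images separate the pieces from some stage on.\<close>

theorem borel_separation:
  fixes f :: "'p::{complete_space, second_countable_topology} \<Rightarrow> 'a::t2_space"
    and f' :: "'q::{complete_space, second_countable_topology} \<Rightarrow> 'a"
  assumes C: "closed C" "closed C'" and f: "continuous_on UNIV f" "continuous_on UNIV f'"
    and disj: "f ` C \<inter> f' ` C' = {}"
  shows "borel_separable (f ` C) (f' ` C')"
proof (rule ccontr)
  assume nsep: "\<not> borel_separable (f ` C) (f' ` C')"
  obtain d :: "nat \<Rightarrow> 'p" where d: "\<And>e. e > 0 \<Longrightarrow> (\<Union>i. cball (d i) e) = UNIV"
    using countable_cball_cover by blast
  obtain d' :: "nat \<Rightarrow> 'q" where d': "\<And>e. e > 0 \<Longrightarrow> (\<Union>i. cball (d' i) e) = UNIV"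
    using countable_cball_cover by blast
  define Q where "Q K \<longleftrightarrow> closed (fst K) \<and> closed (snd K) \<and> \<not> borel_separable (f ` fst K) (f' ` snd K)
      \<and> fst K \<subseteq> C \<and> snd K \<subseteq> C'" for K
  define R where "R n K L \<longleftrightarrow> fst L \<subseteq> fst K \<and> snd L \<subseteq> snd K
      \<and> (\<exists>p. fst L \<subseteq> cball p ((1/2)^n)) \<and> (\<exists>p. snd L \<subseteq> cball p ((1/2)^n))"
    for n :: nat and K L :: "'p set \<times> 'q set"
  have "\<exists>K. K 0 = (C, C') \<and> (\<forall>n. Q (K n) \<and> R n (K n) (K (Suc n)))"
  proof (rule dependent_nat_choice[where P="\<lambda>n K. (n = 0 \<longrightarrow> K = (C, C')) \<and> Q K" and Q=R, THEN exE])
    show "\<exists>K. (0 = (0::nat) \<longrightarrow> K = (C, C')) \<and> Q K" using C nsep by (auto simp: Q_def)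
    fix K and n :: nat assume K: "(n = 0 \<longrightarrow> K = (C, C')) \<and> Q K"
    have "(\<Union>i. f ` (fst K \<inter> cball (d i) ((1/2)^n))) = f ` (fst K \<inter> (\<Union>i. cball (d i) ((1/2)^n)))"
      by (simp only: image_UN Int_UN_distrib)
    then have "f ` fst K = (\<Union>i. f ` (fst K \<inter> cball (d i) ((1/2)^n)))"
      using d[of "(1/2)^n"] by simp
    moreover have "(\<Union>i. f' ` (snd K \<inter> cball (d' i) ((1/2)^n))) = f' ` (snd K \<inter> (\<Union>i. cball (d' i) ((1/2)^n)))"
      by (simp only: image_UN Int_UN_distrib)
    then have "f' ` snd K = (\<Union>i. f' ` (snd K \<inter> cball (d' i) ((1/2)^n)))"
      using d'[of "(1/2)^n"] by simp
    ultimately obtain i j where "\<not> borel_separable (f ` (fst K \<inter> cball (d i) ((1/2)^n)))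
        (f' ` (snd K \<inter> cball (d' j) ((1/2)^n)))"
      using K borel_separable_UN[of "\<lambda>i. f ` (fst K \<inter> cball (d i) ((1/2)^n))"
         "\<lambda>i. f' ` (snd K \<inter> cball (d' i) ((1/2)^n))"] unfolding Q_def by auto
    then show "\<exists>L. ((Suc n = 0 \<longrightarrow> L = (C, C')) \<and> Q L) \<and> R n K L"
      using K by (intro exI[of _ "(fst K \<inter> cball (d i) ((1/2)^n), snd K \<inter> cball (d' j) ((1/2)^n))"])
        (auto simp: Q_def R_def intro!: exI[of _ "d i"] exI[of _ "d' j"])
  qed auto
  then obtain K where K: "\<And>n. Q (K n)" "\<And>n. R n (K n) (K (Suc n))" by auto
  have dec: "fst (K n) \<subseteq> fst (K m) \<and> snd (K n) \<subseteq> snd (K m)" if "m \<le> n" for m n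
    using that by (induction rule: dec_induct) (use K(2) R_def in blast)+
  obtain p p' where p: "\<And>n. fst (K (Suc n)) \<subseteq> cball (p n) ((1/2)^n)" "\<And>n. snd (K (Suc n)) \<subseteq> cball (p' n) ((1/2)^n)"
    using K(2) unfolding R_def by metis
  have ne: "fst (K n) \<noteq> {}" "snd (K n) \<noteq> {}" for n
  proof -
    have "borel_separable {} A" "borel_separable A {}" for A :: "'a set"
      unfolding borel_separable_def by (rule bexI[of _ "{}"]; simp) (rule bexI[of _ UNIV]; simp)
    then show "fst (K n) \<noteq> {}" "snd (K n) \<noteq> {}" using K(1)[of n] unfolding Q_def by (metis image_empty)+
  qed
  have cl: "closed (fst (K n))" "closed (snd (K n))" for n using K(1) unfolding Q_def by auto
  obtain x where x: "\<And>n. x \<in> fst (K n)"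
    using decreasing_closed_nest[of "\<lambda>n. fst (K n)", OF cl(1) ne(1) _ nested_cball_small[OF p(1)]] dec by blast
  obtain y where y: "\<And>n. y \<in> snd (K n)"
    using decreasing_closed_nest[of "\<lambda>n. snd (K n)", OF cl(2) ne(2) _ nested_cball_small[OF p(2)]] dec by blast
  have "x \<in> C" "y \<in> C'" using x[of 0] y[of 0] K(1)[of 0] unfolding Q_def by auto
  then have "f x \<noteq> f' y" using disj by auto
  then obtain U V where UV: "open U" "open V" "f x \<in> U" "f' y \<in> V" "U \<inter> V = {}"
    using hausdorff[of "f x" "f' y"] by blast
  have "open (f -` U)" "open (f' -` V)" using UV f by (auto simp: continuous_on_open_vimage)
  then obtain e e' where e: "e > 0" "ball x e \<subseteq> f -` U" "e' > 0" "ball y e' \<subseteq> f' -` V"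
    using UV unfolding open_contains_ball by blast
  obtain n where n: "\<forall>m\<ge>n. fst (K m) \<subseteq> ball x e" using nested_small_ball[of "\<lambda>n. fst (K n)", OF p(1) x e(1)] by blast
  obtain n' where n': "\<forall>m\<ge>n'. snd (K m) \<subseteq> ball y e'" using nested_small_ball[of "\<lambda>n. snd (K n)", OF p(2) y e(3)] by blast
  define m where "m = max n n'"
  have "fst (K m) \<subseteq> ball x e" "snd (K m) \<subseteq> ball y e'"
    using n[rule_format, of m] n'[rule_format, of m] by (simp_all add: m_def)
  then have "fst (K m) \<subseteq> f -` U" "snd (K m) \<subseteq> f' -` V" using e by blast+
  then have "f ` fst (K m) \<subseteq> U" "f' ` snd (K m) \<subseteq> V" by (simp_all only: image_subset_iff_subset_vimage)
  then have "borel_separable (f ` fst (K m)) (f' ` snd (K m))"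
    unfolding borel_separable_def using UV by (intro bexI[of _ U]) auto
  then show False using K(1) unfolding Q_def by blast
qed

text \<open>Real sequences replace the Baire space because type \<open>nat\<close> carries no metric.\<close>
definition souslin :: "'a::topological_space set \<Rightarrow> bool" where
  "souslin A \<longleftrightarrow> (\<exists>C :: ('a \<times> (nat \<Rightarrow> real)) set. closed C \<and> A = fst ` C)"

lemma souslin_closed: "closed A \<Longrightarrow> souslin A"
  unfolding souslin_def by (rule exI[of _ "A \<times> UNIV"]) (auto intro: closed_Times)

lemma closed_vimage_fun:
  assumes "closed C" "continuous_on UNIV f"
  shows "closed {x. f x \<in> C}"
  using closed_vimage[OF assms(1,2)] by (simp add: vimage_def)

lemma continuous_on_snd_coordinate:
  "continuous_on UNIV (\<lambda>z :: 'a::topological_space \<times> ('i \<Rightarrow> 'b::topological_space). snd z k)"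
  by (rule continuous_on_product_then_coordinatewise[OF continuous_on_snd[OF continuous_on_id]])

text \<open>A single sequence carries witnesses for all the sets at once: its coordinates
  \<open>prod_encode (i, k)\<close> form the witness for \<open>A i\<close>.\<close>

lemma souslin_INT:
  assumes "\<And>i. souslin (A i)"
  shows "souslin (\<Inter>i::nat. A i)"
proof -
  have "\<exists>C. \<forall>i. closed (C i) \<and> A i = fst ` (C i :: ('a \<times> (nat \<Rightarrow> real)) set)"
    using assms unfolding souslin_def by (intro choice) blast
  then obtain C where "\<forall>i. closed (C i) \<and> A i = fst ` (C i :: ('a \<times> (nat \<Rightarrow> real)) set)" ..
  then have C: "\<And>i. closed (C i)" "\<And>i. A i = fst ` C i" by simp_all
  let ?g = "\<lambda>i z. (fst z, \<lambda>k. snd z (prod_encode (i, k))) :: 'a \<times> (nat \<Rightarrow> real)"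
  have g: "continuous_on UNIV (?g i)" for i
    by (intro continuous_on_Pair continuous_on_fst continuous_on_id
          continuous_on_coordinatewise_then_product continuous_on_snd_coordinate)
  show ?thesis unfolding souslin_def
  proof (intro exI conjI)
    show "closed (\<Inter>i. {z. ?g i z \<in> C i})"
      by (intro closed_INT ballI closed_vimage_fun C g)
    show "(\<Inter>i. A i) = fst ` (\<Inter>i. {z. ?g i z \<in> C i})"
    proof (intro equalityI subsetI)
      fix x assume "x \<in> (\<Inter>i. A i)"
      then have "\<forall>i. x \<in> fst ` C i" using C(2) by simp
      then have "\<forall>i. \<exists>s. (x, s) \<in> C i" by force
      then obtain s where s: "\<And>i. (x, s i) \<in> C i" by metis
      have "(x, \<lambda>n. s (fst (prod_decode n)) (snd (prod_decode n))) \<in> (\<Inter>i. {z. ?g i z \<in> C i})"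
        using s by simp
      then show "x \<in> fst ` (\<Inter>i. {z. ?g i z \<in> C i})" by (rule image_eqI[rotated]) simp
    next
      fix x assume "x \<in> fst ` (\<Inter>i. {z. ?g i z \<in> C i})"
      then obtain z where z: "x = fst z" "\<And>i. ?g i z \<in> C i" by blast
      have "x \<in> A i" for i using imageI[OF z(2)[of i], of fst] C(2)[of i] z(1) by simp
      then show "x \<in> (\<Inter>i. A i)" by blast
    qed
  qed
qed

lemma souslin_UN:
  assumes "\<And>i. souslin (A i)"
  shows "souslin (\<Union>i::nat. A i)"
proof -
  have "\<exists>C. \<forall>i. closed (C i) \<and> A i = fst ` (C i :: ('a \<times> (nat \<Rightarrow> real)) set)"
    using assms unfolding souslin_def by (intro choice) blast
  then obtain C where "\<forall>i. closed (C i) \<and> A i = fst ` (C i :: ('a \<times> (nat \<Rightarrow> real)) set)" ..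
  then have C: "\<And>i. closed (C i)" "\<And>i. A i = fst ` C i" by simp_all
  let ?g = "\<lambda>z. (fst z, \<lambda>k. snd z (Suc k)) :: 'a \<times> (nat \<Rightarrow> real)"
  \<comment> \<open>Coordinate 0 names the index of the piece and the shifted sequence is the
    witness. Writing the choice of index as an intersection keeps the set closed: the clause for
    \<open>i\<close> is vacuous unless coordinate 0 is \<open>i\<close>, since distinct naturals
    differ by more than 1/2.\<close>
  let ?D = "{z. snd z 0 \<in> \<nat>} \<inter> (\<Inter>i. {z. ?g z \<in> C i} \<union> {z. \<bar>snd z 0 - real i\<bar> \<in> {1/2..}})"
  have g: "continuous_on UNIV ?g"
    by (intro continuous_on_Pair continuous_on_fst continuous_on_id
          continuous_on_coordinatewise_then_product continuous_on_snd_coordinate)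
  have "continuous_on UNIV (\<lambda>z :: 'a \<times> (nat \<Rightarrow> real). \<bar>snd z 0 - real i\<bar>)" for i
    by (intro continuous_on_rabs continuous_on_diff continuous_on_const continuous_on_snd_coordinate)
  note cont = this continuous_on_snd_coordinate g
  show ?thesis unfolding souslin_def
  proof (intro exI conjI)
    show "closed ?D"
      by (intro closed_Int closed_INT ballI closed_Un closed_vimage_fun C cont closed_Nats closed_atLeast)
    show "(\<Union>i. A i) = fst ` ?D"
    proof (intro equalityI subsetI)
      fix x assume "x \<in> (\<Union>i. A i)"
      then obtain i where "x \<in> fst ` C i" using C(2) by auto
      then obtain s where s: "(x, s) \<in> C i" by force
      have "(x, case_nat (real i) s) \<in> ?D"
      proof -
        have "1/2 \<le> \<bar>real i - real j\<bar>" if "j \<noteq> i" for j using that by linarith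
        then have "j = i \<or> 1/2 \<le> \<bar>real i - real j\<bar>" for j by blast
        then show ?thesis using s by fastforce
      qed
      then show "x \<in> fst ` ?D" by (rule image_eqI[rotated]) simp
    next
      fix x assume "x \<in> fst ` ?D"
      then obtain z where z: "z \<in> ?D" "x = fst z" by blast
      then obtain i where "snd z 0 = real i" by (auto elim: Nats_cases)
      then have "?g z \<in> C i" using z by auto
      then have "x \<in> A i" using imageI[of "?g z" "C i" fst] C(2)[of i] z(2) by simp
      then show "x \<in> (\<Union>i. A i)" by blast
    qed
  qed
qed

lemma open_UN_closed:
  fixes U :: "'a::metric_space set"
  assumes "open U"
  shows "\<exists>F. (\<forall>n::nat. closed (F n)) \<and> U = (\<Union>n. F n)"
\<comment> \<open>\<open>infdist\<close> to the empty set is 0 by convention, so the description by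
  distance to the complement fails for \<open>UNIV\<close>.\<close>
proof (cases "U = UNIV")
  case False
  define F where "F n = {x. 1 / real (Suc n) \<le> infdist x (- U)}" for n
  have "closed (F n)" for n unfolding F_def
    by (intro closed_Collect_le continuous_intros)
  moreover have "x \<in> U \<longleftrightarrow> (\<exists>n. x \<in> F n)" for x
  proof -
    have "x \<in> U \<longleftrightarrow> infdist x (- U) \<noteq> 0"
      using in_closed_iff_infdist_zero[of "- U" x] assms False by auto
    also have "\<dots> \<longleftrightarrow> infdist x (- U) > 0" using infdist_nonneg[of x "- U"] by linarith
    also have "\<dots> \<longleftrightarrow> (\<exists>n. 1 / real (Suc n) \<le> infdist x (- U))"
    proof
      assume "infdist x (- U) > 0"
      then show "\<exists>n. 1 / real (Suc n) \<le> infdist x (- U)"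
        using reals_Archimedean[of "infdist x (- U)"] unfolding inverse_eq_divide by (blast intro: less_imp_le)
    next
      assume "\<exists>n. 1 / real (Suc n) \<le> infdist x (- U)"
      then obtain n where "1 / real (Suc n) \<le> infdist x (- U)" ..
      moreover have "0 < 1 / real (Suc n)" by simp
      ultimately show "infdist x (- U) > 0" by linarith
    qed
    finally show ?thesis by (simp only: F_def mem_Collect_eq)
  qed
  then have "U = (\<Union>n. F n)" by blast
  ultimately show ?thesis by blast
qed (intro exI[of _ "\<lambda>_. UNIV"], auto)

lemma borel_souslin:
  fixes A :: "'a::metric_space set"
  assumes "A \<in> sets borel"
  shows "souslin A"
proof -
  have "A \<in> sigma_sets UNIV (Collect closed)" using assms by (simp add: borel_eq_closed)
  \<comment> \<open>Souslin sets are not closed under complement, so the induction carries the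
    complement along.\<close>
  then have "souslin A \<and> souslin (- A)"
  proof induction
    case (Basic a)
    then have a: "closed a" by simp
    obtain F where F: "\<And>n::nat. closed (F n)" "- a = (\<Union>n. F n)"
      using open_UN_closed[of "- a"] a by auto
    have "souslin (\<Union>n. F n)" by (intro souslin_UN souslin_closed F)
    then show ?case using a F souslin_closed by auto
  next
    case Empty then show ?case by (auto intro!: souslin_closed)
  next
    case (Compl a) then show ?case by (simp add: Compl_eq_Diff_UNIV[symmetric])
  next
    case (Union a)
    then show ?case using souslin_UN[of a] souslin_INT[of "\<lambda>i. - a i"] by (simp add: Compl_UN)
  qed
  then show ?thesis by simp
qed

theorem borel_separation_fst:
  fixes B B' :: "('a::{complete_space, second_countable_topology} \<times> 'b::{complete_space, second_countable_topology}) set"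
  assumes "B \<in> sets borel" "B' \<in> sets borel" "fst ` B \<inter> fst ` B' = {}"
  shows "borel_separable (fst ` B) (fst ` B')"
proof -
  obtain C C' :: "(('a \<times> 'b) \<times> (nat \<Rightarrow> real)) set"
    where C: "closed C" "B = fst ` C" "closed C'" "B' = fst ` C'"
    using borel_souslin[OF assms(1)] borel_souslin[OF assms(2)] unfolding souslin_def by (elim exE conjE)
  have c: "continuous_on UNIV (\<lambda>z::('a \<times> 'b) \<times> (nat \<Rightarrow> real). fst (fst z))"
    by (intro continuous_intros)
  have eq: "fst ` B = (\<lambda>z. fst (fst z)) ` C" "fst ` B' = (\<lambda>z. fst (fst z)) ` C'" using C by (auto simp: image_image)
  show ?thesis unfolding eq
    by (rule borel_separation[OF C(1,3) c c]) (use assms(3) eq in auto)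
qed

text \<open>Lusin-Souslin for injective projections. Since each section has at most one point, the
  part of \<open>B\<close> over a ball and the part over its complement have disjoint projections. A
  separating Borel set then decides from \<open>x\<close> alone whether the point \<open>y\<close>
  above it lies in the ball. Countably many such decisions give a Borel map \<open>L\<close> that
  returns \<open>y\<close>, and the projection is the set where the graph of \<open>L\<close> meets
  \<open>B\<close>.\<close>

theorem borel_fst_unique_sections:
  fixes B :: "('a::{complete_space, second_countable_topology} \<times> 'b::{complete_space, second_countable_topology}) set"
  assumes B[measurable]: "B \<in> sets borel" and uniq: "\<And>x y z. (x, y) \<in> B \<Longrightarrow> (x, z) \<in> B \<Longrightarrow> y = z"
  shows "fst ` B \<in> sets borel"
proof -
  obtain d :: "nat \<Rightarrow> 'b" where d: "\<And>e. e > 0 \<Longrightarrow> (\<Union>i. cball (d i) e) = UNIV"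
    using countable_cball_cover by blast
  have [measurable]: "B \<in> sets (borel \<Otimes>\<^sub>M borel)" using B by (simp only: borel_prod)
  let ?V = "\<lambda>i k. cball (d i) ((1/2)^k)"
  have "borel_separable (fst ` (B \<inter> UNIV \<times> ?V i k)) (fst ` (B \<inter> UNIV \<times> (- ?V i k)))" for i k
  proof (rule borel_separation_fst)
    have "UNIV \<times> X \<in> sets (borel :: ('a \<times> 'b) measure)" if "X \<in> sets borel" for X
      using that by (simp add: borel_prod[symmetric])
    then show "B \<inter> UNIV \<times> ?V i k \<in> sets borel" "B \<inter> UNIV \<times> (- ?V i k) \<in> sets borel" using B by auto
    show "fst ` (B \<inter> UNIV \<times> ?V i k) \<inter> fst ` (B \<inter> UNIV \<times> (- ?V i k)) = {}"
    proof (rule equals0I)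
      fix x assume "x \<in> fst ` (B \<inter> UNIV \<times> ?V i k) \<inter> fst ` (B \<inter> UNIV \<times> (- ?V i k))"
      then obtain y z where "(x, y) \<in> B" "y \<in> ?V i k" "(x, z) \<in> B" "z \<notin> ?V i k"
        by (auto simp del: mem_cball)
      then show False using uniq by blast
    qed
  qed
  then have "\<forall>i k. \<exists>S\<in>sets borel. fst ` (B \<inter> UNIV \<times> ?V i k) \<subseteq> S \<and> S \<inter> fst ` (B \<inter> UNIV \<times> (- ?V i k)) = {}"
    unfolding borel_separable_def by blast
  then obtain S where "\<forall>i k. S i k \<in> sets borel \<and> fst ` (B \<inter> UNIV \<times> ?V i k) \<subseteq> S i k
      \<and> S i k \<inter> fst ` (B \<inter> UNIV \<times> (- ?V i k)) = {}"
    unfolding Bex_def choice_iff by (elim exE)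
  then have S[measurable]: "\<And>i k. S i k \<in> sets borel"
    and S1: "\<And>i k. fst ` (B \<inter> UNIV \<times> ?V i k) \<subseteq> S i k"
    and S2: "\<And>i k. S i k \<inter> fst ` (B \<inter> UNIV \<times> (- ?V i k)) = {}"
    by blast+
  have S_iff: "x \<in> S i k \<longleftrightarrow> y \<in> ?V i k" if "(x, y) \<in> B" for x y i k
  proof (cases "y \<in> ?V i k")
    case True
    then have "x \<in> fst ` (B \<inter> UNIV \<times> ?V i k)" using that by force
    then show ?thesis using S1[of i k] True by blast
  next
    case False
    then have "x \<in> fst ` (B \<inter> UNIV \<times> (- ?V i k))" using that by force
    then show ?thesis using S2[of i k] False by blast
  qed
  define a where "a k x = d (LEAST i. x \<in> S i k)" for k x
  have [measurable]: "a k \<in> borel_measurable borel" for k unfolding a_def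
  proof -
    have "(\<lambda>x. LEAST i. x \<in> S i k) \<in> measurable borel (count_space UNIV)" by measurable
    then show "(\<lambda>x. d (LEAST i. x \<in> S i k)) \<in> borel_measurable borel" by measurable
  qed
  \<comment> \<open>Outside the projection the approximations need not converge. Replacing them
    there by a constant makes the limit exist everywhere, hence a Borel function.\<close>
  define b where "b k x = (if Cauchy (\<lambda>k. a k x) then a k x else d 0)" for k x
  have [measurable]: "b k \<in> borel_measurable borel" for k unfolding b_def by measurable
  have conv: "(\<lambda>k. b k x) \<longlonglongrightarrow> lim (\<lambda>k. b k x)" for x
    by (cases "Cauchy (\<lambda>k. a k x)")
       (auto simp: b_def Cauchy_convergent_iff convergent_LIMSEQ_iff[symmetric])
  define L where "L x = lim (\<lambda>k. b k x)" for x
  have [measurable]: "L \<in> borel_measurable borel"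
    by (rule borel_measurable_LIMSEQ_metric[of b]) (use conv in \<open>auto simp: L_def\<close>)
  have L: "L x = y" if "(x, y) \<in> B" for x y
  proof -
    have dist: "dist (a k x) y \<le> (1/2)^k" for k
    proof -
      have "\<exists>i. x \<in> S i k" using d[of "(1/2)^k"] S_iff[OF that] by (auto simp del: mem_cball)
      from LeastI_ex[OF this] show ?thesis using S_iff[OF that] by (auto simp: a_def)
    qed
    have lim: "(\<lambda>k. a k x) \<longlonglongrightarrow> y"
    proof (rule metric_LIMSEQ_I)
      fix e :: real assume "e > 0"
      then obtain n where n: "(1/2::real)^n < e" using real_arch_pow_inv[of e "1/2"] by auto
      have "dist (a k x) y < e" if "k \<ge> n" for k
      proof -
        have "(1/2::real)^k \<le> (1/2)^n" using that by (intro power_decreasing) auto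
        then show ?thesis using dist[of k] n by linarith
      qed
      then show "\<exists>n. \<forall>k\<ge>n. dist (a k x) y < e" by blast
    qed
    then have "Cauchy (\<lambda>k. a k x)" by (intro convergent_Cauchy) (auto simp: convergent_def)
    then show ?thesis using lim limI unfolding L_def b_def by simp
  qed
  have "fst ` B = {x\<in>space borel. (x, L x) \<in> B}" using L by force
  also have "\<dots> \<in> sets borel" by measurable
  finally show ?thesis .
qed

lemma finite_separated:
  fixes Y :: "'a::metric_space set"
  assumes "finite Y"
  shows "\<exists>r>0. \<forall>y\<in>Y. \<forall>z\<in>Y. y \<noteq> z \<longrightarrow> r \<le> dist y z"
proof -
  let ?D = "insert 1 ((\<lambda>(y, z). dist y z) ` {p \<in> Y \<times> Y. fst p \<noteq> snd p})"
  have fin: "finite ?D" using assms by (auto intro!: finite_imageI finite_subset[of _ "Y \<times> Y"])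
  show ?thesis
  proof (intro exI[of _ "Min ?D"] conjI ballI impI)
    show "0 < Min ?D" using fin by (subst Min_gr_iff) auto
    fix y z assume "y \<in> Y" "z \<in> Y" "y \<noteq> z"
    then show "Min ?D \<le> dist y z" using fin by (intro Min_le) force+
  qed
qed

lemma open_basis_sequence:
  obtains b :: "nat \<Rightarrow> 'a::second_countable_topology set"
  where "\<And>i. open (b i)" "\<And>U y. open U \<Longrightarrow> y \<in> U \<Longrightarrow> \<exists>i. y \<in> b i \<and> b i \<subseteq> U"
proof -
  obtain \<B> :: "'a set set" where \<B>: "countable \<B>" "topological_basis \<B>" using ex_countable_basis by auto
  have ne: "\<B> \<noteq> {}"
  proof -
    obtain V where "V \<in> \<B>" "undefined \<in> V" using topological_basisE[OF \<B>(2) open_UNIV UNIV_I[of undefined]] by blast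
    then show ?thesis by blast
  qed
  show ?thesis
  proof
    show "open (from_nat_into \<B> i)" for i
      using from_nat_into[OF ne] \<B>(2) topological_basis_open by blast
    fix U :: "'a set" and y assume U: "open U" "y \<in> U"
    obtain V where "V \<in> \<B>" "y \<in> V" "V \<subseteq> U" using topological_basisE[OF \<B>(2) U] by blast
    then show "\<exists>i. y \<in> from_nat_into \<B> i \<and> from_nat_into \<B> i \<subseteq> U"
      using from_nat_into_surj[OF \<B>(1)] by metis
  qed
qed

text \<open>Induction on the bound. A section with exactly \<open>Suc D\<close> points can be listed
  as a tuple lying in pairwise disjoint basic open sets. For fixed open sets this tuple is unique,
  as a second one would need a further point, so uniqueness of sections applies to tuples. Removing
  these \<open>x\<close> for all of the countably many choices of open sets leaves sections with at
  most \<open>D\<close> points.\<close>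

theorem borel_fst_finite_sections:
  fixes B :: "('a::{complete_space, second_countable_topology} \<times> 'b::{complete_space, second_countable_topology}) set"
  assumes "B \<in> sets borel" "\<And>x. finite {y. (x, y) \<in> B}" "\<And>x. card {y. (x, y) \<in> B} \<le> D"
  shows "fst ` B \<in> sets borel"
  using assms
proof (induction D arbitrary: B)
  case 0
  then have "{y. (x, y) \<in> B} = {}" for x by auto
  then have "B = {}" by auto
  then show ?case by simp
next
  case (Suc D)
  note [measurable] = Suc.prems(1)
  have [measurable]: "B \<in> sets (borel \<Otimes>\<^sub>M borel)" using Suc.prems(1) by (simp only: borel_prod)
  obtain b :: "nat \<Rightarrow> 'b set" where b_open: "\<And>i. open (b i)"
    and b_ex: "\<And>U y. open U \<Longrightarrow> y \<in> U \<Longrightarrow> \<exists>i. y \<in> b i \<and> b i \<subseteq> U"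
    using open_basis_sequence by blast
  have [measurable]: "b i \<in> sets borel" for i using b_open by simp
  define dis where "dis v \<longleftrightarrow> length v = Suc D \<and> (\<forall>i\<le>D. \<forall>j\<le>D. i \<noteq> j \<longrightarrow> b (v!i) \<inter> b (v!j) = {})" for v
  define P where "P v = {x. \<forall>i\<le>D. \<exists>y\<in>b (v!i). (x, y) \<in> B}" for v
  have P_borel: "P v \<in> sets borel" if v: "dis v" for v
  proof -
    \<comment> \<open>Tuples are coded as infinite sequences; pinning the coordinates above
      \<open>D\<close> to coordinate 0 preserves uniqueness.\<close>
    define Z where "Z = {p. (\<forall>i\<in>{..D}. snd p i \<in> b (v!i) \<and> (fst p, snd p i) \<in> B) \<and> (\<forall>i\<in>{D<..}. snd p i = snd p 0)}"
    have [measurable]: "(\<lambda>p :: 'a \<times> (nat \<Rightarrow> 'b). snd p i) \<in> borel_measurable borel" for i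
      by (rule borel_measurable_continuous_onI[OF continuous_on_snd_coordinate])
    have [measurable]: "fst \<in> borel_measurable (borel :: ('a \<times> (nat \<Rightarrow> 'b)) measure)"
      by (intro borel_measurable_continuous_onI continuous_on_fst continuous_on_id)
    have "Z = {p\<in>space borel. (\<forall>i\<in>{..D}. snd p i \<in> b (v!i) \<and> (fst p, snd p i) \<in> B) \<and> (\<forall>i\<in>{D<..}. snd p i = snd p 0)}"
      by (simp add: Z_def)
    also have "\<dots> \<in> sets borel" by measurable
    finally have Z: "Z \<in> sets borel" .
    have "fst ` Z \<in> sets borel"
    proof (rule borel_fst_unique_sections[OF Z])
      fix x s t assume s: "(x, s) \<in> Z" and t: "(x, t) \<in> Z"
      have eq: "s i = t i" if i: "i \<le> D" for i
      proof (rule ccontr)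
        assume ne: "s i \<noteq> t i"
        have bs: "s j \<in> b (v!j)" "t j \<in> b (v!j)" if "j \<le> D" for j using s t that by (auto simp: Z_def)
        have inj: "inj_on s {..D}"
        proof (rule inj_onI)
          fix j k assume "j \<in> {..D}" "k \<in> {..D}" "s j = s k"
          then show "j = k" using bs(1)[of j] bs(1)[of k] v unfolding dis_def by (metis IntI atMost_iff empty_iff)
        qed
        have "t i \<notin> s ` {..D}"
        proof
          assume "t i \<in> s ` {..D}"
          then obtain j where j: "j \<le> D" "t i = s j" by auto
          then have "j = i" using bs(1)[of j] bs(2)[of i] v i unfolding dis_def by (metis IntI empty_iff)
          then show False using j ne by simp
        qed
        then have "card (insert (t i) (s ` {..D})) = Suc (Suc D)" using card_image[OF inj] by simp
        moreover have "insert (t i) (s ` {..D}) \<subseteq> {y. (x, y) \<in> B}"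
          using s t i unfolding Z_def by simp blast
        ultimately have "Suc (Suc D) \<le> card {y. (x, y) \<in> B}" using card_mono[OF Suc.prems(2)[of x]] by metis
        then show False using Suc.prems(3)[of x] by simp
      qed
      show "s = t"
      proof
        fix i show "s i = t i"
        proof (cases "i \<le> D")
          case False
          then have "s i = s 0" "t i = t 0" using s t by (auto simp: Z_def)
          then show ?thesis using eq[of 0] by simp
        qed (rule eq)
      qed
    qed
    also have "fst ` Z = P v"
    proof (intro equalityI subsetI)
      fix x assume "x \<in> fst ` Z" then show "x \<in> P v" by (auto simp: Z_def P_def)
    next
      fix x assume "x \<in> P v"
      then obtain y where y: "\<And>i. i \<le> D \<Longrightarrow> y i \<in> b (v!i) \<and> (x, y i) \<in> B" unfolding P_def Bex_def mem_Collect_eq by metis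
      then have "(x, \<lambda>i. if i \<le> D then y i else y 0) \<in> Z" by (auto simp: Z_def)
      then show "x \<in> fst ` Z" by force
    qed
    finally show ?thesis .
  qed
  define Q where "Q = (\<Union>v\<in>Collect dis. P v)"
  have Q: "Q \<in> sets borel" unfolding Q_def
    by (rule sets.countable_UN') (use P_borel in auto)
  have [measurable]: "Q \<in> sets borel" by fact
  define B' where "B' = {p \<in> space (borel \<Otimes>\<^sub>M borel). p \<in> B \<and> fst p \<notin> Q}"
  have "fst ` B' \<in> sets borel"
  proof (rule Suc.IH)
    have "B' \<in> sets (borel \<Otimes>\<^sub>M borel)" unfolding B'_def by measurable
    then show "B' \<in> sets borel" by (simp only: borel_prod)
    fix x
    have sub: "{y. (x, y) \<in> B'} \<subseteq> {y. (x, y) \<in> B}" by (auto simp: B'_def)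
    show fin: "finite {y. (x, y) \<in> B'}" using finite_subset[OF sub Suc.prems(2)] .
    show "card {y. (x, y) \<in> B'} \<le> D"
    proof (rule ccontr)
      assume "\<not> card {y. (x, y) \<in> B'} \<le> D"
      then have "card {y. (x, y) \<in> B'} = Suc D" using card_mono[OF Suc.prems(2) sub] Suc.prems(3)[of x] by linarith
      then obtain y where y: "bij_betw y {0..<Suc D} {y. (x, y) \<in> B'}" using ex_bij_betw_nat_finite[OF fin] by auto
      obtain r where r: "r > 0" "\<And>y z. (x, y) \<in> B' \<Longrightarrow> (x, z) \<in> B' \<Longrightarrow> y \<noteq> z \<Longrightarrow> r \<le> dist y z"
        using finite_separated[OF fin] by blast
      have "\<forall>i. \<exists>k. y i \<in> b k \<and> b k \<subseteq> ball (y i) (r/2)" using r by (intro allI b_ex) auto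
      then obtain k where k: "\<And>i. y i \<in> b (k i)" "\<And>i. b (k i) \<subseteq> ball (y i) (r/2)" by metis
      define v where "v = map k [0..<Suc D]"
      have v: "v ! i = k i" if "i \<le> D" for i using that unfolding v_def by (subst nth_map) (auto simp del: upt_Suc)
      have yB: "(x, y i) \<in> B'" if "i \<le> D" for i using bij_betwE[OF y] that by auto
      have "dis v" unfolding dis_def
      proof (intro conjI allI impI)
        show "length v = Suc D" by (simp add: v_def)
        fix i j assume ij: "i \<le> D" "j \<le> D" "i \<noteq> j"
        then have "y i \<noteq> y j" using y unfolding bij_betw_def inj_on_def by auto
        then have "r \<le> dist (y i) (y j)" using r(2) yB ij by blast
        then have "ball (y i) (r/2) \<inter> ball (y j) (r/2) = {}" by (intro disjoint_ballI) auto
        then show "b (v ! i) \<inter> b (v ! j) = {}" using k(2)[of i] k(2)[of j] v ij by auto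
      qed
      moreover have "x \<in> P v" using k(1) yB v by (auto simp: P_def B'_def)
      ultimately have "x \<in> Q" by (auto simp: Q_def)
      moreover have "x \<notin> Q" using yB[of 0] by (auto simp: B'_def)
      ultimately show False by simp
    qed
  qed
  moreover have "fst ` B = Q \<union> fst ` B'"
  proof (intro equalityI subsetI)
    fix x assume "x \<in> fst ` B" then show "x \<in> Q \<union> fst ` B'" by (force simp: B'_def space_pair_measure)
  next
    fix x assume x: "x \<in> Q \<union> fst ` B'"
    have "x \<in> fst ` B" if "x \<in> Q" using that by (force simp: Q_def P_def)
    then show "x \<in> fst ` B" using x by (auto simp: B'_def)
  qed
  ultimately show ?case using Q by auto
qed

section \<open>Enumerating the orbits of a graphing\<close>

lemma sigma_algebra_uprod_sets:
  "sigma_algebra UNIV (uprod_sets :: ('a::topological_space) uprod set set)"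
proof -
  let ?q = "\<lambda>p :: 'a \<times> 'a. Upair (fst p) (snd p)"
  have "uprod_sets \<subseteq> Pow UNIV" by simp
  then show ?thesis unfolding sigma_algebra_iff2
  proof (intro conjI ballI allI impI)
    show "{} \<in> (uprod_sets :: 'a uprod set set)" by (simp add: uprod_sets_def)
    fix A :: "'a uprod set" assume "A \<in> uprod_sets"
    then have "UNIV - ?q -` A \<in> sets borel" unfolding uprod_sets_def by (metis mem_Collect_eq sets.compl_sets space_borel)
    then show "UNIV - A \<in> uprod_sets" by (simp add: uprod_sets_def vimage_Diff)
  next
    fix A :: "nat \<Rightarrow> 'a uprod set" assume "range A \<subseteq> uprod_sets"
    then have "(\<Union>i. ?q -` A i) \<in> sets borel" unfolding uprod_sets_def by (intro sets.countable_UN) auto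
    then show "(\<Union>i. A i) \<in> uprod_sets" by (simp add: uprod_sets_def vimage_UN)
  qed
qed

lemma Upair_commute: "Upair x y = Upair y x"
  by simp

lemma adj_mono: "F \<subseteq> G \<Longrightarrow> adj F \<subseteq> adj G"
  by (auto simp: adj_def)

lemma sym_adj: "sym (adj F)"
proof (rule symI)
  fix u v assume "(u, v) \<in> adj F"
  moreover have "Upair v u = Upair u v" by simp
  ultimately show "(v, u) \<in> adj F" by (simp add: adj_def del: Upair_inject)
qed

lemma comp_refl: "x \<in> comp F x"
  by (simp add: comp_def)

lemma comp_trans: "y \<in> comp F x \<Longrightarrow> z \<in> comp F y \<Longrightarrow> z \<in> comp F x"
  by (auto simp: comp_def)

lemma comp_sym: "y \<in> comp F x \<Longrightarrow> x \<in> comp F y"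
  unfolding comp_def mem_Collect_eq by (rule symD[OF sym_rtrancl[OF sym_adj]])

lemma comp_eq:
  assumes "y \<in> comp F x"
  shows "comp F y = comp F x"
  using comp_trans[OF assms] comp_trans[OF comp_sym[OF assms]] by (intro equalityI subsetI)

lemma comp_mono: "F \<subseteq> G \<Longrightarrow> comp F x \<subseteq> comp G x"
  unfolding comp_def using rtrancl_mono[OF adj_mono[of F G]] by blast

lemma Upair_in_comp: "Upair x y \<in> F \<Longrightarrow> y \<in> comp F x"
  unfolding comp_def adj_def by (simp add: r_into_rtrancl)

lemma comp_step: "y \<in> comp F x \<Longrightarrow> Upair y z \<in> F \<Longrightarrow> z \<in> comp F x"
  unfolding comp_def adj_def by (simp add: rtrancl_into_rtrancl)

locale graphing_space =
  fixes M :: "'a::polish_space measure" and E :: "'a uprod set"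
  assumes graphing: "graphing M E"
begin

lemma sets_M[measurable_cong]: "sets M = sets borel"
  using graphing unfolding graphing_def by blast

lemma space_M[simp]: "space M = UNIV"
  using sets_eq_imp_space_eq[OF sets_M] by simp

sublocale prob_space M
  using graphing unfolding graphing_def by blast

lemma E_uprod_sets: "E \<in> uprod_sets"
  using graphing unfolding graphing_def by blast

lemma Upair_E_neq: "Upair x y \<in> E \<Longrightarrow> x \<noteq> y"
  using graphing unfolding graphing_def by fastforce

lemma finite_nbrs: "finite {y. Upair x y \<in> E}"
  using graphing unfolding graphing_def by blast

definition deg_bound :: nat where
  "deg_bound = (SOME D. \<forall>x. card {y. Upair x y \<in> E} \<le> D)"

lemma card_nbrs: "card {y. Upair x y \<in> E} \<le> deg_bound"
proof -
  have "\<exists>D. \<forall>x. card {y. Upair x y \<in> E} \<le> D" using graphing unfolding graphing_def by blast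
  from someI_ex[OF this] show ?thesis unfolding deg_bound_def by blast
qed

lemma deg_transport:
  assumes "A \<in> sets borel" "B \<in> sets borel"
  shows "(\<integral>\<^sup>+x\<in>A. ennreal (real (deg E B x)) \<partial>M) = (\<integral>\<^sup>+x\<in>B. ennreal (real (deg E A x)) \<partial>M)"
  using graphing assms sets_M unfolding graphing_def by blast

definition touching :: "'a set \<Rightarrow> 'a set" where
  "touching A = {x. \<exists>y\<in>A. Upair x y \<in> E}"

lemma touching_borel[measurable]:
  assumes [measurable]: "A \<in> sets borel"
  shows "touching A \<in> sets borel"
proof -
  let ?B = "{p. Upair (fst p) (snd p) \<in> E} \<inter> UNIV \<times> A"
  have "?B \<in> sets borel"
  proof (rule sets.Int)
    show "{p. Upair (fst p) (snd p) \<in> E} \<in> sets borel"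
      using E_uprod_sets unfolding uprod_sets_def vimage_def by simp
    have "(UNIV :: 'a set) \<times> A \<in> sets (borel \<Otimes>\<^sub>M borel)" using assms by (intro pair_measureI) auto
    then show "(UNIV :: 'a set) \<times> A \<in> sets borel" by (simp only: borel_prod)
  qed
  moreover have "{y. (x, y) \<in> ?B} \<subseteq> {y. Upair x y \<in> E}" for x by auto
  ultimately have "fst ` ?B \<in> sets borel"
    using card_nbrs by (intro borel_fst_finite_sections[where D=deg_bound])
      (auto intro: finite_subset[OF _ finite_nbrs] order_trans[OF card_mono[OF finite_nbrs]])
  moreover have "fst ` ?B = touching A" by (force simp: touching_def)
  ultimately show ?thesis by simp
qed

definition single :: "'a set \<Rightarrow> 'a set" where
  "single V = {x. \<exists>!y. y \<in> V \<and> Upair x y \<in> E}"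

text \<open>Two different neighbours in \<open>V\<close> are told apart by some basic open set, one
  lying inside it and the other outside. Uniqueness is thus a countable condition on the Borel sets
  \<open>touching\<close>.\<close>

lemma single_borel[measurable]:
  assumes [measurable]: "V \<in> sets borel"
  shows "single V \<in> sets borel"
proof -
  obtain b :: "nat \<Rightarrow> 'a set" where b_open: "\<And>i. open (b i)"
    and b_ex: "\<And>U y. open U \<Longrightarrow> y \<in> U \<Longrightarrow> \<exists>i. y \<in> b i \<and> b i \<subseteq> U"
    using open_basis_sequence by blast
  have [measurable]: "b i \<in> sets borel" for i using b_open by simp
  have "single V = touching V - (\<Union>k. touching (V \<inter> b k) \<inter> touching (V - b k))"
  proof (intro equalityI subsetI DiffI)
    fix x assume x: "x \<in> touching V - (\<Union>k. touching (V \<inter> b k) \<inter> touching (V - b k))"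
    then obtain y where y: "y \<in> V" "Upair x y \<in> E" by (auto simp: touching_def)
    moreover have "z = y" if z: "z \<in> V" "Upair x z \<in> E" for z
    proof (rule ccontr)
      assume "z \<noteq> y"
      then obtain k where "y \<in> b k" "b k \<subseteq> - {z}" using b_ex[of "- {z}" y] by auto
      then have "x \<in> touching (V \<inter> b k) \<inter> touching (V - b k)" using y z by (auto simp: touching_def)
      then show False using x by blast
    qed
    ultimately show "x \<in> single V" unfolding single_def by blast
  qed (auto simp: single_def touching_def)
  also have "\<dots> \<in> sets borel" by measurable
  finally show ?thesis .
qed

text \<open>Uniqueness is asked from both ends, so that \<open>mate V\<close> and
  \<open>mate U\<close> are inverse bijections between \<open>matched U V\<close> and
  \<open>matched V U\<close>.\<close>

definition matched :: "'a set \<Rightarrow> 'a set \<Rightarrow> 'a set" where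
  "matched U V = U \<inter> single V \<inter> touching (V \<inter> single U)"

lemma matched_borel[measurable]:
  assumes [measurable]: "U \<in> sets borel" "V \<in> sets borel"
  shows "matched U V \<in> sets borel"
  unfolding matched_def by measurable

definition mate :: "'a set \<Rightarrow> 'a \<Rightarrow> 'a" where
  "mate V x = (THE y. y \<in> V \<and> Upair x y \<in> E)"

lemma mate:
  assumes "x \<in> single V"
  shows "mate V x \<in> V" "Upair x (mate V x) \<in> E"
  using theI'[of "\<lambda>y. y \<in> V \<and> Upair x y \<in> E"] assms unfolding mate_def single_def by auto

lemma mate_eq:
  assumes "x \<in> single V" "y \<in> V" "Upair x y \<in> E"
  shows "mate V x = y"
  using mate[OF assms(1)] assms unfolding single_def by blast

lemma mate_in_iff:
  assumes s: "x \<in> single V"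
  shows "mate V x \<in> A \<longleftrightarrow> x \<in> touching (V \<inter> A)"
proof
  assume "mate V x \<in> A"
  then show "x \<in> touching (V \<inter> A)" using mate[OF s] by (auto simp: touching_def)
next
  assume "x \<in> touching (V \<inter> A)"
  then obtain y where "y \<in> V" "y \<in> A" "Upair x y \<in> E" by (auto simp: touching_def)
  then show "mate V x \<in> A" using mate_eq[OF s] by simp
qed

lemma matched_mate:
  assumes x: "x \<in> matched U V"
  shows "mate V x \<in> matched V U" "mate U (mate V x) = x"
proof -
  have xs: "x \<in> single V" "x \<in> U" using x by (auto simp: matched_def)
  obtain y where y: "y \<in> V" "y \<in> single U" "Upair x y \<in> E" using x by (auto simp: matched_def touching_def)
  have eq: "mate V x = y" using mate_eq[OF xs(1) y(1,3)] .
  have yx: "Upair y x \<in> E" using y(3) Upair_commute by metis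
  show "mate U (mate V x) = x" unfolding eq by (rule mate_eq[OF y(2) xs(2) yx])
  show "mate V x \<in> matched V U" unfolding eq using y xs yx by (auto simp: matched_def touching_def)
qed

lemma matched_nbrs:
  assumes x: "x \<in> matched U V"
  shows "{y \<in> matched V U. Upair x y \<in> E} = {mate V x}"
proof -
  have s: "x \<in> single V" using x by (simp add: matched_def)
  have "y = mate V x" if y: "y \<in> matched V U" "Upair x y \<in> E" for y
  proof -
    have "y \<in> V" using y(1) by (simp add: matched_def)
    then show ?thesis using mate_eq[OF s _ y(2)] by simp
  qed
  then show ?thesis using mate(2)[OF s] matched_mate(1)[OF x] by blast
qed

text \<open>These involutions exchange the ends of the edges that are isolated between \<open>U\<close> and \<open>V\<close>. For \<open>U\<close>, \<open>V\<close> in a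
  countable base they generate the connectedness relation, and \<open>deg_transport\<close> says that they preserve \<open>M\<close>.\<close>
definition swap :: "'a set \<Rightarrow> 'a set \<Rightarrow> 'a \<Rightarrow> 'a" where
  "swap U V x = (if U \<inter> V \<noteq> {} then x else if x \<in> matched U V then mate V x
     else if x \<in> matched V U then mate U x else x)"

lemma matched_disjoint: "U \<inter> V = {} \<Longrightarrow> matched U V \<inter> matched V U = {}"
  by (auto simp: matched_def)

lemma swap_swap: "swap U V (swap U V x) = x"
  using matched_mate[of x U V] matched_mate[of x V U] matched_disjoint[of U V]
  unfolding swap_def by auto

lemma swap_vimage:
  assumes "U \<inter> V = {}"
  shows "swap U V -` A = (matched U V \<inter> touching (V \<inter> A)) \<union> (matched V U \<inter> touching (U \<inter> A))
    \<union> (A - matched U V - matched V U)"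
proof -
  have eq1: "swap U V x = mate V x" if "x \<in> matched U V" for x
    using assms that by (simp add: swap_def)
  have eq2: "swap U V x = mate U x" if "x \<in> matched V U" for x
    using assms that matched_disjoint[OF assms] by (auto simp: swap_def)
  have eq3: "swap U V x = x" if "x \<notin> matched U V" "x \<notin> matched V U" for x
    using that by (simp add: swap_def)
  have "swap U V x \<in> A \<longleftrightarrow> x \<in> (matched U V \<inter> touching (V \<inter> A)) \<union> (matched V U \<inter> touching (U \<inter> A))
    \<union> (A - matched U V - matched V U)" for x
  proof (cases "x \<in> matched U V")
    case True
    moreover have "x \<notin> matched V U" using True matched_disjoint[OF assms] by blast
    moreover have "x \<in> single V" using True by (simp add: matched_def)
    ultimately show ?thesis using mate_in_iff[of x V A] eq1[of x] by simp
  next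
    case False
    show ?thesis
    proof (cases "x \<in> matched V U")
      case True
      moreover have "x \<in> single U" using True by (simp add: matched_def)
      ultimately show ?thesis using False mate_in_iff[of x U A] eq2[of x] by simp
    qed (use False eq3 in simp)
  qed
  then show ?thesis by (intro set_eqI) (simp only: vimage_eq)
qed

text \<open>The edges between the two matched sets form a perfect matching, so all degrees in
  \<open>deg_transport\<close> are 0 or 1 and its integrals become measures of sets.\<close>

lemma emeasure_matched:
  assumes [measurable]: "U \<in> sets borel" "V \<in> sets borel" "A \<in> sets borel"
  shows "emeasure M (matched U V \<inter> touching (V \<inter> A)) = emeasure M (A \<inter> matched V U)"
proof -
  let ?B = "A \<inter> matched V U"
  have "deg E ?B x = (if x \<in> touching (V \<inter> A) then 1 else 0)" if x: "x \<in> matched U V" for x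
  proof -
    have s: "x \<in> single V" using x by (simp add: matched_def)
    have "{y \<in> ?B. Upair x y \<in> E} = {mate V x} \<inter> A"
      using matched_nbrs[OF x] by blast
    then show ?thesis using mate_in_iff[OF s, of A] by (auto simp: deg_def)
  qed
  then have "(\<integral>\<^sup>+x\<in>matched U V. ennreal (real (deg E ?B x)) \<partial>M) = (\<integral>\<^sup>+x. indicator (matched U V \<inter> touching (V \<inter> A)) x \<partial>M)"
    by (intro nn_integral_cong) (auto split: split_indicator)
  also have "\<dots> = emeasure M (matched U V \<inter> touching (V \<inter> A))"
    by (intro nn_integral_indicator) measurable
  finally have 1: "(\<integral>\<^sup>+x\<in>matched U V. ennreal (real (deg E ?B x)) \<partial>M) = emeasure M (matched U V \<inter> touching (V \<inter> A))" .
  have "deg E (matched U V) x = 1" if x: "x \<in> matched V U" for x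
  proof -
    have s: "x \<in> single U" using x by (simp add: matched_def)
    show ?thesis using matched_nbrs[OF x] by (simp add: deg_def)
  qed
  then have "(\<integral>\<^sup>+x\<in>?B. ennreal (real (deg E (matched U V) x)) \<partial>M) = (\<integral>\<^sup>+x. indicator ?B x \<partial>M)"
    by (intro nn_integral_cong) (auto split: split_indicator)
  also have "\<dots> = emeasure M ?B" by (intro nn_integral_indicator) measurable
  finally show ?thesis using 1 deg_transport[of "matched U V" ?B] by simp
qed

lemma swap_measurable[measurable]:
  assumes [measurable]: "U \<in> sets borel" "V \<in> sets borel"
  shows "swap U V \<in> borel_measurable borel"
proof (cases "U \<inter> V = {}")
  case True
  show ?thesis
  proof (rule measurableI)
    fix A :: "'a set" assume [measurable]: "A \<in> sets borel"
    show "swap U V -` A \<inter> space borel \<in> sets borel" unfolding swap_vimage[OF True] by measurable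
  qed simp
next
  case False
  then have "swap U V = (\<lambda>x. x)" by (simp add: swap_def fun_eq_iff)
  then show ?thesis by simp
qed

lemma emeasure_swap:
  assumes [measurable]: "U \<in> sets borel" "V \<in> sets borel" "A \<in> sets borel"
  shows "emeasure M (swap U V -` A) = emeasure M A"
proof (cases "U \<inter> V = {}")
  case True
  let ?R = "A - matched U V - matched V U"
  have [measurable]: "swap U V -` A \<in> sets M" unfolding swap_vimage[OF True] by measurable
  have Un3: "emeasure M (X \<union> Y \<union> Z) = emeasure M X + emeasure M Y + emeasure M Z"
    if "X \<in> sets borel" "Y \<in> sets borel" "Z \<in> sets borel" "X \<inter> Y = {}" "X \<inter> Z = {}" "Y \<inter> Z = {}" for X Y Z
    using that plus_emeasure[of X M Y] plus_emeasure[of "X \<union> Y" M Z] sets_M by (simp add: Int_Un_distrib2)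
  have "emeasure M (swap U V -` A) = emeasure M (matched U V \<inter> touching (V \<inter> A)) + emeasure M (matched V U \<inter> touching (U \<inter> A)) + emeasure M ?R"
    unfolding swap_vimage[OF True] using matched_disjoint[OF True] by (intro Un3; measurable?) auto
  also have "\<dots> = emeasure M (A \<inter> matched V U) + emeasure M (A \<inter> matched U V) + emeasure M ?R"
    by (simp add: emeasure_matched)
  also have "\<dots> = emeasure M ((A \<inter> matched V U \<union> A \<inter> matched U V) \<union> ?R)"
    using matched_disjoint[OF True] by (intro Un3[symmetric]; measurable?) auto
  also have "(A \<inter> matched V U \<union> A \<inter> matched U V) \<union> ?R = A" by auto
  finally show ?thesis .
next
  case False
  then have "swap U V = (\<lambda>x. x)" by (simp add: swap_def fun_eq_iff)
  then show ?thesis by simp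
qed

lemma swap_in_comp: "swap U V x \<in> comp E x"
proof -
  have "x \<in> matched U V \<Longrightarrow> Upair x (mate V x) \<in> E" for U V using mate(2) by (auto simp: matched_def)
  then have "swap U V x = x \<or> Upair x (swap U V x) \<in> E" by (auto simp: swap_def)
  then show ?thesis by (auto simp: comp_def adj_def)
qed

text \<open>Take disjoint basic neighbourhoods of \<open>x\<close> and \<open>y\<close> that avoid
  the finitely many other neighbours of the opposite end. Then \<open>x\<close> and \<open>y\<close>
  are each other's only neighbour there, and the involution exchanges them.\<close>

lemma edge_swap:
  assumes b_ex: "\<And>U y. open U \<Longrightarrow> y \<in> U \<Longrightarrow> \<exists>i. y \<in> b i \<and> b i \<subseteq> U"
    and e: "Upair x y \<in> E"
  shows "\<exists>i j. swap (b i) (b j) x = (y :: 'a)"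
proof -
  have ne: "x \<noteq> y" using Upair_E_neq e by blast
  obtain U0 V0 where UV: "open U0" "open V0" "x \<in> U0" "y \<in> V0" "U0 \<inter> V0 = {}" using hausdorff[OF ne] by blast
  have "open (U0 - ({z. Upair y z \<in> E} - {x}))" by (intro open_Diff finite_imp_closed finite_Diff finite_nbrs UV)
  moreover have "open (V0 - ({z. Upair x z \<in> E} - {y}))" by (intro open_Diff finite_imp_closed finite_Diff finite_nbrs UV)
  ultimately obtain i j where i: "x \<in> b i" "b i \<subseteq> U0 - ({z. Upair y z \<in> E} - {x})"
    and j: "y \<in> b j" "b j \<subseteq> V0 - ({z. Upair x z \<in> E} - {y})"
    using b_ex[of "U0 - ({z. Upair y z \<in> E} - {x})" x] b_ex[of "V0 - ({z. Upair x z \<in> E} - {y})" y] UV by auto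
  have e': "Upair y x \<in> E" using e Upair_commute by metis
  have s: "x \<in> single (b j)" "y \<in> single (b i)" using i j e e' unfolding single_def by blast+
  have "x \<in> matched (b i) (b j)" using s i j e by (auto simp: matched_def touching_def)
  moreover have "b i \<inter> b j = {}" using i j UV by auto
  moreover have "mate (b j) x = y" by (rule mate_eq[OF s(1) j(1) e])
  ultimately show ?thesis by (intro exI[of _ i] exI[of _ j]) (simp add: swap_def)
qed

text \<open>The involutions \<open>swap\<close> of a countable base generate a countable group. A
  path in the graph is followed by a word in the generators, the reversed word acts as the inverse,
  and every generator preserves \<open>M\<close>. The maps are the words, enumerated by
  \<open>from_nat\<close>.\<close>

theorem ex_orbit_enumeration:
  "\<exists>g :: nat \<Rightarrow> 'a \<Rightarrow> 'a. (\<forall>n. g n \<in> borel_measurable borel) \<and> (\<forall>n. distr M M (g n) = M)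
     \<and> (\<forall>n. \<exists>m. \<forall>x. g m (g n x) = x \<and> g n (g m x) = x) \<and> (\<forall>x. comp E x = range (\<lambda>n. g n x))"
proof -
  obtain b :: "nat \<Rightarrow> 'a set" where b_open: "\<And>i. open (b i)"
    and b_ex: "\<And>U y. open U \<Longrightarrow> y \<in> U \<Longrightarrow> \<exists>i. y \<in> b i \<and> b i \<subseteq> U"
    using open_basis_sequence by blast
  have [measurable]: "b i \<in> sets borel" for i using b_open by simp
  define s where "s p = swap (b (fst p)) (b (snd p))" for p
  define act where "act w = foldr s w" for w
  have s_meas[measurable]: "s p \<in> borel_measurable borel" for p unfolding s_def by measurable
  have act_meas[measurable]: "act w \<in> borel_measurable borel" for w
    unfolding act_def by (induction w) (simp_all add: id_def)
  have act_M: "emeasure M (act w -` A) = emeasure M A" if "A \<in> sets borel" for w A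
    using that
  proof (induction w arbitrary: A)
    case (Cons p w)
    have "s p -` A \<in> sets borel" using measurable_sets[OF s_meas Cons.prems] by simp
    moreover have "act (p # w) -` A = act w -` (s p -` A)" by (auto simp: act_def)
    ultimately show ?case using Cons.IH emeasure_swap Cons.prems by (simp add: s_def)
  qed (simp add: act_def)
  have inv: "act (rev w) (act w x) = x" for w x
    by (induction w arbitrary: x) (auto simp: act_def s_def swap_swap)
  have act_comp: "act w x \<in> comp E x" for w x
  proof (induction w)
    case Nil then show ?case by (simp add: act_def comp_def)
  next
    case (Cons p w)
    then show ?case using swap_in_comp comp_trans by (fastforce simp: act_def s_def)
  qed
  have comp_act: "\<exists>w. y = act w x" if "y \<in> comp E x" for x y
    using that unfolding comp_def mem_Collect_eq
  proof (induction rule: rtrancl_induct)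
    case base show ?case by (rule exI[of _ "[]"]) (simp add: act_def)
  next
    case (step y z)
    then obtain w where "y = act w x" by blast
    moreover have "Upair y z \<in> E" using step by (simp add: adj_def)
    then obtain i j where "swap (b i) (b j) y = z" using edge_swap[of b, OF b_ex] by blast
    ultimately show ?case by (intro exI[of _ "(i, j) # w"]) (simp add: act_def s_def)
  qed
  define g where "g n = act (from_nat n)" for n
  have "distr M M (g n) = M" for n
  proof (rule measure_eqI)
    fix A assume A: "A \<in> sets (distr M M (g n))"
    have "g n \<in> measurable M M" unfolding g_def by measurable
    then show "emeasure (distr M M (g n)) A = emeasure M A"
      using A act_M[of A] sets_M by (simp add: emeasure_distr g_def)
  qed simp
  moreover have "\<exists>m. \<forall>x. g m (g n x) = x \<and> g n (g m x) = x" for n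
    using inv[of "from_nat n"] inv[of "rev (from_nat n)"]
    by (intro exI[of _ "to_nat (rev (from_nat n :: (nat \<times> nat) list))"]) (simp add: g_def)
  moreover have "comp E x = range (\<lambda>n. g n x)" for x
  proof (intro equalityI subsetI)
    fix y assume "y \<in> comp E x"
    then obtain w where "y = act w x" using comp_act by blast
    then show "y \<in> range (\<lambda>n. g n x)" by (intro image_eqI[of _ _ "to_nat w"]) (simp_all add: g_def)
  qed (auto simp: g_def act_comp)
  ultimately show ?thesis by (intro exI[of _ g]) (auto simp: g_def)
qed

end

section \<open>Mass transport and measurability along components\<close>

context graphing_space
begin

definition g :: "nat \<Rightarrow> 'a \<Rightarrow> 'a" where
  "g = (SOME g. (\<forall>n. g n \<in> borel_measurable borel) \<and> (\<forall>n. distr M M (g n) = M)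
     \<and> (\<forall>n. \<exists>m. \<forall>x. g m (g n x) = x \<and> g n (g m x) = x) \<and> (\<forall>x. comp E x = range (\<lambda>n. g n x)))"

lemma g_all: "(\<forall>n. g n \<in> borel_measurable borel) \<and> (\<forall>n. distr M M (g n) = M)
     \<and> (\<forall>n. \<exists>m. \<forall>x. g m (g n x) = x \<and> g n (g m x) = x) \<and> (\<forall>x. comp E x = range (\<lambda>n. g n x))"
  unfolding g_def by (rule someI_ex[OF ex_orbit_enumeration])

lemma g_measurable[measurable]: "g n \<in> borel_measurable borel" using g_all by blast
lemma g_measurable_M: "g n \<in> measurable M M" by measurable
lemma distr_g: "distr M M (g n) = M" using g_all by blast
lemma comp_g: "comp E x = range (\<lambda>n. g n x)" using g_all by blast

definition gi :: "nat \<Rightarrow> nat" where "gi n = (SOME m. \<forall>x. g m (g n x) = x \<and> g n (g m x) = x)"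

lemma gi: "g (gi n) (g n x) = x" "g n (g (gi n) x) = x"
proof -
  have "\<exists>m. \<forall>x. g m (g n x) = x \<and> g n (g m x) = x" using g_all by blast
  from someI_ex[OF this] show "g (gi n) (g n x) = x" "g n (g (gi n) x) = x" unfolding gi_def by blast+
qed

text \<open>The enumeration of a component by \<open>g\<close> may repeat vertices. Keeping only the
  least index of each vertex turns a sum over the component into a sum over indices with every
  vertex counted once.\<close>

definition first :: "nat \<Rightarrow> 'a \<Rightarrow> bool" where "first n x \<longleftrightarrow> (\<forall>m\<in>{..<n}. g m x \<noteq> g n x)"

lemma first_measurable[measurable]: "Measurable.pred borel (first n)"
  unfolding first_def by measurable

lemma first_eq: "first m x \<Longrightarrow> first n x \<Longrightarrow> g m x = g n x \<Longrightarrow> m = n"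
  by (cases m n rule: linorder_cases) (auto simp: first_def)

lemma bij_first: "bij_betw (\<lambda>n. g n x) {n. first n x} (comp E x)"
proof (rule bij_betwI')
  fix m n assume "m \<in> {n. first n x}" "n \<in> {n. first n x}"
  then show "(g m x = g n x) = (m = n)" using first_eq[of m x n] by auto
next
  fix y assume "y \<in> comp E x"
  then have ex: "\<exists>n. g n x = y" unfolding comp_g by blast
  let ?n = "LEAST n. g n x = y"
  have "g ?n x = y" by (rule LeastI_ex[OF ex])
  moreover have "first ?n x" unfolding first_def using not_less_Least calculation by auto
  ultimately show "\<exists>n\<in>{n. first n x}. y = g n x" by (intro bexI[of _ ?n]) simp_all
qed (auto simp: comp_g)

lemma nn_integral_comp:
  "(\<integral>\<^sup>+y. h y \<partial>count_space (comp E x)) = (\<Sum>n. if first n x then h (g n x) else 0)"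
proof -
  have "(\<integral>\<^sup>+y. h y \<partial>count_space (comp E x)) = (\<integral>\<^sup>+n. h (g n x) \<partial>count_space {n. first n x})"
    by (rule nn_integral_bij_count_space[OF bij_first, symmetric])
  also have "\<dots> = (\<integral>\<^sup>+n. h (g n x) * indicator {n. first n x} n \<partial>count_space UNIV)"
    by (rule nn_integral_count_space_indicator) simp
  also have "\<dots> = (\<Sum>n. h (g n x) * indicator {n. first n x} n)" by (rule nn_integral_count_space_nat)
  also have "\<dots> = (\<Sum>n. if first n x then h (g n x) else 0)" by (intro suminf_cong) simp
  finally show ?thesis .
qed

lemma measurable_comp_sum[measurable (raw)]:
  assumes [measurable]: "(\<lambda>(p, y). h p y) \<in> borel_measurable (N \<Otimes>\<^sub>M borel)" "k \<in> measurable N borel"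
  shows "(\<lambda>p. \<integral>\<^sup>+y. h p y \<partial>count_space (comp E (k p))) \<in> borel_measurable N"
  unfolding nn_integral_comp by measurable

text \<open>Mass sent from \<open>x\<close> to \<open>y\<close> is sorted by the least index
  \<open>n\<close> with \<open>y = g n x\<close>. For each \<open>n\<close> the substitution along
  the measure preserving map \<open>g n\<close> moves the integral from senders to receivers, and
  the pieces are then added up again.\<close>

theorem mass_transport:
  assumes [measurable]: "(\<lambda>(x, y). h x y) \<in> borel_measurable (borel \<Otimes>\<^sub>M borel)"
  shows "(\<integral>\<^sup>+x. (\<integral>\<^sup>+y. h x y \<partial>count_space (comp E x)) \<partial>M) = (\<integral>\<^sup>+x. (\<integral>\<^sup>+y. h y x \<partial>count_space (comp E x)) \<partial>M)"
proof -
  \<comment> \<open>The mass that \<open>y\<close> receives along \<open>g n\<close>, expressed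
    through its only possible sender \<open>g (gi n) y\<close>.\<close>
  define f where "f n y = (if first n (g (gi n) y) then h (g (gi n) y) y else 0)" for n y
  have [measurable]: "f n \<in> borel_measurable borel" for n unfolding f_def by measurable
  have "(\<integral>\<^sup>+x. (\<integral>\<^sup>+y. h x y \<partial>count_space (comp E x)) \<partial>M) = (\<integral>\<^sup>+x. (\<Sum>n. if first n x then h x (g n x) else 0) \<partial>M)"
    unfolding nn_integral_comp ..
  also have "\<dots> = (\<Sum>n. \<integral>\<^sup>+x. (if first n x then h x (g n x) else 0) \<partial>M)"
    by (rule nn_integral_suminf) measurable
  also have "\<dots> = (\<Sum>n. \<integral>\<^sup>+x. f n x \<partial>M)"
  proof (intro suminf_cong)
    fix n
    have "(\<integral>\<^sup>+x. f n x \<partial>M) = (\<integral>\<^sup>+x. f n x \<partial>distr M M (g n))" unfolding distr_g ..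
    also have "\<dots> = (\<integral>\<^sup>+x. f n (g n x) \<partial>M)" by (rule nn_integral_distr[OF g_measurable_M]) (unfold distr_g, measurable)
    also have "\<dots> = (\<integral>\<^sup>+x. (if first n x then h x (g n x) else 0) \<partial>M)" by (simp add: f_def gi cong: if_cong)
    finally show "(\<integral>\<^sup>+x. (if first n x then h x (g n x) else 0) \<partial>M) = (\<integral>\<^sup>+x. f n x \<partial>M)" ..
  qed
  also have "\<dots> = (\<integral>\<^sup>+x. (\<Sum>n. f n x) \<partial>M)" by (rule nn_integral_suminf[symmetric]) measurable
  also have "\<dots> = (\<integral>\<^sup>+x. (\<integral>\<^sup>+y. h y x \<partial>count_space (comp E x)) \<partial>M)"
  proof (intro nn_integral_cong)
    fix x
    \<comment> \<open>Each vertex \<open>z\<close> of the component reaches \<open>x\<close> through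
      exactly one least index, so every sender is counted once on the receiving side too.\<close>
    have "bij_betw (\<lambda>n. g (gi n) x) {n. first n (g (gi n) x)} (comp E x)"
    proof (rule bij_betwI')
      fix m n assume mn: "m \<in> {n. first n (g (gi n) x)}" "n \<in> {n. first n (g (gi n) x)}"
      show "(g (gi m) x = g (gi n) x) = (m = n)"
      proof
        assume eq: "g (gi m) x = g (gi n) x"
        then have "g m (g (gi m) x) = g n (g (gi m) x)" using gi(2) by metis
        moreover have "first m (g (gi m) x)" "first n (g (gi m) x)" using mn eq by auto
        ultimately show "m = n" using first_eq by blast
      qed simp
    next
      fix n show "g (gi n) x \<in> comp E x" unfolding comp_g by blast
    next
      fix z assume z: "z \<in> comp E x"
      then have "x \<in> comp E z" by (rule comp_sym)
      then obtain n where n: "first n z" "x = g n z" using bij_first[of z] unfolding bij_betw_def by auto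
      then have zn: "z = g (gi n) x" using gi by simp
      then have "first n (g (gi n) x)" using n(1) by simp
      then show "\<exists>n\<in>{n. first n (g (gi n) x)}. z = g (gi n) x" using zn by blast
    qed
    then have "(\<integral>\<^sup>+y. h y x \<partial>count_space (comp E x)) = (\<integral>\<^sup>+n. h (g (gi n) x) x \<partial>count_space {n. first n (g (gi n) x)})"
      by (rule nn_integral_bij_count_space[symmetric])
    also have "\<dots> = (\<integral>\<^sup>+n. h (g (gi n) x) x * indicator {n. first n (g (gi n) x)} n \<partial>count_space UNIV)"
      by (rule nn_integral_count_space_indicator) simp
    also have "\<dots> = (\<Sum>n. h (g (gi n) x) x * indicator {n. first n (g (gi n) x)} n)" by (rule nn_integral_count_space_nat)
    also have "\<dots> = (\<Sum>n. f n x)" unfolding f_def by (intro suminf_cong) simp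
    finally show "(\<Sum>n. f n x) = (\<integral>\<^sup>+y. h y x \<partial>count_space (comp E x))" ..
  qed
  finally show ?thesis .
qed

text \<open>The vertices whose component meets a null set form the union of the preimages of that
  set under the countably many \<open>g n\<close>, which preserve \<open>M\<close>.\<close>

lemma AE_comp:
  assumes "AE x in M. P x"
  shows "AE x in M. \<forall>y\<in>comp E x. P y"
proof -
  have "AE x in M. P (g n x)" for n
    using AE_distrD[OF g_measurable_M[of n], of P] assms unfolding distr_g .
  then have "AE x in M. \<forall>n. P (g n x)" by (simp add: AE_all_countable)
  then show ?thesis by eventually_elim (auto simp: comp_g)
qed

text \<open>Intermediate vertices of a path lie in the component of its start, so they can be
  quantified over the countable family \<open>g\<close>. The parameter \<open>p\<close> is there
  because the graphs needed later, such as \<open>Up (Upair a b)\<close>, vary with the point at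
  which they are tested.\<close>

lemma pred_reachable:
  assumes [measurable]: "Measurable.pred (N \<Otimes>\<^sub>M (borel \<Otimes>\<^sub>M borel)) (\<lambda>(p, u, v). P p u v)"
    and P: "\<And>p u v. P p u v \<Longrightarrow> v \<in> comp E u"
  shows "Measurable.pred (N \<Otimes>\<^sub>M (borel \<Otimes>\<^sub>M borel)) (\<lambda>(p, x, y). (x, y) \<in> {(u, v). P p u v}\<^sup>*)"
proof -
  have sub: "(x, y) \<in> {(u, v). P p u v} ^^ k \<Longrightarrow> y \<in> comp E x" for p x y k
  proof (induction k arbitrary: y)
    case 0 then show ?case by (simp add: comp_refl)
  next
    case (Suc k) then show ?case using P comp_trans by fastforce
  qed
  have [measurable]: "Measurable.pred (N \<Otimes>\<^sub>M (borel \<Otimes>\<^sub>M borel)) (\<lambda>(p, x, y). (x, y) \<in> {(u, v). P p u v} ^^ k)" for k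
  proof (induction k)
    case 0 show ?case by simp
  next
    case (Suc k)
    note [measurable] = Suc
    let ?K = "\<lambda>(p, x, y). (x, y) \<in> {(u, v). P p u v} ^^ k" and ?P = "\<lambda>(p, u, v). P p u v"
    have eq: "(x, y) \<in> {(u, v). P p u v} ^^ Suc k \<longleftrightarrow> (\<exists>n. ?K (p, x, g n x) \<and> ?P (p, g n x, y))" for p x y
    proof
      assume "(x, y) \<in> {(u, v). P p u v} ^^ Suc k"
      then obtain z where z: "(x, z) \<in> {(u, v). P p u v} ^^ k" "P p z y" by auto
      then obtain n where "z = g n x" using sub[OF z(1)] unfolding comp_g by blast
      then show "\<exists>n. ?K (p, x, g n x) \<and> ?P (p, g n x, y)" using z by auto
    next
      assume "\<exists>n. ?K (p, x, g n x) \<and> ?P (p, g n x, y)"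
      then obtain n where "(x, g n x) \<in> {(u, v). P p u v} ^^ k" "P p (g n x) y" by auto
      then show "(x, y) \<in> {(u, v). P p u v} ^^ Suc k" by (auto intro: relcompI)
    qed
    show ?case unfolding eq by measurable
  qed
  have eq: "(x, y) \<in> {(u, v). P p u v}\<^sup>* \<longleftrightarrow> (\<exists>k. (\<lambda>(p, x, y). (x, y) \<in> {(u, v). P p u v} ^^ k) (p, x, y))" for p x y
    unfolding rtrancl_power by simp
  show ?thesis unfolding eq by measurable
qed

lemma pred_comp:
  assumes F: "Measurable.pred (N \<Otimes>\<^sub>M (borel \<Otimes>\<^sub>M borel)) (\<lambda>(p, u, v). Upair u v \<in> F p)"
    and sub: "\<And>p. F p \<subseteq> E" and [measurable]: "x \<in> measurable N borel" "y \<in> measurable N borel"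
  shows "Measurable.pred N (\<lambda>p. y p \<in> comp (F p) (x p))"
proof -
  have [measurable]: "Measurable.pred (N \<Otimes>\<^sub>M (borel \<Otimes>\<^sub>M borel)) (\<lambda>(p, x, y). (x, y) \<in> {(u, v). Upair u v \<in> F p}\<^sup>*)"
    by (rule pred_reachable[OF F]) (rule Upair_in_comp, rule subsetD[OF sub])
  have eq: "y p \<in> comp (F p) (x p) \<longleftrightarrow> (\<lambda>(p, x, y). (x, y) \<in> {(u, v). Upair u v \<in> F p}\<^sup>*) (p, x p, y p)" for p
    by (simp add: comp_def adj_def)
  show ?thesis unfolding eq by measurable
qed

text \<open>Unlike \<open>card\<close>, this count distinguishes infinite sets from the empty one.
  For subsets of a component it is a measurable countable sum, from which measurability of
  finiteness and of \<open>card\<close> follows.\<close>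

definition ecard :: "'b set \<Rightarrow> ennreal" where "ecard A = emeasure (count_space UNIV) A"

lemma ecard_finite: "finite A \<Longrightarrow> ecard A = of_nat (card A)"
  by (simp add: ecard_def)

lemma ecard_infinite: "infinite A \<Longrightarrow> ecard A = \<infinity>"
  by (simp add: ecard_def)

lemma ecard_comp_sum:
  assumes "A \<subseteq> comp E x"
  shows "ecard A = (\<integral>\<^sup>+y. indicator A y \<partial>count_space (comp E x))"
proof -
  have "(\<integral>\<^sup>+y. indicator A y \<partial>count_space (comp E x)) = emeasure (count_space (comp E x)) A"
    by (rule nn_integral_indicator) (use assms in auto)
  also have "\<dots> = ecard A" unfolding ecard_def using assms by (simp add: emeasure_count_space)
  finally show ?thesis ..
qed

lemma measurable_ecard:
  assumes A: "\<And>p. A p \<subseteq> comp E (x p)" and [measurable]: "x \<in> measurable N borel"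
    and A_meas[measurable]: "Measurable.pred (N \<Otimes>\<^sub>M borel) (\<lambda>(p, y). y \<in> A p)"
  shows "(\<lambda>p. ecard (A p)) \<in> borel_measurable N"
proof -
  have eq: "indicator (A p) y = (if (\<lambda>(p, y). y \<in> A p) (p, y) then 1 else 0 :: ennreal)" for p y by simp
  have [measurable]: "(\<lambda>(p, y). indicator (A p) y :: ennreal) \<in> borel_measurable (N \<Otimes>\<^sub>M borel)"
    unfolding eq by measurable
  show ?thesis unfolding ecard_comp_sum[OF A] by measurable
qed

lemma pred_finite:
  assumes "\<And>p. A p \<subseteq> comp E (x p)" "x \<in> measurable N borel"
    "Measurable.pred (N \<Otimes>\<^sub>M borel) (\<lambda>(p, y). y \<in> A p)"
  shows "Measurable.pred N (\<lambda>p. finite (A p))"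
proof -
  have [measurable]: "(\<lambda>p. ecard (A p)) \<in> borel_measurable N" using assms by (rule measurable_ecard)
  have "finite (A p) \<longleftrightarrow> ecard (A p) < \<infinity>" for p
    by (cases "finite (A p)") (simp_all add: ecard_finite ecard_infinite of_nat_less_top)
  then show ?thesis by simp
qed

lemma measurable_card:
  assumes "\<And>p. A p \<subseteq> comp E (x p)" "x \<in> measurable N borel"
    "Measurable.pred (N \<Otimes>\<^sub>M borel) (\<lambda>(p, y). y \<in> A p)"
  shows "(\<lambda>p. real (card (A p))) \<in> borel_measurable N"
proof -
  have [measurable]: "(\<lambda>p. ecard (A p)) \<in> borel_measurable N" using assms by (rule measurable_ecard)
  have "real (card (A p)) = enn2real (ecard (A p))" for p
    by (cases "finite (A p)") (simp_all add: ecard_finite ecard_infinite)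
  then show ?thesis by simp
qed

end

section \<open>Edge measure and rank\<close>

text \<open>The pointwise form of \<open>forest\<close>, without an exceptional null set. The
  forests constructed here satisfy it, and it passes to subsets.\<close>

definition acyclic_edges :: "'a uprod set \<Rightarrow> bool" where
  "acyclic_edges F \<longleftrightarrow> (\<forall>e. \<not> cycle_edge F e)"

lemma acyclic_edges_subset: "acyclic_edges G \<Longrightarrow> F \<subseteq> G \<Longrightarrow> acyclic_edges F"
  unfolding acyclic_edges_def cycle_edge_def
  using rtrancl_mono[OF adj_mono[of "F - {e}" "G - {e}" for e]] by blast

text \<open>A breadth-first tree rooted at \<open>x\<close> supplies card - 1 edges, each counted at
  both of its ends. In the acyclic case there is no further edge, since it would close a cycle with
  the tree.\<close>

lemma comp_degree_sum:
  assumes fin: "finite (comp A x)" and loop: "\<And>y z. Upair y z \<in> A \<Longrightarrow> y \<noteq> z"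
  shows "2 * (card (comp A x) - 1) \<le> (\<Sum>y\<in>comp A x. card {z. Upair y z \<in> A})"
    and "acyclic_edges A \<Longrightarrow> (\<Sum>y\<in>comp A x. card {z. Upair y z \<in> A}) = 2 * (card (comp A x) - 1)"
proof -
  let ?C = "comp A x"
  have xC: "x \<in> ?C" by (simp add: comp_def)
  define d where "d y = (LEAST k. (x, y) \<in> adj A ^^ k)" for y
  have d: "(x, y) \<in> adj A ^^ d y" if "y \<in> ?C" for y
  proof -
    have "\<exists>k. (x, y) \<in> adj A ^^ k" using that by (simp add: comp_def rtrancl_is_UN_relpow)
    then show ?thesis unfolding d_def by (rule LeastI_ex)
  qed
  have "\<exists>p. Upair y p \<in> A \<and> p \<in> ?C \<and> d p < d y" if y: "y \<in> ?C" "y \<noteq> x" for y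
  proof -
    have "d y \<noteq> 0" using d[OF y(1)] y(2) by (intro notI) simp
    then obtain k where k: "d y = Suc k" using not0_implies_Suc by blast
    then obtain p where p: "(x, p) \<in> adj A ^^ k" "(p, y) \<in> adj A" using d[OF y(1)] by auto
    have "d p \<le> k" unfolding d_def by (rule Least_le) (rule p(1))
    moreover have "p \<in> ?C" using p(1) relpow_imp_rtrancl by (auto simp: comp_def)
    moreover have "Upair y p \<in> A" using symD[OF sym_adj p(2)] by (simp add: adj_def)
    ultimately show ?thesis using k by auto
  qed
  then obtain par where par: "\<And>y. y \<in> ?C \<Longrightarrow> y \<noteq> x \<Longrightarrow> Upair y (par y) \<in> A \<and> par y \<in> ?C \<and> d (par y) < d y"
    by metis
  have parUp: "Upair (par y) y = Upair y (par y)" for y by simp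
  let ?P = "SIGMA y:?C. {z. Upair y z \<in> A}"
  \<comment> \<open>The tree edges in their two orientations. They are disjoint because the distance
    \<open>d\<close> to the root drops strictly towards the parent.\<close>
  let ?X = "(\<lambda>y. (y, par y)) ` (?C - {x})" and ?Y = "(\<lambda>y. (par y, y)) ` (?C - {x})"
  have nb: "{z. Upair y z \<in> A} \<subseteq> ?C" if "y \<in> ?C" for y using comp_step[OF that] by blast
  have finP: "finite ?P" using fin nb by (intro finite_SigmaI) (auto intro: finite_subset)
  have cardP: "card ?P = (\<Sum>y\<in>?C. card {z. Upair y z \<in> A})"
    using fin nb by (intro card_SigmaI) (auto intro: finite_subset)
  have disj: "?X \<inter> ?Y = {}"
  proof (rule equals0I)
    fix p assume "p \<in> ?X \<inter> ?Y"
    then obtain y z where "y \<in> ?C" "y \<noteq> x" "z \<in> ?C" "z \<noteq> x" "y = par z" "par y = z" by auto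
    then show False using par[of y] par[of z] by auto
  qed
  have "card ?X = card ?C - 1" "card ?Y = card ?C - 1"
    using fin xC by (subst card_image; auto simp: inj_on_def)+
  then have cardXY: "card (?X \<union> ?Y) = 2 * (card ?C - 1)" using fin disj by (subst card_Un_disjoint) auto
  have sub: "?X \<union> ?Y \<subseteq> ?P" using par parUp by (auto simp del: Upair_inject)
  show "2 * (card ?C - 1) \<le> (\<Sum>y\<in>?C. card {z. Upair y z \<in> A})"
    using card_mono[OF finP sub] cardXY cardP by simp
  assume acyc: "acyclic_edges A"
  have "?P \<subseteq> ?X \<union> ?Y"
  proof (rule ccontr)
    assume "\<not> ?P \<subseteq> ?X \<union> ?Y"
    then obtain y z where yz: "y \<in> ?C" "Upair y z \<in> A" "(y, z) \<notin> ?X" "(y, z) \<notin> ?Y" by auto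
    have zC: "z \<in> ?C" using comp_step[OF yz(1,2)] .
    let ?B = "A - {Upair y z}"
    \<comment> \<open>Climbing to the root uses tree edges only, so it survives the removal of an
      edge outside the tree.\<close>
    have conn: "w \<in> ?C \<Longrightarrow> (w, x) \<in> (adj ?B)\<^sup>*" for w
    proof (induction "d w" arbitrary: w rule: less_induct)
      case less
      show ?case
      proof (cases "w = x")
        case False
        note p = par[OF less.prems False]
        have "Upair w (par w) \<noteq> Upair y z" using yz(3,4) less.prems False by auto
        then have "(w, par w) \<in> adj ?B" using p by (simp add: adj_def)
        then show ?thesis using less.hyps[of "par w"] p by (meson converse_rtrancl_into_rtrancl)
      qed simp
    qed
    have "(x, z) \<in> (adj ?B)\<^sup>*" using symD[OF sym_rtrancl[OF sym_adj] conn[OF zC]] .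
    then have "(y, z) \<in> (adj ?B)\<^sup>*" using conn[OF yz(1)] by (rule rtrancl_trans[rotated])
    then have "cycle_edge A (Upair y z)" unfolding cycle_edge_def using yz(2) loop by blast
    then show False using acyc by (simp add: acyclic_edges_def)
  qed
  then have "?P = ?X \<union> ?Y" using sub by blast
  then show "(\<Sum>y\<in>?C. card {z. Upair y z \<in> A}) = 2 * (card ?C - 1)" using cardXY cardP by simp
qed

context graphing_space
begin

lemma pred_Upair[measurable (raw)]:
  assumes F: "F \<in> uprod_sets" and [measurable]: "f \<in> borel_measurable N" "h \<in> borel_measurable N"
  shows "Measurable.pred N (\<lambda>p. Upair (f p) (h p :: 'a) \<in> F)"
proof -
  have "{p \<in> space borel. Upair (fst p) (snd p) \<in> F} \<in> sets borel" using F unfolding uprod_sets_def vimage_def by simp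
  then have [measurable]: "Measurable.pred (borel \<Otimes>\<^sub>M borel) (\<lambda>p. Upair (fst p) (snd p) \<in> F)"
    by (simp add: borel_prod pred_def)
  have "Measurable.pred N (\<lambda>p. (\<lambda>p. Upair (fst p) (snd p) \<in> F) (f p, h p))" by measurable
  then show ?thesis by simp
qed

lemma uprod_setsI:
  assumes "Measurable.pred (borel \<Otimes>\<^sub>M borel) (\<lambda>(u, v). Upair u v \<in> F)"
  shows "F \<in> (uprod_sets :: 'a uprod set set)"
proof -
  have "{p \<in> space (borel \<Otimes>\<^sub>M borel). (\<lambda>(u, v). Upair u v \<in> F) p} \<in> sets (borel \<Otimes>\<^sub>M borel)"
    using assms unfolding pred_def .
  then have "{p. (\<lambda>(u, v). Upair u v \<in> F) p} \<in> sets (borel :: ('a \<times> 'a) measure)"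
    unfolding borel_prod space_borel by simp
  then show ?thesis unfolding uprod_sets_def vimage_def case_prod_beta' by simp
qed

lemma uprod_sets_Int[measurable]: "F \<in> uprod_sets \<Longrightarrow> G \<in> uprod_sets \<Longrightarrow> F \<inter> G \<in> (uprod_sets :: 'a uprod set set)"
  and uprod_sets_Diff[measurable]: "F \<in> uprod_sets \<Longrightarrow> G \<in> uprod_sets \<Longrightarrow> F - G \<in> (uprod_sets :: 'a uprod set set)"
  and uprod_sets_Un[measurable]: "F \<in> uprod_sets \<Longrightarrow> G \<in> uprod_sets \<Longrightarrow> F \<union> G \<in> (uprod_sets :: 'a uprod set set)"
proof -
  interpret sigma_algebra UNIV "uprod_sets :: 'a uprod set set" by (rule sigma_algebra_uprod_sets)
  show "F \<in> uprod_sets \<Longrightarrow> G \<in> uprod_sets \<Longrightarrow> F \<inter> G \<in> uprod_sets"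
    "F \<in> uprod_sets \<Longrightarrow> G \<in> uprod_sets \<Longrightarrow> F - G \<in> uprod_sets"
    "F \<in> uprod_sets \<Longrightarrow> G \<in> uprod_sets \<Longrightarrow> F \<union> G \<in> uprod_sets" by auto
qed

definition edeg :: "'a uprod set \<Rightarrow> 'a \<Rightarrow> ennreal" where
  "edeg F x = ecard {y. Upair x y \<in> F \<inter> E}"

lemma edeg_subset: "{y. Upair x y \<in> F \<inter> E} \<subseteq> comp E x"
proof
  fix y assume "y \<in> {y. Upair x y \<in> F \<inter> E}"
  then have "Upair x y \<in> E" by simp
  then show "y \<in> comp E x" by (rule Upair_in_comp)
qed

lemma finite_edeg: "finite {y. Upair x y \<in> F \<inter> E}"
  by (rule finite_subset[OF _ finite_nbrs[of x]]) blast

lemma edeg_card: "edeg F x = ennreal (real (card {y. Upair x y \<in> F \<inter> E}))"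
  unfolding edeg_def using finite_edeg by (simp add: ecard_finite ennreal_of_nat_eq_real_of_nat)

lemma edeg_measurable[measurable]:
  assumes [measurable]: "F \<in> uprod_sets"
  shows "edeg F \<in> borel_measurable borel"
  unfolding edeg_def
proof (rule measurable_ecard[where x="\<lambda>x. x"])
  note [measurable] = E_uprod_sets
  have "Measurable.pred (borel \<Otimes>\<^sub>M borel) (\<lambda>p. Upair (fst p) (snd p) \<in> F \<inter> E)" by measurable
  then show "Measurable.pred (borel \<Otimes>\<^sub>M borel) (\<lambda>(x, y). y \<in> {y. Upair x y \<in> F \<inter> E})" by (simp add: split_beta')
qed (rule edeg_subset, measurable)

lemma sets_eta: "sets (eta M E) = uprod_sets"
  unfolding eta_def using sigma_algebra.sets_measure_of_eq[OF sigma_algebra_uprod_sets] .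

lemma space_eta[simp]: "space (eta M E) = UNIV"
  unfolding eta_def by (simp add: space_measure_of_conv)

text \<open>\<open>measure_of\<close> assigns 0 to every set unless the given set function is a
  measure, so countable additivity of the integrated degree has to be established before the
  defining formula is available.\<close>

lemma emeasure_eta:
  assumes F: "F \<in> uprod_sets"
  shows "emeasure (eta M E) F = (\<integral>\<^sup>+x. edeg F x \<partial>M) / 2"
proof -
  interpret sigma_algebra UNIV "uprod_sets :: 'a uprod set set" by (rule sigma_algebra_uprod_sets)
  have "emeasure (eta M E) F = (\<integral>\<^sup>+x. ennreal (real (card {y. Upair x y \<in> F \<inter> E})) \<partial>M) / 2"
    unfolding eta_def
  proof (rule emeasure_measure_of_sigma[OF sigma_algebra_uprod_sets _ _ F])
    show "positive uprod_sets (\<lambda>F. (\<integral>\<^sup>+x. ennreal (real (card {y. Upair x y \<in> F \<inter> E})) \<partial>M) / 2)"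
      by (simp add: positive_def)
    show "countably_additive uprod_sets (\<lambda>F. (\<integral>\<^sup>+x. ennreal (real (card {y. Upair x y \<in> F \<inter> E})) \<partial>M) / 2)"
      unfolding edeg_card[symmetric]
    proof (rule countably_additiveI)
      fix A :: "nat \<Rightarrow> 'a uprod set" assume A: "range A \<subseteq> uprod_sets" "disjoint_family A"
      have [measurable]: "A i \<in> uprod_sets" for i using A by auto
      have sum: "(\<integral>\<^sup>+x. (\<Sum>i. edeg (A i) x) \<partial>M) = (\<Sum>i. \<integral>\<^sup>+x. edeg (A i) x \<partial>M)"
        by (rule nn_integral_suminf) measurable
      have "(\<Sum>i. (\<integral>\<^sup>+x. edeg (A i) x \<partial>M) / 2) = (\<integral>\<^sup>+x. (\<Sum>i. edeg (A i) x) \<partial>M) / 2"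
        unfolding sum divide_ennreal_def by (rule ennreal_suminf_multc)
      also have "(\<lambda>x. \<Sum>i. edeg (A i) x) = edeg (\<Union>i. A i)"
      proof
        fix x
        have "(\<Union>i. {y. Upair x y \<in> A i \<inter> E}) = {y. Upair x y \<in> (\<Union>i. A i) \<inter> E}" by auto
        moreover have "disjoint_family (\<lambda>i. {y. Upair x y \<in> A i \<inter> E})"
          using A(2) unfolding disjoint_family_on_def by blast
        ultimately show "(\<Sum>i. edeg (A i) x) = edeg (\<Union>i. A i) x"
          unfolding edeg_def ecard_def by (subst suminf_emeasure) auto
      qed
      finally show "(\<Sum>i. (\<integral>\<^sup>+x. edeg (A i) x \<partial>M) / 2) = (\<integral>\<^sup>+x. edeg (\<Union>i. A i) x \<partial>M) / 2" .
    qed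
  qed
  then show ?thesis unfolding edeg_card[symmetric] .
qed

sublocale eta: finite_measure "eta M E"
proof (rule finite_measureI)
  have U: "(UNIV :: 'a uprod set) \<in> uprod_sets" by (simp add: uprod_sets_def)
  have "(\<integral>\<^sup>+x. edeg UNIV x \<partial>M) \<le> (\<integral>\<^sup>+x. ennreal (real deg_bound) \<partial>M)"
    by (intro nn_integral_mono) (auto simp: edeg_card intro!: ennreal_leI card_nbrs)
  also have "\<dots> < \<infinity>" using emeasure_space_1 by (simp add: ennreal_mult_less_top)
  finally show "emeasure (eta M E) (space (eta M E)) \<noteq> \<infinity>"
    by (simp add: emeasure_eta[OF U] ennreal_divide_eq_top_iff)
qed

lemma eta_outside: "A \<in> uprod_sets \<Longrightarrow> A \<inter> E = {} \<Longrightarrow> emeasure (eta M E) A = 0"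
  by (simp add: emeasure_eta edeg_def ecard_finite)

lemma AE_eta_E: "AE e in eta M E. e \<in> E"
proof (rule AE_I)
  show "{e \<in> space (eta M E). e \<notin> E} \<subseteq> - E" by auto
  have "- E \<in> uprod_sets" using sets.compl_sets[of E "eta M E"] E_uprod_sets
    by (simp add: sets_eta Compl_eq_Diff_UNIV)
  then show "emeasure (eta M E) (- E) = 0" "- E \<in> sets (eta M E)" by (auto simp: eta_outside sets_eta)
qed

definition ends :: "'a uprod set \<Rightarrow> 'a set" where "ends S = {x. \<exists>y. Upair x y \<in> S}"

lemma ends_measurable:
  assumes [measurable]: "S \<in> uprod_sets" and "S \<subseteq> E"
  shows "ends S \<in> sets borel"
proof -
  have "ends S = {x \<in> space borel. 0 < edeg S x}"
    using finite_edeg[of _ S] Int_absorb2[OF assms(2)] by (auto simp: ends_def edeg_card card_gt_0_iff)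
  also have "\<dots> \<in> sets borel" by measurable
  finally show ?thesis .
qed

lemma emeasure_ends:
  assumes [measurable]: "S \<in> uprod_sets" and "S \<subseteq> E"
  shows "emeasure M (ends S) \<le> 2 * emeasure (eta M E) S"
proof -
  note [measurable] = ends_measurable[OF assms]
  have "emeasure M (ends S) = (\<integral>\<^sup>+x. indicator (ends S) x \<partial>M)" by simp
  also have "\<dots> \<le> (\<integral>\<^sup>+x. edeg S x \<partial>M)"
  proof (intro nn_integral_mono)
    fix x
    show "indicator (ends S) x \<le> edeg S x"
    proof (cases "x \<in> ends S")
      case True
      then have "card {y. Upair x y \<in> S \<inter> E} \<noteq> 0" using finite_edeg[of x S] assms(2) by (auto simp: ends_def)
      then show ?thesis using True by (simp add: edeg_card)
    qed simp
  qed
  also have "\<dots> = 2 * emeasure (eta M E) S"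
    by (simp add: emeasure_eta[OF assms(1)] ennreal_times_divide ennreal_mult_divide_eq mult.commute[of 2])
  finally show ?thesis .
qed

definition icomp :: "'a uprod set \<Rightarrow> 'a \<Rightarrow> real" where
  "icomp A x = (if finite (comp A x) then 1 / real (card (comp A x)) else 0)"

lemma icomp_bounds: "0 \<le> icomp A x" "icomp A x \<le> 1"
proof -
  have "finite (comp A x) \<Longrightarrow> 1 \<le> card (comp A x)" using comp_refl[of x A] by (simp add: Suc_le_eq card_gt_0_iff) blast
  then show "0 \<le> icomp A x" "icomp A x \<le> 1" by (auto simp: icomp_def)
qed

lemma pred_in_comp:
  assumes F: "F \<in> uprod_sets" "F \<subseteq> E" and [measurable]: "x \<in> measurable N borel" "y \<in> measurable N borel"
  shows "Measurable.pred N (\<lambda>p. y p \<in> comp F (x p))"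
proof (rule pred_comp)
  note [measurable] = F(1)
  have "Measurable.pred (N \<Otimes>\<^sub>M borel \<Otimes>\<^sub>M borel) (\<lambda>q. Upair (fst (snd q)) (snd (snd q)) \<in> F)" by measurable
  then show "Measurable.pred (N \<Otimes>\<^sub>M borel \<Otimes>\<^sub>M borel) (\<lambda>(p, u, v). Upair u v \<in> F)" by (simp add: split_beta')
qed (use assms in auto)

lemma icomp_measurable:
  assumes A: "A \<in> uprod_sets" "A \<subseteq> E"
  shows "icomp A \<in> borel_measurable borel"
proof -
  have "Measurable.pred (borel \<Otimes>\<^sub>M borel) (\<lambda>p. snd p \<in> comp A (fst p))"
    by (rule pred_in_comp[OF A]) measurable
  then have p: "Measurable.pred (borel \<Otimes>\<^sub>M borel) (\<lambda>(x, y). y \<in> comp A x)" by (simp add: split_beta')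
  have [measurable]: "Measurable.pred borel (\<lambda>x. finite (comp A x))"
    by (rule pred_finite[OF comp_mono[OF A(2)] _ p]) measurable
  have [measurable]: "(\<lambda>x. real (card (comp A x))) \<in> borel_measurable borel"
    by (rule measurable_card[OF comp_mono[OF A(2)] _ p]) measurable
  show ?thesis unfolding icomp_def by measurable
qed

lemma rho_icomp: "A \<subseteq> E \<Longrightarrow> rho M E A = 1 - (\<integral>x. icomp A x \<partial>M)"
  unfolding rho_def icomp_def by (simp add: Int_absorb2 cong: if_cong)

lemma integrable_icomp:
  assumes A: "A \<in> uprod_sets" "A \<subseteq> E"
  shows "integrable M (icomp A)"
proof (rule integrable_const_bound[where B=1])
  show "icomp A \<in> borel_measurable M" using icomp_measurable[OF A] by measurable
qed (use icomp_bounds in auto)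

lemma rho_nn_integral:
  assumes A: "A \<in> uprod_sets" "A \<subseteq> E"
  shows "ennreal (rho M E A) = (\<integral>\<^sup>+x. ennreal (1 - icomp A x) \<partial>M)" and "0 \<le> rho M E A"
proof -
  have eq: "rho M E A = (\<integral>x. 1 - icomp A x \<partial>M)"
    using integrable_icomp[OF A] prob_space by (simp add: rho_icomp[OF A(2)])
  show "ennreal (rho M E A) = (\<integral>\<^sup>+x. ennreal (1 - icomp A x) \<partial>M)"
    unfolding eq using integrable_icomp[OF A] icomp_bounds by (intro nn_integral_eq_integral[symmetric]) auto
  show "0 \<le> rho M E A" unfolding eq using icomp_bounds by (intro integral_nonneg_AE) auto
qed

lemma rho_mono:
  assumes A: "A \<in> uprod_sets" and B: "B \<in> uprod_sets" "B \<subseteq> E" and sub: "A \<subseteq> B"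
  shows "rho M E A \<le> rho M E B"
proof -
  have AE: "A \<subseteq> E" using sub B by blast
  have "icomp B x \<le> icomp A x" for x
  proof (cases "finite (comp B x)")
    case True
    have "card (comp A x) \<le> card (comp B x)" by (rule card_mono[OF True comp_mono[OF sub]])
    moreover have "0 < card (comp A x)" using finite_subset[OF comp_mono[OF sub] True] comp_refl[of x A]
      by (simp add: card_gt_0_iff) blast
    ultimately show ?thesis using finite_subset[OF comp_mono[OF sub] True] True by (simp add: icomp_def frac_le)
  next
    case False then show ?thesis using icomp_bounds(1)[of A x] by (simp add: icomp_def)
  qed
  then have "(\<integral>x. icomp B x \<partial>M) \<le> (\<integral>x. icomp A x \<partial>M)"
    using integrable_icomp[OF A AE] integrable_icomp[OF B] by (intro integral_mono) auto
  then show ?thesis using rho_icomp AE B by simp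
qed

lemma sum_over_component:
  assumes "finite (comp A x)" "A \<subseteq> E"
  shows "(\<integral>\<^sup>+y. indicator (comp A x) y * h y \<partial>count_space (comp E x)) = (\<Sum>y\<in>comp A x. h y)"
proof -
  have "(\<integral>\<^sup>+y. indicator (comp A x) y * h y \<partial>count_space (comp E x)) = (\<Sum>y\<in>comp A x. indicator (comp A x) y * h y)"
    using assms comp_mono[OF assms(2)] by (intro nn_integral_count_space') auto
  then show ?thesis by simp
qed

lemma sum_icomp: "finite (comp A x) \<Longrightarrow> (\<Sum>y\<in>comp A x. ennreal (icomp A y)) = 1"
proof -
  assume fin: "finite (comp A x)"
  have "icomp A y = icomp A x" if "y \<in> comp A x" for y using comp_eq[OF that] by (simp add: icomp_def)
  then have "(\<Sum>y\<in>comp A x. ennreal (icomp A y)) = (\<Sum>y\<in>comp A x. ennreal (icomp A x))" by (intro sum.cong) simp_all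
  also have "\<dots> = ennreal (real (card (comp A x)) * icomp A x)"
    using icomp_bounds by (simp add: ennreal_mult ennreal_of_nat_eq_real_of_nat)
  also have "real (card (comp A x)) * icomp A x = 1"
    using fin comp_refl[of x A] by (auto simp: icomp_def card_gt_0_iff)
  finally show ?thesis by simp
qed

lemma pred_in_comp':
  assumes "A \<in> uprod_sets" "A \<subseteq> E"
  shows "Measurable.pred (borel \<Otimes>\<^sub>M borel) (\<lambda>(x, y). y \<in> comp A x)"
    and "Measurable.pred (borel \<Otimes>\<^sub>M borel) (\<lambda>(x, y). x \<in> comp A y)"
proof -
  have "Measurable.pred (borel \<Otimes>\<^sub>M borel) (\<lambda>p. snd p \<in> comp A (fst p))"
    by (rule pred_in_comp[OF assms]) measurable
  then show "Measurable.pred (borel \<Otimes>\<^sub>M borel) (\<lambda>(x, y). y \<in> comp A x)" by (simp add: split_beta')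
  have "Measurable.pred (borel \<Otimes>\<^sub>M borel) (\<lambda>p. fst p \<in> comp A (snd p))"
    by (rule pred_in_comp[OF assms]) measurable
  then show "Measurable.pred (borel \<Otimes>\<^sub>M borel) (\<lambda>(x, y). x \<in> comp A y)" by (simp add: split_beta')
qed

text \<open>Replacing \<open>f\<close> by its average over each finite component of \<open>A\<close>
  keeps the integral. In terms of mass transport, the vertex \<open>y\<close> distributes
  \<open>f y\<close> in equal shares over its component.\<close>

lemma mass_transport_within:
  assumes A: "A \<in> uprod_sets" "A \<subseteq> E" and fin: "\<And>x. finite (comp A x)"
    and [measurable]: "f \<in> borel_measurable borel"
  shows "(\<integral>\<^sup>+x. ennreal (icomp A x) * (\<Sum>y\<in>comp A x. f y) \<partial>M) = (\<integral>\<^sup>+x. f x \<partial>M)"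
proof -
  note [measurable] = icomp_measurable[OF A] pred_in_comp'[OF A]
  define h where "h x y = indicator (comp A x) y * (ennreal (icomp A x) * f y)" for x y
  have eq: "(\<lambda>(x, y). h x y) = (\<lambda>p. (if (\<lambda>(x, y). y \<in> comp A x) p then ennreal (icomp A (fst p)) * f (snd p) else 0))"
    by (auto simp: h_def)
  have [measurable]: "(\<lambda>(x, y). h x y) \<in> borel_measurable (borel \<Otimes>\<^sub>M borel)" unfolding eq by measurable
  have 1: "(\<integral>\<^sup>+y. h x y \<partial>count_space (comp E x)) = ennreal (icomp A x) * (\<Sum>y\<in>comp A x. f y)" for x
    unfolding h_def by (simp add: sum_over_component[OF fin A(2)] sum_distrib_left)
  have 2: "(\<integral>\<^sup>+y. h y x \<partial>count_space (comp E x)) = f x" for x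
  proof -
    have "h y x = indicator (comp A x) y * (ennreal (icomp A y) * f x)" for y
      using comp_sym[of x A y] comp_sym[of y A x] by (auto simp: h_def indicator_def)
    then show ?thesis
      by (simp add: sum_over_component[OF fin A(2)] sum_distrib_right[symmetric] sum_icomp[OF fin])
  qed
  show ?thesis using mass_transport[of h] unfolding 1 2 by simp
qed

lemma sum_edeg_component:
  assumes A: "A \<subseteq> E" and fin: "finite (comp A x)"
  shows "ennreal (icomp A x) * (\<Sum>y\<in>comp A x. edeg A y) = ennreal (icomp A x * real (\<Sum>y\<in>comp A x. card {z. Upair y z \<in> A}))"
proof -
  have "(\<Sum>y\<in>comp A x. edeg A y) = ennreal (real (\<Sum>y\<in>comp A x. card {z. Upair y z \<in> A}))"
    using Int_absorb2[OF A] by (simp add: edeg_card sum_ennreal)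
  then show ?thesis by (simp only: ennreal_mult[OF icomp_bounds(1) of_nat_0_le_iff])
qed

lemma component_average:
  assumes A: "A \<subseteq> E" and fin: "finite (comp A x)"
  shows "2 * (1 - icomp A x) \<le> icomp A x * real (\<Sum>y\<in>comp A x. card {z. Upair y z \<in> A})"
    and "acyclic_edges A \<Longrightarrow> icomp A x * real (\<Sum>y\<in>comp A x. card {z. Upair y z \<in> A}) = 2 * (1 - icomp A x)"
proof -
  let ?n = "card (comp A x)" and ?s = "\<Sum>y\<in>comp A x. card {z. Upair y z \<in> A}"
  have loop: "Upair y z \<in> A \<Longrightarrow> y \<noteq> z" for y z using Upair_E_neq A by blast
  have n: "0 < ?n" using fin comp_refl[of x A] by (auto simp: card_gt_0_iff)
  have i: "icomp A x = 1 / real ?n" using fin by (simp add: icomp_def)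
  have eq: "2 * (1 - icomp A x) = icomp A x * real (2 * (?n - 1))"
    using n by (simp add: i field_simps of_nat_diff)
  show "2 * (1 - icomp A x) \<le> icomp A x * real ?s"
    unfolding eq using comp_degree_sum(1)[OF fin loop] icomp_bounds by (intro mult_left_mono) (simp_all only: of_nat_le_iff)
  show "acyclic_edges A \<Longrightarrow> icomp A x * real ?s = 2 * (1 - icomp A x)"
    unfolding eq using comp_degree_sum(2)[OF fin loop] by simp
qed

lemma eta_finite_components:
  assumes A: "A \<in> uprod_sets" "A \<subseteq> E" and fin: "\<And>x. finite (comp A x)"
  shows "emeasure (eta M E) A = (\<integral>\<^sup>+x. ennreal (icomp A x * real (\<Sum>y\<in>comp A x. card {z. Upair y z \<in> A})) \<partial>M) / 2"
  unfolding emeasure_eta[OF A(1)] sum_edeg_component[OF A(2) fin, symmetric]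
  using mass_transport_within[OF A fin edeg_measurable[OF A(1)]] by simp

lemma nn_integral_twice_rho:
  assumes A: "A \<in> uprod_sets" "A \<subseteq> E"
  shows "(\<integral>\<^sup>+x. ennreal (2 * (1 - icomp A x)) \<partial>M) / 2 = ennreal (rho M E A)"
proof -
  note [measurable] = icomp_measurable[OF A]
  have "(\<integral>\<^sup>+x. ennreal (2 * (1 - icomp A x)) \<partial>M) = 2 * (\<integral>\<^sup>+x. ennreal (1 - icomp A x) \<partial>M)"
  proof (subst nn_integral_cmult[symmetric])
    have "ennreal (2 * (1 - icomp A x)) = 2 * ennreal (1 - icomp A x)" for x
      using icomp_bounds[of A x] by (subst ennreal_mult) auto
    then show "(\<integral>\<^sup>+x. ennreal (2 * (1 - icomp A x)) \<partial>M) = (\<integral>\<^sup>+x. 2 * ennreal (1 - icomp A x) \<partial>M)" by simp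
  qed measurable
  then show ?thesis using rho_nn_integral[OF A]
    by (simp add: mult.commute[of 2] ennreal_mult_divide_eq)
qed

text \<open>After averaging over components, both sides become integrals of functions constant on
  components. On n vertices the degree sum is at least 2(n - 1), with equality for trees; dividing
  by 2n yields the integrand 1 - 1/n of the rank.\<close>

lemma finite_components_rho_le_eta:
  assumes A: "A \<in> uprod_sets" "A \<subseteq> E" and fin: "\<And>x. finite (comp A x)"
  shows "ennreal (rho M E A) \<le> emeasure (eta M E) A"
    and "acyclic_edges A \<Longrightarrow> emeasure (eta M E) A = ennreal (rho M E A)"
proof -
  show "ennreal (rho M E A) \<le> emeasure (eta M E) A"
    unfolding eta_finite_components[OF A fin] nn_integral_twice_rho[OF A, symmetric]
    by (intro divide_right_mono_ennreal nn_integral_mono ennreal_leI component_average A fin)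
  assume "acyclic_edges A"
  then show "emeasure (eta M E) A = ennreal (rho M E A)"
    unfolding eta_finite_components[OF A fin] nn_integral_twice_rho[OF A, symmetric]
    by (simp only: component_average(2)[OF A(2) fin])
qed

lemma comp_Diff_untouched:
  assumes "comp (A - S) x \<inter> ends S = {}"
  shows "comp A x = comp (A - S) x"
proof
  show "comp (A - S) x \<subseteq> comp A x" by (rule comp_mono) blast
  show "comp A x \<subseteq> comp (A - S) x"
  proof
    fix y assume "y \<in> comp A x"
    then have "(x, y) \<in> (adj A)\<^sup>*" by (simp add: comp_def)
    then show "y \<in> comp (A - S) x"
    proof induction
      case base show ?case by (rule comp_refl)
    next
      case (step y z)
      then have "y \<notin> ends S" using assms by blast
      then have "Upair y z \<in> A - S" using step by (auto simp: ends_def adj_def)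
      then show ?case by (rule comp_step[OF step.IH])
    qed
  qed
qed

text \<open>A component of \<open>A - S\<close> that contains no end of an edge of \<open>S\<close>
  is still a component of \<open>A\<close>. On any other component the integrand grows by at most
  1/n per vertex, hence by at most 1 in total, which is charged to one of the ends it contains. The
  ends of \<open>S\<close> have measure at most twice that of \<open>S\<close>.\<close>

lemma rho_Diff:
  assumes A: "A \<in> uprod_sets" "A \<subseteq> E" and S: "S \<in> uprod_sets" "S \<subseteq> A" and fin: "\<And>x. finite (comp (A - S) x)"
  shows "ennreal (rho M E A) \<le> ennreal (rho M E (A - S)) + 2 * emeasure (eta M E) S"
proof -
  let ?B = "A - S"
  have B: "?B \<in> uprod_sets" "?B \<subseteq> E" using A S by (auto intro: uprod_sets_Diff)
  have SE: "S \<subseteq> E" using S A by blast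
  note [measurable] = icomp_measurable[OF A] icomp_measurable[OF B] ends_measurable[OF S(1) SE]
  let ?f = "indicator (ends S) :: 'a \<Rightarrow> ennreal"
  have pt: "ennreal (1 - icomp A x) \<le> ennreal (1 - icomp ?B x) + ennreal (icomp ?B x) * (\<Sum>y\<in>comp ?B x. ?f y)" for x
  proof (cases "comp ?B x \<inter> ends S = {}")
    case True
    then have "icomp A x = icomp ?B x" using comp_Diff_untouched[OF True] by (simp add: icomp_def)
    then show ?thesis by simp
  next
    case False
    then obtain y where y: "y \<in> comp ?B x" "y \<in> ends S" by blast
    have "?f y \<le> (\<Sum>y\<in>comp ?B x. ?f y)" by (rule member_le_sum[OF y(1) _ fin]) simp
    then have "1 \<le> (\<Sum>y\<in>comp ?B x. ?f y)" using y by simp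
    then have "ennreal (icomp ?B x) * 1 \<le> ennreal (icomp ?B x) * (\<Sum>y\<in>comp ?B x. ?f y)" by (intro mult_left_mono) auto
    moreover have "ennreal (1 - icomp A x) \<le> ennreal (1 - icomp ?B x) + ennreal (icomp ?B x)"
      using icomp_bounds[of A x] icomp_bounds[of ?B x] by (subst ennreal_plus[symmetric]) (auto intro: ennreal_leI)
    ultimately show ?thesis by (simp only: mult_1_right) (meson add_left_mono order_trans)
  qed
  have "ennreal (rho M E A) \<le> (\<integral>\<^sup>+x. ennreal (1 - icomp ?B x) + ennreal (icomp ?B x) * (\<Sum>y\<in>comp ?B x. ?f y) \<partial>M)"
    unfolding rho_nn_integral[OF A] by (intro nn_integral_mono pt)
  also have "\<dots> = (\<integral>\<^sup>+x. ennreal (1 - icomp ?B x) \<partial>M) + (\<integral>\<^sup>+x. ennreal (icomp ?B x) * (\<Sum>y\<in>comp ?B x. ?f y) \<partial>M)"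
  proof (rule nn_integral_add)
    note [measurable] = pred_in_comp'[OF B]
    have eq: "(\<Sum>y\<in>comp ?B x. ?f y) = (\<integral>\<^sup>+y. (if (\<lambda>(x, y). y \<in> comp ?B x) (x, y) then ?f y else 0) \<partial>count_space (comp E x))" for x
      by (subst sum_over_component[OF fin B(2), symmetric]) (auto intro!: nn_integral_cong simp: indicator_def)
    show "(\<lambda>x. ennreal (icomp ?B x) * (\<Sum>y\<in>comp ?B x. ?f y)) \<in> borel_measurable M"
      unfolding eq by measurable
  qed measurable
  also have "(\<integral>\<^sup>+x. ennreal (icomp ?B x) * (\<Sum>y\<in>comp ?B x. ?f y) \<partial>M) = emeasure M (ends S)"
    by (subst mass_transport_within[OF B fin]) measurable
  also have "(\<integral>\<^sup>+x. ennreal (1 - icomp ?B x) \<partial>M) = ennreal (rho M E ?B)" using rho_nn_integral[OF B] by simp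
  finally show ?thesis using emeasure_ends[OF S(1) SE] by (meson add_left_mono order_trans)
qed

theorem hyperfinite_rho_le_eta:
  assumes A: "A \<in> uprod_sets" "A \<subseteq> E" and hyp: "hyperfinite M E A"
  shows "rho M E A \<le> measure (eta M E) A"
proof (rule field_le_epsilon)
  fix e :: real assume "e > 0"
  \<comment> \<open>Half of \<open>e\<close> compensates the factor 2 in
    \<open>rho_Diff\<close>.\<close>
  then have "e / 2 > 0" by simp
  then obtain S where S: "S \<in> uprod_sets" "S \<subseteq> A" "emeasure (eta M E) S \<le> ennreal (e / 2)"
    and fin: "\<And>x. finite (comp (A - S) x)"
    using hyp unfolding hyperfinite_def sets_eta by blast
  have B: "A - S \<in> uprod_sets" "A - S \<subseteq> E" using A S by (auto intro: uprod_sets_Diff)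
  have "ennreal (rho M E A) \<le> emeasure (eta M E) (A - S) + 2 * ennreal (e / 2)"
    using rho_Diff[OF A S(1,2) fin] finite_components_rho_le_eta(1)[OF B fin] S(3)
    by (meson add_mono mult_left_mono order_trans zero_le)
  also have "\<dots> \<le> emeasure (eta M E) A + 2 * ennreal (e / 2)"
    using A by (intro add_right_mono emeasure_mono) (auto simp: sets_eta)
  also have "\<dots> = ennreal (measure (eta M E) A + e)"
    using \<open>e > 0\<close> by (simp add: eta.emeasure_eq_measure ennreal_mult'[symmetric] flip: ennreal_numeral ennreal_plus)
  finally show "rho M E A \<le> measure (eta M E) A + e" using \<open>e > 0\<close> by (subst (asm) ennreal_le_iff) auto
qed

text \<open>On \<open>A - S\<close> all components are finite trees, so rank and edge measure agree
  there. Restoring \<open>S\<close> costs at most \<open>e\<close> in measure and can only increase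
  the rank.\<close>

theorem hyperfinite_acyclic_eta_le_rho:
  assumes A: "A \<in> uprod_sets" "A \<subseteq> E" and hyp: "hyperfinite M E A" and acyc: "acyclic_edges A"
  shows "measure (eta M E) A \<le> rho M E A"
proof (rule field_le_epsilon)
  fix e :: real assume e: "e > 0"
  then obtain S where S: "S \<in> uprod_sets" "S \<subseteq> A" "emeasure (eta M E) S \<le> ennreal e"
    and fin: "\<And>x. finite (comp (A - S) x)"
    using hyp unfolding hyperfinite_def sets_eta by blast
  have B: "A - S \<in> uprod_sets" "A - S \<subseteq> E" using A S by (auto intro: uprod_sets_Diff)
  have "acyclic_edges (A - S)" by (rule acyclic_edges_subset[OF acyc]) blast
  then have "ennreal (measure (eta M E) (A - S)) = ennreal (rho M E (A - S))"
    using finite_components_rho_le_eta(2)[OF B fin] by (simp add: eta.emeasure_eq_measure)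
  then have "measure (eta M E) (A - S) = rho M E (A - S)" using rho_nn_integral(2)[OF B] by simp
  moreover have "measure (eta M E) S \<le> e" using S(3) e by (simp add: eta.emeasure_eq_measure)
  moreover have "measure (eta M E) A = measure (eta M E) (A - S) + measure (eta M E) S"
    using eta.finite_measure_Diff[of A S] A S by (simp add: sets_eta)
  ultimately show "measure (eta M E) A \<le> rho M E A + e" using rho_mono[OF B(1) A] by simp
qed

lemma hyperfinite_subset:
  assumes "hyperfinite M E A" "B \<subseteq> A" "B \<in> uprod_sets"
  shows "hyperfinite M E B"
  unfolding hyperfinite_def
proof (intro allI impI)
  fix e :: real assume "e > 0"
  then obtain S where S: "S \<in> uprod_sets" "S \<subseteq> A" "emeasure (eta M E) S \<le> ennreal e"
    and fin: "\<And>x. finite (comp (A - S) x)"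
    using assms(1) unfolding hyperfinite_def sets_eta by blast
  have "emeasure (eta M E) (S \<inter> B) \<le> emeasure (eta M E) S" using S by (intro emeasure_mono) (auto simp: sets_eta)
  moreover have "finite (comp (B - S \<inter> B) x)" for x
    by (rule finite_subset[OF comp_mono fin[of x]]) (use assms in auto)
  ultimately show "\<exists>S\<in>sets (eta M E). S \<subseteq> B \<and> emeasure (eta M E) S \<le> ennreal e \<and> (\<forall>x. finite (comp (B - S) x))"
    using S assms(3) by (intro bexI[of _ "S \<inter> B"]) (auto simp: sets_eta intro: uprod_sets_Int order_trans)
qed

end

section \<open>The wired maximal spanning forest\<close>

text \<open>Reduces connectedness to finite edge sets. This matters because only those are certain
  to have a smallest edge.\<close>

lemma finite_reach:
  assumes "y \<in> comp F x"
  shows "\<exists>W\<subseteq>F. finite W \<and> y \<in> comp W x"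
  using assms unfolding comp_def mem_Collect_eq
proof (induction rule: rtrancl_induct)
  case base show ?case by (intro exI[of _ "{}"]) simp
next
  case (step y z)
  then obtain W where W: "W \<subseteq> F" "finite W" "(x, y) \<in> (adj W)\<^sup>*" by blast
  let ?W = "insert (Upair y z) W"
  have "(x, y) \<in> (adj ?W)\<^sup>*" using W(3) rtrancl_mono[OF adj_mono[of W ?W]] by blast
  moreover have "(y, z) \<in> adj ?W" by (simp add: adj_def)
  ultimately have "(x, z) \<in> (adj ?W)\<^sup>*" by (rule rtrancl_into_rtrancl)
  then show ?case using W step(2) by (intro exI[of _ ?W]) (auto simp: adj_def)
qed

lemma comp_insert_edge:
  assumes "y \<in> comp (insert (Upair c d) W) x"
  shows "y \<in> comp W x \<or> (c \<in> comp W x \<and> y \<in> comp W d) \<or> (d \<in> comp W x \<and> y \<in> comp W c)"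
  using assms unfolding comp_def[of "insert (Upair c d) W"] mem_Collect_eq
proof (induction rule: rtrancl_induct)
  case base show ?case by (simp add: comp_refl)
next
  case (step y z)
  from step(2) have "Upair y z \<in> W \<or> (y = c \<and> z = d) \<or> (y = d \<and> z = c)" by (auto simp: adj_def)
  then show ?case
  proof (elim disjE conjE)
    assume "Upair y z \<in> W"
    then show ?case using step(3) comp_step[of y W _ z] by blast
  next
    assume "y = c" "z = d"
    then show ?case using step(3) comp_refl[of d W] comp_sym[of c W d] comp_trans[of d W x c] comp_trans[of c W x d] by blast
  next
    assume "y = d" "z = c"
    then show ?case using step(3) comp_refl[of c W] comp_sym[of d W c] comp_trans[of d W x c] comp_trans[of c W x d] by blast
  qed
qed

section \<open>Combinatorics of a totally ordered, locally finite edge set\<close>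

locale ordered_edges =
  fixes E :: "'a uprod set" and gt :: "'a uprod \<Rightarrow> 'a uprod \<Rightarrow> bool"
  assumes gt_trans: "gt a b \<Longrightarrow> gt b c \<Longrightarrow> gt a c"
    and gt_irrefl: "\<not> gt a a"
    and gt_total: "a \<in> E \<Longrightarrow> b \<in> E \<Longrightarrow> a \<noteq> b \<Longrightarrow> gt a b \<or> gt b a"
    and locally_finite: "finite {y. Upair x y \<in> E}"
    and loopless: "Upair x y \<in> E \<Longrightarrow> x \<noteq> y"
begin

definition Up :: "'a uprod \<Rightarrow> 'a uprod set" where "Up e = {d \<in> E. gt d e}"

text \<open>The edge from \<open>a\<close> to \<open>b\<close> is the largest one leaving the finite cluster formed at \<open>a\<close> by the larger
  edges.\<close>
definition exits :: "'a \<Rightarrow> 'a \<Rightarrow> bool" where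
  "exits a b \<longleftrightarrow> Upair a b \<in> E \<and> finite (comp (Up (Upair a b)) a) \<and> b \<notin> comp (Up (Upair a b)) a"

definition wmsf :: "'a uprod set" where "wmsf = {Upair a b | a b. exits a b}"

definition ray :: "'a \<Rightarrow> 'a \<Rightarrow> bool" where
  "ray a b \<longleftrightarrow> exits a b \<and> infinite (comp (Up (Upair a b)) b)"

text \<open>The index counts predecessors. One ray precedes another if it ends in the finite cluster
  from which the other starts.\<close>

fun chain :: "nat \<Rightarrow> 'a \<Rightarrow> 'a \<Rightarrow> bool" where
  "chain 0 a b = ray a b"
| "chain (Suc n) a b = (ray a b \<and> (\<exists>a' b'. chain n a' b' \<and> b' \<in> comp (Up (Upair a b)) a))"

text \<open>Two kinds of edges are removed: those merging two finite clusters into more than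
  \<open>n\<close> vertices, and rays with \<open>n\<close> predecessors. What remains is covered by
  \<open>small n\<close> and the rays in \<open>late n\<close>.\<close>

definition cut :: "nat \<Rightarrow> 'a uprod set" where
  "cut n = {Upair a b | a b. exits a b \<and> finite (comp (Up (Upair a b)) b) \<and>
       n < card (comp (Up (Upair a b)) a \<union> comp (Up (Upair a b)) b)}
     \<union> {Upair a b | a b. chain n a b}"

lemma wmsf_subset: "wmsf \<subseteq> E" by (auto simp: wmsf_def exits_def)
lemma Up_subset: "Up e \<subseteq> E" by (auto simp: Up_def)
lemma Up_mono: "gt d e \<Longrightarrow> Up d \<subseteq> Up e" using gt_trans by (auto simp: Up_def)

lemma gt_minimum:
  assumes "finite W" "W \<noteq> {}" "W \<subseteq> E"
  shows "\<exists>e\<in>W. \<forall>d\<in>W. d \<noteq> e \<longrightarrow> gt d e"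
  using assms
proof (induction rule: finite_ne_induct)
  case (insert x W)
  then obtain e where e: "e \<in> W" "\<forall>d\<in>W. d \<noteq> e \<longrightarrow> gt d e" by auto
  show ?case
  proof (cases "gt x e")
    case True then show ?thesis using e by blast
  next
    case False
    then have "gt e x" using gt_total[of x e] insert e by blast
    have "gt d x" if "d \<in> insert x W" "d \<noteq> x" for d
      using that e \<open>gt e x\<close> gt_trans[of d e x] by (cases "d = e") auto
    then show ?thesis by blast
  qed
qed simp

lemma gt_maximum:
  assumes "finite W" "W \<noteq> {}" "W \<subseteq> E"
  shows "\<exists>e\<in>W. \<forall>d\<in>W. d \<noteq> e \<longrightarrow> gt e d"
  using assms
proof (induction rule: finite_ne_induct)
  case (insert x W)
  then obtain e where e: "e \<in> W" "\<forall>d\<in>W. d \<noteq> e \<longrightarrow> gt e d" by auto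
  show ?case
  proof (cases "gt e x")
    case True then show ?thesis using e by blast
  next
    case False
    then have "gt x e" using gt_total[of x e] insert e by blast
    have "gt x d" if "d \<in> insert x W" "d \<noteq> x" for d
      using that e \<open>gt x e\<close> gt_trans[of x e d] by (cases "d = e") auto
    then show ?thesis by blast
  qed
qed simp

text \<open>Edges are inserted in decreasing order. When \<open>e\<close> is added, the edges
  already present lie in \<open>Up e\<close>, so their components are contained in the clusters that
  decide the status of \<open>e\<close>.\<close>

lemma finite_min_induct [consumes 2, case_names empty insert]:
  assumes "finite W" "W \<subseteq> E" "P {}"
    and step: "\<And>e W. finite W \<Longrightarrow> e \<in> E \<Longrightarrow> W \<subseteq> Up e \<Longrightarrow> P W \<Longrightarrow> P (insert e W)"
  shows "P W"
  using assms(1,2)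
proof (induction "card W" arbitrary: W)
  case 0 then show ?case using assms(3) by simp
next
  case (Suc n)
  then have "W \<noteq> {}" by auto
  then obtain e where e: "e \<in> W" "\<forall>d\<in>W. d \<noteq> e \<longrightarrow> gt d e" using gt_minimum Suc.prems by blast
  have "P (W - {e})" using Suc e by (intro Suc.hyps(1)) auto
  moreover have "W - {e} \<subseteq> Up e" using e Suc.prems by (auto simp: Up_def)
  ultimately have "P (insert e (W - {e}))" using step[of "W - {e}" e] e Suc.prems by auto
  then show ?case using e by (simp add: insert_absorb)
qed

lemma wmsf_separates:
  assumes "Upair c d \<in> wmsf"
  shows "d \<notin> comp (Up (Upair c d)) c"
proof -
  obtain a b where ab: "Upair c d = Upair a b" "exits a b" using assms by (auto simp: wmsf_def)
  have "b \<notin> comp (Up (Upair c d)) a" using ab(2) unfolding exits_def ab(1)[symmetric] by blast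
  moreover have "(c = a \<and> d = b) \<or> (c = b \<and> d = a)" using ab(1) by simp
  ultimately show ?thesis using comp_sym[of d _ c] by blast
qed

text \<open>The smallest edge \<open>m\<close> joins vertices that the larger edges leave
  disconnected. A cycle through another edge \<open>e\<close> would have to use \<open>m\<close>,
  since \<open>W\<close> is acyclic by induction; travelling the rest of that cycle, including
  \<open>e\<close>, would connect the ends of \<open>m\<close> inside \<open>W\<close>.\<close>

lemma acyclic_finite_wmsf:
  assumes "finite W" "W \<subseteq> E" "W \<subseteq> wmsf"
  shows "acyclic_edges W"
  using assms
proof (induction rule: finite_min_induct)
  case empty show ?case by (simp add: acyclic_edges_def cycle_edge_def)
next
  case (insert m W)
  have acyc: "acyclic_edges W" using insert by simp
  obtain c d where m: "m = Upair c d" by (cases m)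
  have sep: "d \<notin> comp W c"
    using wmsf_separates[of c d] insert.prems insert.hyps(3) m comp_mono[of W "Up m" c] by auto
  show ?case unfolding acyclic_edges_def
  proof (intro allI notI)
    fix e assume "cycle_edge (insert m W) e"
    then obtain a b where e: "e \<in> insert m W" "e = Upair a b" "b \<in> comp (insert m W - {e}) a"
      by (auto simp: cycle_edge_def comp_def)
    show False
    proof (cases "e = m")
      case True
      then have "b \<in> comp W a" using e comp_mono[of "insert m W - {e}" W a] by auto
      moreover have "(a = c \<and> b = d) \<or> (a = d \<and> b = c)" using True e m by auto
      ultimately show False using sep comp_sym[of b W a] by auto
    next
      case False
      let ?W = "W - {e}"
      have eW: "Upair a b \<in> W" using e False by auto
      have ba: "b \<notin> comp ?W a"
      proof
        assume "b \<in> comp ?W a"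
        moreover have "a \<noteq> b" using loopless[of a b] eW insert.hyps(3) Up_subset by blast
        ultimately have "cycle_edge W e" using eW e by (auto simp: cycle_edge_def comp_def)
        then show False using acyc by (simp add: acyclic_edges_def)
      qed
      have "insert m W - {e} = insert (Upair c d) ?W" using False m by auto
      then have "b \<in> comp (insert (Upair c d) ?W) a" using e(3) by simp
      then have "(c \<in> comp ?W a \<and> b \<in> comp ?W d) \<or> (d \<in> comp ?W a \<and> b \<in> comp ?W c)"
        using comp_insert_edge[of b c d ?W a] ba by blast
      then have "(c \<in> comp W a \<and> b \<in> comp W d) \<or> (d \<in> comp W a \<and> b \<in> comp W c)"
        using comp_mono[of ?W W a] comp_mono[of ?W W c] comp_mono[of ?W W d] by blast
      moreover have ba: "b \<in> comp W a" using eW by (rule Upair_in_comp)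
      ultimately have "d \<in> comp W c"
      proof (elim disjE conjE)
        assume c: "c \<in> comp W a" "b \<in> comp W d"
        have "b \<in> comp W c" by (rule comp_trans[OF comp_sym[OF c(1)] ba])
        then show ?thesis by (rule comp_trans) (rule comp_sym[OF c(2)])
      next
        assume c: "d \<in> comp W a" "b \<in> comp W c"
        have "a \<in> comp W c" by (rule comp_trans[OF c(2) comp_sym[OF ba]])
        then show ?thesis using c(1) by (rule comp_trans)
      qed
      then show False using sep by simp
    qed
  qed
qed

theorem acyclic_wmsf: "acyclic_edges wmsf"
  unfolding acyclic_edges_def
proof (intro allI notI)
  fix e assume "cycle_edge wmsf e"
  then obtain a b where e: "e \<in> wmsf" "e = Upair a b" "a \<noteq> b" "b \<in> comp (wmsf - {e}) a"
    by (auto simp: cycle_edge_def comp_def)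
  obtain W where W: "W \<subseteq> wmsf - {e}" "finite W" "b \<in> comp W a" using finite_reach[OF e(4)] by blast
  have "acyclic_edges (insert e W)" using W e(1) wmsf_subset by (intro acyclic_finite_wmsf) auto
  moreover have eq: "insert e W - {e} = W" using W by auto
  have "cycle_edge (insert e W) e" unfolding cycle_edge_def eq using e(2,3) W(3) by (auto simp: comp_def)
  ultimately show False by (simp add: acyclic_edges_def)
qed

text \<open>Otherwise let \<open>e\<close> be the largest of the finitely many edges of
  \<open>U\<close> that leave the finite component. A larger edge leaving it would again lie in the
  upward closed set \<open>U\<close>, so the cluster of \<open>e\<close> at its inner end stays
  inside the component and is finite. Then \<open>e\<close> belongs to the forest after all.\<close>

theorem wmsf_spanning:
  assumes sub: "U \<subseteq> E" and up: "\<And>d e. e \<in> U \<Longrightarrow> d \<in> E \<Longrightarrow> gt d e \<Longrightarrow> d \<in> U"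
    and fin: "finite (comp (wmsf \<inter> U) x)"
  shows "comp (wmsf \<inter> U) x = comp U x"
proof (rule ccontr)
  let ?K = "comp (wmsf \<inter> U) x"
  assume "?K \<noteq> comp U x"
  then obtain y where y: "y \<in> comp U x" "y \<notin> ?K" using comp_mono[of "wmsf \<inter> U" U x] by auto
  let ?B = "{Upair a b | a b. a \<in> ?K \<and> b \<notin> ?K \<and> Upair a b \<in> U}"
  have "?B \<noteq> {}"
  proof
    assume B: "?B = {}"
    have "(x, y) \<in> (adj U)\<^sup>*" using y by (simp add: comp_def)
    then have "y \<in> ?K"
    proof (induction rule: rtrancl_induct)
      case base show ?case by (rule comp_refl)
    next
      case (step y z) then show ?case using B by (auto simp: adj_def)
    qed
    then show False using y by simp
  qed
  moreover have "finite ?B"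
  proof (rule finite_subset)
    show "?B \<subseteq> (\<Union>a\<in>?K. Upair a ` {b. Upair a b \<in> E})" using sub by blast
    show "finite (\<Union>a\<in>?K. Upair a ` {b. Upair a b \<in> E})" using fin locally_finite by blast
  qed
  moreover have "?B \<subseteq> E" using sub by blast
  ultimately obtain e where e: "e \<in> ?B" "\<forall>d\<in>?B. d \<noteq> e \<longrightarrow> gt e d" using gt_maximum by meson
  then obtain a b where ab: "e = Upair a b" "a \<in> ?K" "b \<notin> ?K" "Upair a b \<in> U" by blast
  have "z \<in> ?K" if "z \<in> comp (Up e) a" for z
  proof -
    have "(a, z) \<in> (adj (Up e))\<^sup>*" using that by (simp add: comp_def)
    then show ?thesis
    proof (induction rule: rtrancl_induct)
      case base show ?case by (rule ab)
    next
      case (step y z)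
      then have yz: "Upair y z \<in> E" "gt (Upair y z) e" by (auto simp: adj_def Up_def)
      then have U: "Upair y z \<in> U" using up[of e] ab by blast
      show ?case
      proof (rule ccontr)
        assume "z \<notin> ?K"
        then have "Upair y z \<in> ?B" using step(3) U by blast
        moreover have "Upair y z \<noteq> e" using yz(2) gt_irrefl[of e] by metis
        ultimately have "gt e (Upair y z)" by (rule e(2)[rule_format])
        then show False using gt_trans[OF yz(2)] gt_irrefl by blast
      qed
    qed
  qed
  then have "comp (Up e) a \<subseteq> ?K" by blast
  then have "exits a b" using ab sub finite_subset[OF _ fin] by (auto simp: exits_def)
  then have "Upair a b \<in> wmsf \<inter> U" using ab by (auto simp: wmsf_def)
  then have "b \<in> ?K" using comp_step[OF ab(2)] by blast
  then show False using ab by simp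
qed

lemma ray_orientation: "ray a b \<Longrightarrow> ray a' b' \<Longrightarrow> Upair a b = Upair a' b' \<Longrightarrow> a = a' \<and> b = b'"
proof -
  assume r: "ray a b" "ray a' b'" and eq: "Upair a b = Upair a' b'"
  have "finite (comp (Up (Upair a b)) a)" "infinite (comp (Up (Upair a b)) b')"
    using r unfolding ray_def exits_def eq by auto
  then have "a \<noteq> b'" by auto
  then show ?thesis using eq by auto
qed

text \<open>A ray is larger than the threshold \<open>e\<close>, hence present in
  \<open>Up e\<close>. Any cluster of \<open>Up e\<close> that meets the finite side of the ray
  therefore contains its infinite side too.\<close>

lemma ray_absorbs:
  assumes "gt d e" "ray a b" "d = Upair a b" "x \<in> comp (Up d) a" "finite (comp (Up e) x)"
  shows False
proof -
  have "a \<in> comp (Up e) x" using comp_sym[OF assms(4)] comp_mono[OF Up_mono[OF assms(1)], of x] by blast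
  moreover have "Upair a b \<in> Up e" using assms by (simp add: Up_def ray_def exits_def)
  ultimately have "b \<in> comp (Up e) x" by (rule comp_step)
  then have "comp (Up e) b = comp (Up e) x" by (rule comp_eq)
  then have "comp (Up d) b \<subseteq> comp (Up e) x" using comp_mono[OF Up_mono[OF assms(1)], of b] by simp
  then have "finite (comp (Up d) b)" using assms(5) by (rule finite_subset)
  then show False using assms(2,3) by (simp add: ray_def)
qed

text \<open>Of two distinct rays one is larger, and the finite cluster of the smaller one would
  absorb it. Hence each vertex lies in the starting cluster of at most one ray: rays form a
  functional graph.\<close>

lemma ray_unique:
  assumes r: "ray a b" "ray a' b'" and x: "x \<in> comp (Up (Upair a b)) a" "x \<in> comp (Up (Upair a' b')) a'"
  shows "a = a' \<and> b = b'"
proof (cases "Upair a b = Upair a' b'")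
  case True then show ?thesis using ray_orientation r by blast
next
  case False
  have fin: "finite (comp (Up (Upair a b)) x)" "finite (comp (Up (Upair a' b')) x)"
    using r comp_eq[OF x(1)] comp_eq[OF x(2)] by (auto simp: ray_def exits_def)
  have "Upair a b \<in> E" "Upair a' b' \<in> E" using r by (auto simp: ray_def exits_def)
  then have "gt (Upair a b) (Upair a' b') \<or> gt (Upair a' b') (Upair a b)" using gt_total False by blast
  then show ?thesis using ray_absorbs[OF _ r(1) refl x(1) fin(2)] ray_absorbs[OF _ r(2) refl x(2) fin(1)] by blast
qed

text \<open>If the first ray were the larger one, the infinite cluster at its head \<open>b\<close>
  would be contained in the finite cluster from which the second ray starts.\<close>

lemma ray_increasing:
  assumes r: "ray a b" "ray a' b'" and b: "b \<in> comp (Up (Upair a' b')) a'"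
  shows "gt (Upair a' b') (Upair a b)"
proof -
  have "Upair a b \<noteq> Upair a' b'"
  proof
    assume eq: "Upair a b = Upair a' b'"
    then have "a = a'" "b = b'" using ray_orientation r by blast+
    then show False using r b by (auto simp: ray_def exits_def)
  qed
  moreover have "\<not> gt (Upair a b) (Upair a' b')"
  proof
    assume gt: "gt (Upair a b) (Upair a' b')"
    have "comp (Up (Upair a b)) b \<subseteq> comp (Up (Upair a' b')) a'"
      using comp_mono[OF Up_mono[OF gt], of b] comp_eq[OF b] by simp
    moreover have "finite (comp (Up (Upair a' b')) a')" using r(2) by (simp add: ray_def exits_def)
    ultimately show False using r(1) finite_subset unfolding ray_def by metis
  qed
  ultimately show ?thesis using gt_total[of "Upair a b" "Upair a' b'"] r by (auto simp: ray_def exits_def)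
qed

lemma chain_ray: "chain n a b \<Longrightarrow> ray a b" by (cases n) auto

lemma chain_decreasing: "chain (Suc n) a b \<Longrightarrow> chain n a b"
proof (induction n arbitrary: a b)
  case (Suc n)
  then obtain a' b' where "ray a b" "chain (Suc n) a' b'" "b' \<in> comp (Up (Upair a b)) a" by auto
  then show ?case using Suc.IH[of a' b'] by auto
qed simp

lemma chain_antimono: "n \<le> m \<Longrightarrow> chain m a b \<Longrightarrow> chain n a b"
  by (induction rule: dec_induct) (auto dest: chain_decreasing simp del: chain.simps)

text \<open>Koenig's argument. A predecessor ends in a finite cluster and the graph is locally
  finite, so there are finitely many candidates; one of them must serve chains of every
  length.\<close>

lemma infinite_chain_predecessor:
  assumes "\<And>n. chain n a b"
  shows "\<exists>a' b'. (\<forall>n. chain n a' b') \<and> b' \<in> comp (Up (Upair a b)) a"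
proof (rule ccontr)
  assume neg: "\<not> ?thesis"
  let ?K = "comp (Up (Upair a b)) a"
  let ?P = "SIGMA b':?K. {a'. Upair b' a' \<in> E}"
  have fin: "finite ?P" using chain_ray[OF assms] locally_finite by (auto simp: ray_def exits_def)
  have "\<forall>p\<in>?P. \<exists>n. \<not> chain n (snd p) (fst p)" using neg by auto
  then obtain N where N: "\<And>p. p \<in> ?P \<Longrightarrow> \<not> chain (N p) (snd p) (fst p)" by metis
  obtain m where m: "\<And>p. p \<in> ?P \<Longrightarrow> N p \<le> m" using finite_nat_set_iff_bounded_le[of "N ` ?P"] fin by auto
  obtain a' b' where ab: "chain m a' b'" "b' \<in> ?K" using assms[of "Suc m"] by auto
  have "Upair a' b' \<in> E" using chain_ray[OF ab(1)] by (simp add: ray_def exits_def)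
  then have "(b', a') \<in> ?P" using ab Upair_commute[of a' b'] by (simp del: Upair_inject)
  then show False using N[of "(b', a')"] m[of "(b', a')"] chain_antimono[OF _ ab(1)] by simp
qed

section \<open>Finiteness of the components left after cutting\<close>

definition small :: "nat \<Rightarrow> 'a uprod set" where
  "small n = {Upair a b | a b. exits a b \<and> finite (comp (Up (Upair a b)) b) \<and>
     card (comp (Up (Upair a b)) a \<union> comp (Up (Upair a b)) b) \<le> n}"

definition late :: "nat \<Rightarrow> 'a \<Rightarrow> 'a \<Rightarrow> bool" where "late n a b \<longleftrightarrow> ray a b \<and> \<not> chain n a b"

lemma wmsf_minus_cut: "wmsf - cut n \<subseteq> small n \<union> {Upair a b | a b. late n a b}"
proof
  fix e assume e: "e \<in> wmsf - cut n"
  then obtain a b where ab: "e = Upair a b" "exits a b" by (auto simp: wmsf_def)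
  show "e \<in> small n \<union> {Upair a b | a b. late n a b}"
  proof (cases "finite (comp (Up e) b)")
    case True
    then have "\<not> n < card (comp (Up e) a \<union> comp (Up e) b)" using e ab unfolding cut_def by blast
    then show ?thesis using True ab unfolding small_def by (auto simp: not_less)
  next
    case False
    then have "ray a b" using ab by (simp add: ray_def)
    moreover have "\<not> chain n a b" using e ab unfolding cut_def by blast
    ultimately show ?thesis using ab unfolding late_def by blast
  qed
qed

lemma small_subset: "small n \<subseteq> E" by (auto simp: small_def exits_def)

lemma small_finite_ends:
  assumes "Upair y z \<in> small n"
  shows "finite (comp (Up (Upair y z)) y)" "finite (comp (Up (Upair y z)) z)"
    "card (comp (Up (Upair y z)) y \<union> comp (Up (Upair y z)) z) \<le> n"
proof -
  obtain a b where ab: "Upair y z = Upair a b" "exits a b" "finite (comp (Up (Upair a b)) b)"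
    "card (comp (Up (Upair a b)) a \<union> comp (Up (Upair a b)) b) \<le> n"
    using assms unfolding small_def by blast
  have "finite (comp (Up (Upair y z)) a)" "finite (comp (Up (Upair y z)) b)"
    "card (comp (Up (Upair y z)) a \<union> comp (Up (Upair y z)) b) \<le> n"
    using ab(2-4) unfolding exits_def ab(1)[symmetric] by auto
  moreover have "(y = a \<and> z = b) \<or> (y = b \<and> z = a)" using ab(1) by simp
  ultimately show "finite (comp (Up (Upair y z)) y)" "finite (comp (Up (Upair y z)) z)"
    "card (comp (Up (Upair y z)) y \<union> comp (Up (Upair y z)) z) \<le> n" by (auto simp: Un_commute)
qed

text \<open>In decreasing order, each new edge merges components contained in its two clusters,
  which together have at most \<open>n\<close> vertices. The bound \<open>Suc n\<close> also covers
  isolated vertices when \<open>n\<close> is 0.\<close>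

lemma finite_small_components:
  assumes "finite W" "W \<subseteq> E" "W \<subseteq> small n"
  shows "finite (comp W x) \<and> card (comp W x) \<le> Suc n"
  using assms
proof (induction arbitrary: x rule: finite_min_induct)
  case empty
  have "comp {} x = {x}" by (auto simp: comp_def adj_def)
  then show ?case by simp
next
  case (insert e W)
  obtain a b where e: "e = Upair a b" by (cases e)
  have s: "Upair a b \<in> small n" using insert.prems e by simp
  let ?K = "comp (Up e) a \<union> comp (Up e) b"
  have K: "finite ?K" "card ?K \<le> n" using small_finite_ends[OF s] e by auto
  have sub: "comp W z \<subseteq> comp (Up e) z" for z by (rule comp_mono[OF insert.hyps(3)])
  show ?case
  proof (cases "a \<in> comp W x \<or> b \<in> comp W x")
    case True
    then have "comp W x = comp W a \<or> comp W x = comp W b" using comp_eq[of a W x] comp_eq[of b W x] by auto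
    then have "comp (insert e W) x \<subseteq> comp W a \<union> comp W b" using comp_insert_edge[of _ a b W x] e by blast
    then have "comp (insert e W) x \<subseteq> ?K" using sub by blast
    then show ?thesis using K card_mono[OF K(1)] finite_subset[OF _ K(1)] by (meson le_SucI order_trans)
  next
    case False
    then have "comp (insert e W) x \<subseteq> comp W x" using comp_insert_edge[of _ a b W x] e by blast
    moreover have W: "finite (comp W x)" "card (comp W x) \<le> Suc n" using insert by simp_all
    ultimately show ?thesis using card_mono[OF W(1)] finite_subset[OF _ W(1)] by (meson order_trans)
  qed
qed

lemma small_components: "finite (comp (small n) x)"
proof (rule ccontr)
  assume "infinite (comp (small n) x)"
  then obtain Y where Y: "finite Y" "card Y = Suc (Suc n)" "Y \<subseteq> comp (small n) x"
    using infinite_arbitrarily_large by metis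
  have "\<exists>W. W \<subseteq> small n \<and> finite W \<and> y \<in> comp W x" if "y \<in> Y" for y
    using finite_reach[OF subsetD[OF Y(3) that]] by blast
  then obtain W where W: "\<And>y. y \<in> Y \<Longrightarrow> W y \<subseteq> small n \<and> finite (W y) \<and> y \<in> comp (W y) x" by metis
  let ?W = "\<Union>y\<in>Y. W y"
  have "y \<in> comp ?W x" if "y \<in> Y" for y
    using W[OF that] comp_mono[of "W y" ?W x] that by blast
  then have "Y \<subseteq> comp ?W x" by blast
  moreover have "finite (comp ?W x) \<and> card (comp ?W x) \<le> Suc n"
    using W Y small_subset by (intro finite_small_components) blast+
  ultimately show False using Y card_mono[of "comp ?W x" Y] by simp
qed

text \<open>A \<open>small\<close> edge at a vertex of the cluster cannot be below the ray, because
  its own finite cluster would absorb the ray. It is therefore larger, belongs to \<open>Up\<close>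
  of the ray, and does not leave the cluster.\<close>

lemma ray_cluster_small_closed:
  assumes r: "ray a b" and y: "y \<in> comp (Up (Upair a b)) a" and z: "z \<in> comp (small n) y"
  shows "z \<in> comp (Up (Upair a b)) a"
proof -
  let ?e = "Upair a b"
  have "(y, z) \<in> (adj (small n))\<^sup>*" using z by (simp add: comp_def)
  then show ?thesis
  proof (induction rule: rtrancl_induct)
    case base show ?case by (rule y)
  next
    case (step u v)
    let ?d = "Upair u v"
    have d: "?d \<in> small n" using step(2) by (simp add: adj_def)
    note f = small_finite_ends[OF d]
    have "?d \<noteq> ?e"
    proof
      assume eq: "?d = ?e"
      have "b = u \<or> b = v" using eq by auto
      then show False using f(1,2) r unfolding eq ray_def by auto
    qed
    moreover have "\<not> gt ?e ?d" using ray_absorbs[OF _ r refl step(3) f(1)] by blast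
    ultimately have "gt ?d ?e" using gt_total[of ?d ?e] d small_subset r by (auto simp: ray_def exits_def)
    then have "?d \<in> Up ?e" using d small_subset by (auto simp: Up_def)
    then show ?case using comp_step[OF step(3)] by blast
  qed
qed

context
  fixes n :: nat
begin

definition cluster :: "'a \<Rightarrow> 'a set" where "cluster x = comp (small n) x"

text \<open>After contraction of the \<open>small\<close> components, the late rays are a partial
  function on clusters, since at most one of them leaves each cluster. It is made total by letting
  clusters without an outgoing late ray be fixed points.\<close>

definition parent :: "'a set \<Rightarrow> 'a set" where
  "parent C = (if \<exists>a b. a \<in> C \<and> late n a b then cluster (SOME b. \<exists>a\<in>C. late n a b) else C)"

lemma late_unique:
  assumes "a \<in> cluster y" "late n a b" "a' \<in> cluster y" "late n a' b'"
  shows "a = a'" "b = b'"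
proof -
  have r: "ray a b" "ray a' b'" using assms by (auto simp: late_def)
  have "a' \<in> comp (small n) a" using assms comp_eq[of a "small n" y] by (simp add: cluster_def)
  then have "a' \<in> comp (Up (Upair a b)) a" by (rule ray_cluster_small_closed[OF r(1) comp_refl])
  then show "a = a'" "b = b'" using ray_unique[OF r _ comp_refl] by blast+
qed

lemma parent_cluster:
  assumes "a \<in> cluster y" "late n a b"
  shows "parent (cluster y) = cluster b"
proof -
  have "\<exists>a'\<in>cluster y. late n a' (SOME b. \<exists>a\<in>cluster y. late n a b)"
    by (rule someI[where x=b]) (use assms in blast)
  then have "(SOME b. \<exists>a\<in>cluster y. late n a b) = b" using late_unique assms by blast
  then show ?thesis using assms unfolding parent_def by auto
qed

lemma parent_no_late: "\<not> (\<exists>a b. a \<in> C \<and> late n a b) \<Longrightarrow> parent C = C"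
  unfolding parent_def by (rule if_not_P)

lemma parent_is_cluster: "\<exists>z. (parent ^^ k) (cluster y) = cluster z"
proof (induction k)
  case (Suc k)
  then obtain z where z: "(parent ^^ k) (cluster y) = cluster z" by blast
  show ?case
  proof (cases "\<exists>a b. a \<in> cluster z \<and> late n a b")
    case True then show ?thesis using parent_cluster[of _ z] z by auto
  next
    case False then show ?thesis using parent_no_late z by auto
  qed
qed auto

text \<open>Every application of \<open>parent\<close> that still moves adds one predecessor, and a
  cluster that is fixed emits no late ray. As late rays do not have \<open>n\<close> predecessors,
  \<open>n\<close> applications always arrive at a fixed cluster.\<close>

lemma iterated_parent_chain:
  assumes "a \<in> (parent ^^ k) (cluster y)" "late n a b"
  shows "chain k a b"
  using assms
proof (induction k arbitrary: a b)
  case 0 then show ?case by (simp add: late_def)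
next
  case (Suc k)
  obtain z where z: "(parent ^^ k) (cluster y) = cluster z" using parent_is_cluster by blast
  have a: "a \<in> parent (cluster z)" using Suc.prems z by simp
  show ?case
  proof (cases "\<exists>a b. a \<in> cluster z \<and> late n a b")
    case True
    then obtain a' b' where ab: "a' \<in> cluster z" "late n a' b'" by blast
    have "chain k a' b'" using Suc.IH ab z by blast
    moreover have "a \<in> cluster b'" using a parent_cluster[OF ab] by simp
    then have "b' \<in> comp (small n) a" unfolding cluster_def by (rule comp_sym)
    then have "b' \<in> comp (Up (Upair a b)) a"
      using Suc.prems(2) by (intro ray_cluster_small_closed[OF _ comp_refl]) (auto simp: late_def)
    ultimately show ?thesis using Suc.prems(2) by (auto simp: late_def)
  next
    case False
    then show ?thesis using a parent_no_late Suc.prems(2) by auto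
  qed
qed

lemma parent_stable: "parent ((parent ^^ n) (cluster y)) = (parent ^^ n) (cluster y)"
  using iterated_parent_chain[of _ n y] by (intro parent_no_late) (auto simp: late_def)

lemma root_invariant:
  assumes "Upair y z \<in> small n \<union> {Upair a b | a b. late n a b}"
  shows "(parent ^^ n) (cluster y) = (parent ^^ n) (cluster z)"
proof -
  have late: "(parent ^^ n) (cluster a) = (parent ^^ n) (cluster b)" if "late n a b" for a b
  proof -
    have "parent (cluster a) = cluster b" using parent_cluster[OF _ that, of a] comp_refl[of a "small n"] by (simp add: cluster_def)
    then have "(parent ^^ n) (cluster b) = parent ((parent ^^ n) (cluster a))" by (simp add: funpow_swap1)
    then show ?thesis using parent_stable by simp
  qed
  from assms show ?thesis
  proof
    assume "Upair y z \<in> small n"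
    then have "cluster z = cluster y" unfolding cluster_def by (intro comp_eq Upair_in_comp)
    then show ?thesis by simp
  next
    assume "Upair y z \<in> {Upair a b | a b. late n a b}"
    then show ?thesis using late by auto
  qed
qed

text \<open>Clusters are finite and degrees are finite, so each cluster has finitely many preimages
  under \<open>parent\<close>.\<close>

lemma finite_descendants: "finite {y. (parent ^^ k) (cluster y) = cluster r}"
proof (induction k arbitrary: r)
  case 0
  have "y \<in> cluster r" if "cluster y = cluster r" for y
    using comp_refl[of y "small n"] that unfolding cluster_def by simp
  then have "{y. cluster y = cluster r} \<subseteq> cluster r" by blast
  moreover have "finite (cluster r)" using small_components by (simp add: cluster_def)
  ultimately show ?case by (simp add: finite_subset)
next
  case (Suc k)
  let ?N = "\<Union>b\<in>cluster r. {a. Upair b a \<in> E}"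
  have fin: "finite ?N" using small_components locally_finite by (auto simp: cluster_def)
  have "{y. (parent ^^ Suc k) (cluster y) = cluster r} \<subseteq> (\<Union>s\<in>insert r ?N. {y. (parent ^^ k) (cluster y) = cluster s})"
  proof
    fix y assume "y \<in> {y. (parent ^^ Suc k) (cluster y) = cluster r}"
    then have y: "parent ((parent ^^ k) (cluster y)) = cluster r" by simp
    obtain z where z: "(parent ^^ k) (cluster y) = cluster z" using parent_is_cluster by blast
    show "y \<in> (\<Union>s\<in>insert r ?N. {y. (parent ^^ k) (cluster y) = cluster s})"
    proof (cases "\<exists>a b. a \<in> cluster z \<and> late n a b")
      case True
      then obtain a b where ab: "a \<in> cluster z" "late n a b" by blast
      then have "cluster b = cluster r" using parent_cluster y z by simp
      then have "b \<in> cluster r" using comp_refl[of b "small n"] by (simp add: cluster_def)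
      moreover have "Upair b a \<in> E" using ab Upair_commute[of a b] by (auto simp: late_def ray_def exits_def simp del: Upair_inject)
      ultimately have "a \<in> ?N" by blast
      moreover have "cluster z = cluster a" using ab comp_eq[of a "small n" z] by (simp add: cluster_def)
      ultimately show ?thesis using z by auto
    next
      case False
      then show ?thesis using parent_no_late y z by auto
    qed
  qed
  moreover have "finite (\<Union>s\<in>insert r ?N. {y. (parent ^^ k) (cluster y) = cluster s})"
    using fin Suc.IH by blast
  ultimately show ?case by (rule finite_subset)
qed

text \<open>The cluster reached after \<open>n\<close> applications of \<open>parent\<close> is
  constant along every surviving edge. A component thus lies among the descendants of one
  root.\<close>

theorem finite_components_wmsf_cut: "finite (comp (wmsf - cut n) x)"
proof -
  let ?H = "small n \<union> {Upair a b | a b. late n a b}"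
  obtain r where r: "(parent ^^ n) (cluster x) = cluster r" using parent_is_cluster by blast
  have "(parent ^^ n) (cluster y) = cluster r" if "y \<in> comp ?H x" for y
  proof -
    have "(x, y) \<in> (adj ?H)\<^sup>*" using that by (simp add: comp_def)
    then show ?thesis
    proof (induction rule: rtrancl_induct)
      case base show ?case by (rule r)
    next
      case (step y z)
      then show ?case using root_invariant[of y z] by (simp add: adj_def)
    qed
  qed
  then have "comp ?H x \<subseteq> {y. (parent ^^ n) (cluster y) = cluster r}" by blast
  then have "finite (comp ?H x)" by (rule finite_subset) (rule finite_descendants)
  then show ?thesis by (rule finite_subset[OF comp_mono[OF wmsf_minus_cut]])
qed

end
end

section \<open>The Borel edge order induced by a weight, and measurability of the forest\<close>

locale weighted_graphing = graphing_space +
  fixes w :: "'a uprod \<Rightarrow> real"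
  assumes w_measurable: "w \<in> borel_measurable (eta M E)"
begin

lemma Upair_measurable: "(\<lambda>p. Upair (fst p) (snd p)) \<in> measurable (borel \<Otimes>\<^sub>M borel) (eta M E)"
proof (rule measurableI)
  fix A assume "A \<in> sets (eta M E)"
  then have "(\<lambda>p :: 'a \<times> 'a. Upair (fst p) (snd p)) -` A \<in> sets borel" by (simp add: sets_eta uprod_sets_def)
  then show "(\<lambda>p :: 'a \<times> 'a. Upair (fst p) (snd p)) -` A \<inter> space (borel \<Otimes>\<^sub>M borel) \<in> sets (borel \<Otimes>\<^sub>M borel)"
    unfolding borel_prod by simp
qed simp

definition dseq :: "nat \<Rightarrow> 'a" where
  "dseq = (SOME d. \<forall>e>0. (\<Union>i. cball (d i) e) = UNIV)"

lemma dseq_dense: "e > 0 \<Longrightarrow> \<exists>i. dist (dseq i) x \<le> e"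
proof -
  assume "e > 0"
  obtain d :: "nat \<Rightarrow> 'a" where "\<And>e. e > 0 \<Longrightarrow> (\<Union>i. cball (d i) e) = UNIV"
    using countable_cball_cover by blast
  then have "\<exists>d :: nat \<Rightarrow> 'a. \<forall>e>0. (\<Union>i. cball (d i) e) = UNIV" by blast
  then have "\<forall>e>0. (\<Union>i. cball (dseq i) e) = UNIV" unfolding dseq_def by (rule someI_ex)
  then have "x \<in> (\<Union>i. cball (dseq i) e)" using \<open>e > 0\<close> by blast
  then show ?thesis by auto
qed

text \<open>The weight comes first; the distances to a dense sequence separate edges and break ties.\<close>
definition u :: "nat \<Rightarrow> 'a uprod \<Rightarrow> real" where
  "u i e = (case i of 0 \<Rightarrow> w e | Suc j \<Rightarrow> Min (dist (dseq j) ` set_uprod e))"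

lemma u_0: "u 0 e = w e" by (simp add: u_def)
lemma u_Suc: "u (Suc j) (Upair x y) = min (dist (dseq j) x) (dist (dseq j) y)" by (simp add: u_def)

lemma u_measurable[measurable (raw)]:
  assumes [measurable]: "x \<in> borel_measurable N" "y \<in> borel_measurable N"
  shows "(\<lambda>p. u i (Upair (x p) (y p))) \<in> borel_measurable N"
proof (cases i)
  case 0
  have "w \<circ> (\<lambda>p. Upair (fst p) (snd p)) \<in> borel_measurable (borel \<Otimes>\<^sub>M borel)"
    by (rule measurable_comp[OF Upair_measurable w_measurable])
  then have [measurable]: "(\<lambda>p. w (Upair (fst p) (snd p))) \<in> borel_measurable (borel \<Otimes>\<^sub>M borel)" by (simp add: o_def)
  have "(\<lambda>p. (\<lambda>p. w (Upair (fst p) (snd p))) (x p, y p)) \<in> borel_measurable N" by measurable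
  then show ?thesis using 0 by (simp add: u_0)
next
  case (Suc j) then show ?thesis by (simp add: u_Suc)
qed

lemma u_separates_point:
  assumes "z \<in> set_uprod e" "z \<notin> set_uprod d"
  shows "\<exists>i. u i d \<noteq> u i e"
proof -
  obtain a b where d: "d = Upair a b" by (cases d)
  obtain c where e: "e = Upair z c" using assms(1) by (cases e) auto
  let ?r = "min (dist z a) (dist z b)"
  have r: "?r > 0" using assms d by auto
  \<comment> \<open>With a dense point this close to \<open>z\<close>, its distance to
    \<open>z\<close> is at most r/3, while the distances to \<open>a\<close> and \<open>b\<close>
    are at least 2r/3.\<close>
  then obtain j where j: "dist (dseq j) z \<le> ?r / 3" using dseq_dense[of "?r / 3" z] by auto
  have "dist z a \<le> dist (dseq j) z + dist (dseq j) a" "dist z b \<le> dist (dseq j) z + dist (dseq j) b"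
    using dist_triangle3 by blast+
  then have "u (Suc j) e < u (Suc j) d" using j r unfolding d e u_Suc by linarith
  then have "u (Suc j) d \<noteq> u (Suc j) e" by simp
  then show ?thesis ..
qed

lemma u_separates: "d \<noteq> e \<Longrightarrow> \<exists>i. u i d \<noteq> u i e"
proof -
  assume "d \<noteq> e"
  then have "set_uprod d \<noteq> set_uprod e" by (cases d; cases e) (auto simp: doubleton_eq_iff)
  then obtain z where "(z \<in> set_uprod e \<and> z \<notin> set_uprod d) \<or> (z \<in> set_uprod d \<and> z \<notin> set_uprod e)" by blast
  then show ?thesis using u_separates_point[of z d e] u_separates_point[of z e d] by metis
qed

text \<open>The lexicographic order of the real sequences \<open>u\<close>. It is a countable
  combination of Borel comparisons.\<close>

definition gt :: "'a uprod \<Rightarrow> 'a uprod \<Rightarrow> bool" where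
  "gt d e \<longleftrightarrow> (\<exists>i. u i d > u i e \<and> (\<forall>j\<in>{..<i}. u j d = u j e))"

lemma gt_le:
  assumes "gt d e" "\<And>j. j < i \<Longrightarrow> u j d = u j e"
  shows "u i e \<le> u i d"
proof -
  obtain k where k: "u k d > u k e" "\<And>j. j < k \<Longrightarrow> u j d = u j e" using assms(1) by (auto simp: gt_def)
  have "\<not> k < i" using assms(2)[of k] k(1) by auto
  then show ?thesis using k(2)[of i] k(1) by (cases "k = i") auto
qed

sublocale ordered_edges E gt
proof
  fix a b c :: "'a uprod"
  show "gt a c" if ab: "gt a b" and bc: "gt b c"
  proof -
    obtain i where i: "u i a > u i b" "\<And>j. j < i \<Longrightarrow> u j a = u j b" using ab by (auto simp: gt_def)
    obtain k where k: "u k b > u k c" "\<And>j. j < k \<Longrightarrow> u j b = u j c" using bc by (auto simp: gt_def)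
    show ?thesis unfolding gt_def
    proof (intro exI[of _ "min i k"] conjI ballI)
      show "u (min i k) a > u (min i k) c"
        using i k i(2)[of k] k(2)[of i] by (cases i k rule: linorder_cases) (auto simp: min_def)
      fix j assume "j \<in> {..<min i k}"
      then show "u j a = u j c" using i(2)[of j] k(2)[of j] by simp
    qed
  qed
  show "\<not> gt a a" by (simp add: gt_def)
  show "gt a b \<or> gt b a" if ne: "a \<noteq> b"
  proof -
    obtain i where i: "u i a \<noteq> u i b" and "\<forall>j<i. \<not> u j a \<noteq> u j b"
      using u_separates[OF ne] exists_least_iff[of "\<lambda>i. u i a \<noteq> u i b"] by blast
    then have lt: "u j a = u j b" if "j < i" for j using that by blast
    show ?thesis
    proof (cases "u i a > u i b")
      case True
      then have "gt a b" unfolding gt_def using lt by (intro exI[of _ i]) simp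
      then show ?thesis ..
    next
      case False
      then have "u i b > u i a" using i by linarith
      then have "gt b a" unfolding gt_def using lt by (intro exI[of _ i]) simp
      then show ?thesis ..
    qed
  qed
qed (rule finite_nbrs, rule Upair_E_neq)

lemma gt_measurable[measurable (raw)]:
  assumes [measurable]: "a \<in> borel_measurable N" "b \<in> borel_measurable N" "c \<in> borel_measurable N" "d \<in> borel_measurable N"
  shows "Measurable.pred N (\<lambda>p. gt (Upair (a p) (b p)) (Upair (c p) (d p)))"
  unfolding gt_def by measurable

lemma Up_comp_measurable[measurable (raw)]:
  assumes [measurable]: "a \<in> borel_measurable N" "b \<in> borel_measurable N" "x \<in> borel_measurable N" "y \<in> borel_measurable N"
  shows "Measurable.pred N (\<lambda>p. y p \<in> comp (Up (Upair (a p) (b p))) (x p))"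
proof (rule pred_comp)
  note [measurable] = E_uprod_sets
  have "Measurable.pred (N \<Otimes>\<^sub>M borel \<Otimes>\<^sub>M borel) (\<lambda>q. Upair (fst (snd q)) (snd (snd q)) \<in> E \<and>
    gt (Upair (fst (snd q)) (snd (snd q))) (Upair (a (fst q)) (b (fst q))))" by measurable
  then show "Measurable.pred (N \<Otimes>\<^sub>M borel \<Otimes>\<^sub>M borel) (\<lambda>(p, v, z). Upair v z \<in> Up (Upair (a p) (b p)))"
    by (simp add: split_beta' Up_def)
qed (rule Up_subset, measurable)

lemma finite_Up_comp_measurable[measurable (raw)]:
  assumes [measurable]: "a \<in> borel_measurable N" "b \<in> borel_measurable N" "x \<in> borel_measurable N"
  shows "Measurable.pred N (\<lambda>p. finite (comp (Up (Upair (a p) (b p))) (x p)))"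
proof (rule pred_finite)
  have "Measurable.pred (N \<Otimes>\<^sub>M borel) (\<lambda>q. snd q \<in> comp (Up (Upair (a (fst q)) (b (fst q)))) (x (fst q)))" by measurable
  then show "Measurable.pred (N \<Otimes>\<^sub>M borel) (\<lambda>(p, y). y \<in> comp (Up (Upair (a p) (b p))) (x p))" by (simp add: split_beta')
qed (rule comp_mono[OF Up_subset], measurable)

lemma exits_measurable[measurable (raw)]:
  assumes [measurable]: "a \<in> borel_measurable N" "b \<in> borel_measurable N"
  shows "Measurable.pred N (\<lambda>p. exits (a p) (b p))"
proof -
  note [measurable] = E_uprod_sets
  show ?thesis unfolding exits_def by measurable
qed

lemma exits_in_comp: "exits a b \<Longrightarrow> b \<in> comp E a"
  unfolding exits_def by (blast intro: Upair_in_comp)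

lemma comp_E_g: "y \<in> comp E x \<Longrightarrow> \<exists>n. y = g n x"
  unfolding comp_g by blast

lemma ray_measurable[measurable (raw)]:
  assumes [measurable]: "a \<in> borel_measurable N" "b \<in> borel_measurable N"
  shows "Measurable.pred N (\<lambda>p. ray (a p) (b p))"
  unfolding ray_def by measurable

lemma chain_pair_measurable: "Measurable.pred (borel \<Otimes>\<^sub>M borel) (\<lambda>p. chain n (fst p) (snd p))"
proof (induction n)
  case 0 show ?case by simp measurable
next
  case (Suc n)
  note [measurable] = Suc.IH
  have eq: "chain (Suc n) a b \<longleftrightarrow> ray a b \<and> (\<exists>m k. (\<lambda>p. chain n (fst p) (snd p)) (g k (g m a), g m a)
      \<and> g m a \<in> comp (Up (Upair a b)) a)" for a b
  proof
    assume "chain (Suc n) a b"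
    then obtain a' b' where ab: "ray a b" "chain n a' b'" "b' \<in> comp (Up (Upair a b)) a" by auto
    have "b' \<in> comp E a" using ab(3) comp_mono[OF Up_subset] by blast
    then obtain m where m: "b' = g m a" using comp_E_g by blast
    have "a' \<in> comp E b'" using chain_ray[OF ab(2)] exits_in_comp[of a' b'] comp_sym[of b' E a'] by (simp add: ray_def)
    then obtain k where "a' = g k b'" using comp_E_g by blast
    then show "ray a b \<and> (\<exists>m k. (\<lambda>p. chain n (fst p) (snd p)) (g k (g m a), g m a) \<and> g m a \<in> comp (Up (Upair a b)) a)"
      using ab m by auto
  qed auto
  show ?case unfolding eq by measurable
qed

lemma chain_measurable[measurable (raw)]:
  assumes [measurable]: "a \<in> borel_measurable N" "b \<in> borel_measurable N"
  shows "Measurable.pred N (\<lambda>p. chain n (a p) (b p))"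
proof -
  note [measurable] = chain_pair_measurable
  have "Measurable.pred N (\<lambda>p. (\<lambda>p. chain n (fst p) (snd p)) (a p, b p))" by measurable
  then show ?thesis by simp
qed

lemma symmetric_edges_uprod_sets:
  fixes Q :: "'a \<Rightarrow> 'a \<Rightarrow> bool"
  assumes "Measurable.pred (borel \<Otimes>\<^sub>M borel) (\<lambda>p. Q (fst p) (snd p))"
  shows "{Upair a b | a b. Q a b} \<in> uprod_sets"
proof (rule uprod_setsI)
  note [measurable] = assms
  let ?Q = "\<lambda>p. Q (fst p) (snd p)"
  have "Upair a b \<in> {Upair a b | a b. Q a b} \<longleftrightarrow> ?Q (a, b) \<or> ?Q (b, a)" for a b by auto
  moreover have "Measurable.pred (borel \<Otimes>\<^sub>M borel) (\<lambda>(a, b). ?Q (a, b) \<or> ?Q (b, a))" by measurable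
  ultimately show "Measurable.pred (borel \<Otimes>\<^sub>M borel) (\<lambda>(a, b). Upair a b \<in> {Upair a b | a b. Q a b})" by simp
qed

lemma wmsf_uprod_sets: "wmsf \<in> uprod_sets"
  unfolding wmsf_def by (rule symmetric_edges_uprod_sets) measurable

text \<open>The condition \<open>exits a b\<close> is built into the set so that it stays inside
  \<open>comp E a\<close> for all pairs, including unrelated ones; measurability of
  \<open>card\<close> is only available for subsets of a component.\<close>

definition merged :: "'a \<Rightarrow> 'a \<Rightarrow> 'a set" where
  "merged a b = {y. exits a b \<and> (y \<in> comp (Up (Upair a b)) a \<or> y \<in> comp (Up (Upair a b)) b)}"

lemma merged_subset: "merged a b \<subseteq> comp E a"
proof
  fix y assume y: "y \<in> merged a b"
  then have "b \<in> comp E a" using exits_in_comp by (simp add: merged_def)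
  moreover have "y \<in> comp E a \<or> y \<in> comp E b" using y comp_mono[OF Up_subset] unfolding merged_def by blast
  ultimately show "y \<in> comp E a" using comp_trans[of b E a y] by blast
qed

lemma cut_uprod_sets: "cut n \<in> uprod_sets"
proof -
  have [measurable]: "(\<lambda>p. real (card (merged (fst p) (snd p)))) \<in> borel_measurable (borel \<Otimes>\<^sub>M borel)"
  proof (rule measurable_card[OF merged_subset])
    have "Measurable.pred ((borel \<Otimes>\<^sub>M borel) \<Otimes>\<^sub>M borel) (\<lambda>q. exits (fst (fst q)) (snd (fst q)) \<and>
       (snd q \<in> comp (Up (Upair (fst (fst q)) (snd (fst q)))) (fst (fst q)) \<or> snd q \<in> comp (Up (Upair (fst (fst q)) (snd (fst q)))) (snd (fst q))))"
      by measurable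
    then show "Measurable.pred ((borel \<Otimes>\<^sub>M borel) \<Otimes>\<^sub>M borel) (\<lambda>(p, y). y \<in> merged (fst p) (snd p))"
      by (simp add: merged_def split_beta')
  qed measurable
  have "{Upair a b | a b. exits a b \<and> finite (comp (Up (Upair a b)) b) \<and> n < card (comp (Up (Upair a b)) a \<union> comp (Up (Upair a b)) b)}
    = {Upair a b | a b. exits a b \<and> finite (comp (Up (Upair a b)) b) \<and> real n < real (card (merged a b))}"
  proof -
    have "merged a b = comp (Up (Upair a b)) a \<union> comp (Up (Upair a b)) b" if "exits a b" for a b
      using that by (auto simp: merged_def)
    then show ?thesis unfolding of_nat_less_iff by (metis (no_types, lifting))
  qed
  also have "\<dots> \<in> uprod_sets" by (rule symmetric_edges_uprod_sets) measurable
  finally show ?thesis unfolding cut_def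
    by (rule uprod_sets_Un) (rule symmetric_edges_uprod_sets, measurable)
qed

lemma cut_antimono: "cut (Suc n) \<subseteq> cut n"
proof
  fix e assume "e \<in> cut (Suc n)"
  then show "e \<in> cut n"
    unfolding cut_def using chain_decreasing[of n] Suc_lessD[of n] by (elim UnE) blast+
qed

lemma cut_subset: "cut n \<subseteq> wmsf"
  using chain_ray[of n] unfolding cut_def wmsf_def ray_def by blast

section \<open>Endless chains are negligible\<close>

definition endless :: "'a \<Rightarrow> 'a \<Rightarrow> bool" where "endless a b \<longleftrightarrow> (\<forall>n. chain n a b)"

lemma endless_ray: "endless a b \<Longrightarrow> ray a b" unfolding endless_def using chain_ray by blast

text \<open>Once \<open>n\<close> reaches the size of the merged cluster, only the chain clause can
  place the edge in \<open>cut n\<close>. The orientation cannot alternate with \<open>n\<close>,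
  because an edge is a ray in at most one direction.\<close>

lemma in_all_cuts:
  assumes "\<And>n. Upair a b \<in> cut n"
  shows "endless a b \<or> endless b a"
proof -
  let ?e = "Upair a b"
  define N where "N = card (comp (Up ?e) a \<union> comp (Up ?e) b)"
  have ch: "chain n a b \<or> chain n b a" if n: "N \<le> n" for n
  proof -
    obtain c d where cd: "?e = Upair c d"
      and c: "n < card (comp (Up (Upair c d)) c \<union> comp (Up (Upair c d)) d) \<or> chain n c d"
      using assms[of n] unfolding cut_def by blast
    note cd = cd c[folded cd]
    have "(c = a \<and> d = b) \<or> (c = b \<and> d = a)" using cd(1) by auto
    then show ?thesis using cd(2) n unfolding N_def by (auto simp: Un_commute)
  qed
  have all: "endless c d" if "\<And>n. N \<le> n \<Longrightarrow> chain n c d" for c d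
    unfolding endless_def using chain_antimono[of _ "max _ N" c d] that by (metis max.cobounded1 max.cobounded2)
  show ?thesis
  proof (cases "\<forall>n\<ge>N. chain n a b")
    case True then show ?thesis using all by blast
  next
    case False
    then obtain k where "k \<ge> N" "\<not> chain k a b" by blast
    then have r: "ray b a" using ch chain_ray by blast
    have "\<not> ray a b"
    proof
      assume ra: "ray a b"
      have "a = b" using ray_orientation[OF ra r Upair_commute] by (rule conjunct1)
      then show False using ra loopless[of a b] unfolding ray_def exits_def by blast
    qed
    then have "\<And>n. N \<le> n \<Longrightarrow> chain n b a" using ch chain_ray by blast
    then show ?thesis using all by blast
  qed
qed

lemma endless_measurable[measurable (raw)]:
  assumes [measurable]: "a \<in> borel_measurable N" "b \<in> borel_measurable N"
  shows "Measurable.pred N (\<lambda>p. endless (a p) (b p))"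
  unfolding endless_def by measurable

lemma endless_unique: "endless a b \<Longrightarrow> endless a c \<Longrightarrow> b = c"
  using ray_unique[OF endless_ray endless_ray comp_refl comp_refl] by blast

text \<open>An endless ray is determined by its tail, so the successor relation on rays can be
  written as a relation between vertices, the form that mass transport needs.\<close>

definition nxt :: "'a \<Rightarrow> 'a \<Rightarrow> bool" where
  "nxt x y \<longleftrightarrow> (\<exists>b c. endless x b \<and> endless y c \<and> b \<in> comp (Up (Upair y c)) y)"

lemma endless_in_comp: "endless a b \<Longrightarrow> b \<in> comp E a"
  using endless_ray[of a b] exits_in_comp[of a b] by (simp add: ray_def)

lemma nxt_unique: "nxt x y \<Longrightarrow> nxt x z \<Longrightarrow> y = z"
proof -
  assume "nxt x y" "nxt x z"
  then obtain b c b' c' where 1: "endless x b" "endless y c" "b \<in> comp (Up (Upair y c)) y"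
    and 2: "endless x b'" "endless z c'" "b' \<in> comp (Up (Upair z c')) z" unfolding nxt_def by blast
  have "b' = b" using endless_unique 1(1) 2(1) by blast
  then show ?thesis using ray_unique[OF endless_ray[OF 1(2)] endless_ray[OF 2(2)] 1(3)] 2(3) by blast
qed

lemma nxt_comp: "nxt x y \<Longrightarrow> y \<in> comp E x"
proof -
  assume "nxt x y"
  then obtain b c where 1: "endless x b" "endless y c" "b \<in> comp (Up (Upair y c)) y" unfolding nxt_def by blast
  have "b \<in> comp E y" using 1(3) comp_mono[OF Up_subset] by blast
  then show ?thesis using comp_trans[OF endless_in_comp[OF 1(1)] comp_sym[of b E y]] by blast
qed

lemma nxt_ex: "endless y c \<Longrightarrow> \<exists>x. nxt x y"
  using infinite_chain_predecessor[of y c] unfolding nxt_def endless_def by blast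

lemma nxt_measurable[measurable (raw)]:
  assumes [measurable]: "x \<in> borel_measurable N" "y \<in> borel_measurable N"
  shows "Measurable.pred N (\<lambda>p. nxt (x p) (y p))"
proof -
  have "nxt x y \<longleftrightarrow> (\<exists>m k. endless x (g m x) \<and> endless y (g k y) \<and> g m x \<in> comp (Up (Upair y (g k y))) y)" for x y
    unfolding nxt_def using endless_in_comp comp_E_g by metis
  then show ?thesis by simp
qed

definition pre :: "'a set \<Rightarrow> 'a set" where "pre Q = {x. \<exists>y. nxt x y \<and> y \<in> Q}"

lemma pre_measurable[measurable]:
  assumes [measurable]: "Q \<in> sets borel"
  shows "pre Q \<in> sets borel"
proof -
  have "pre Q = {x \<in> space borel. \<exists>m. nxt x (g m x) \<and> g m x \<in> Q}"
    unfolding pre_def using nxt_comp comp_E_g by fastforce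
  also have "\<dots> \<in> sets borel" by measurable
  finally show ?thesis .
qed

text \<open>Every vertex sends unit mass to its successor if that lies in \<open>Q\<close>, so it
  sends at most 1. Every vertex of \<open>Q\<close> receives at least 1, because an endless ray has
  an endless predecessor.\<close>

lemma emeasure_le_pre:
  assumes [measurable]: "Q \<in> sets borel" and Q: "\<And>y. y \<in> Q \<Longrightarrow> \<exists>c. endless y c"
  shows "emeasure M Q \<le> emeasure M (pre Q)"
proof -
  define h :: "'a \<Rightarrow> 'a \<Rightarrow> ennreal" where "h x y = indicator {y. nxt x y \<and> y \<in> Q} y" for x y
  have h': "h y x = indicator {y. nxt y x \<and> x \<in> Q} y" for x y by (simp add: h_def indicator_def)
  have "(\<lambda>p. if nxt (fst p) (snd p) \<and> snd p \<in> Q then 1 else 0 :: ennreal) \<in> borel_measurable (borel \<Otimes>\<^sub>M borel)" by measurable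
  moreover have "(\<lambda>(x, y). h x y) = (\<lambda>p. if nxt (fst p) (snd p) \<and> snd p \<in> Q then 1 else 0)"
    by (auto simp: h_def fun_eq_iff)
  ultimately have meas: "(\<lambda>(x, y). h x y) \<in> borel_measurable (borel \<Otimes>\<^sub>M borel)" by simp
  have out: "(\<integral>\<^sup>+y. h x y \<partial>count_space (comp E x)) \<le> indicator (pre Q) x" for x
  proof -
    let ?A = "{y. nxt x y \<and> y \<in> Q}"
    have "?A \<subseteq> comp E x" using nxt_comp by blast
    then have eq: "(\<integral>\<^sup>+y. h x y \<partial>count_space (comp E x)) = ecard ?A" unfolding h_def by (rule ecard_comp_sum[symmetric])
    show ?thesis
    proof (cases "x \<in> pre Q")
      case True
      then obtain y where "nxt x y" "y \<in> Q" by (auto simp: pre_def)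
      then have "?A = {y}" using nxt_unique by blast
      then show ?thesis using True by (simp add: eq ecard_finite)
    next
      case False
      then have "?A = {}" by (auto simp: pre_def)
      then show ?thesis by (simp only: eq) (simp add: ecard_finite)
    qed
  qed
  have inn: "indicator Q x \<le> (\<integral>\<^sup>+y. h y x \<partial>count_space (comp E x))" for x
  proof (cases "x \<in> Q")
    case True
    let ?A = "{y. nxt y x \<and> x \<in> Q}"
    have "?A \<subseteq> comp E x" using nxt_comp comp_sym[of x E] by blast
    then have eq: "(\<integral>\<^sup>+y. h y x \<partial>count_space (comp E x)) = ecard ?A" unfolding h' by (rule ecard_comp_sum[symmetric])
    obtain y where "nxt y x" using Q[OF True] nxt_ex by blast
    then have "{y} \<subseteq> ?A" using True by blast
    then have "ecard {y} \<le> ecard ?A" unfolding ecard_def by (intro emeasure_mono) auto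
    then show ?thesis using True by (simp add: eq ecard_finite)
  qed simp
  have "emeasure M Q = (\<integral>\<^sup>+x. indicator Q x \<partial>M)" by simp
  also have "\<dots> \<le> (\<integral>\<^sup>+x. (\<integral>\<^sup>+y. h y x \<partial>count_space (comp E x)) \<partial>M)" by (intro nn_integral_mono inn)
  also have "\<dots> = (\<integral>\<^sup>+x. (\<integral>\<^sup>+y. h x y \<partial>count_space (comp E x)) \<partial>M)" by (rule mass_transport[OF meas, symmetric])
  also have "\<dots> \<le> (\<integral>\<^sup>+x. indicator (pre Q) x \<partial>M)" by (intro nn_integral_mono out)
  also have "\<dots> = emeasure M (pre Q)" by simp
  finally show ?thesis .
qed

text \<open>Since the measure is finite and \<open>pre Q\<close> is at least as large as
  \<open>Q\<close>, the inclusion of \<open>pre Q\<close> in \<open>Q\<close> must be an equality up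
  to a null set.\<close>

lemma AE_pre:
  assumes [measurable]: "Q \<in> sets borel" and Q: "\<And>y. y \<in> Q \<Longrightarrow> \<exists>c. endless y c"
    and pre_sub: "AE x in M. x \<in> pre Q \<longrightarrow> x \<in> Q"
  shows "AE x in M. x \<in> Q \<longrightarrow> x \<in> pre Q"
proof -
  have "measure M Q \<le> measure M (pre Q)" using emeasure_le_pre[OF assms(1) Q] by (simp add: emeasure_eq_measure)
  also have "\<dots> = measure M (Q \<inter> pre Q)"
    by (rule finite_measure_eq_AE) (use pre_sub in auto)
  finally have "measure M (Q - pre Q) = 0"
    using finite_measure_Diff'[of Q "pre Q"] measure_nonneg[of M "Q - pre Q"] by simp
  then have "Q - pre Q \<in> null_sets M" by (intro null_setsI) (simp_all add: emeasure_eq_measure)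
  then have "AE x in M. x \<notin> Q - pre Q" by (rule AE_not_in)
  then show ?thesis by eventually_elim blast
qed

lemma endless_g: "(\<exists>m. endless x (g m x) \<and> P (g m x)) \<longleftrightarrow> (\<exists>b. endless x b \<and> P b)"
proof
  assume "\<exists>b. endless x b \<and> P b"
  then obtain b where b: "endless x b" "P b" by blast
  obtain m where "b = g m x" using comp_E_g[OF endless_in_comp[OF b(1)]] by blast
  then show "\<exists>m. endless x (g m x) \<and> P (g m x)" using b by blast
qed blast

text \<open>Induction over coordinates. Where the coordinates below \<open>i\<close> agree, the
  lexicographic increase along the chain means that coordinate \<open>i\<close> does not drop at the
  successor. Its sublevel sets are then closed under predecessors, and \<open>AE_pre\<close> makes
  them closed under successors as well, so coordinate \<open>i\<close> does not rise either.\<close>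

lemma AE_nxt_weights:
  "AE x in M. \<forall>b. endless x b \<longrightarrow> (\<exists>y c. nxt x y \<and> endless y c \<and> (\<forall>j<i. u j (Upair x b) = u j (Upair y c)))"
proof (induction i)
  case 0
  \<comment> \<open>Endless chains extend backwards by \<open>infinite_chain_predecessor\<close>.
    That they almost surely extend forwards as well is \<open>AE_pre\<close> for the set of all
    tails.\<close>
  let ?V = "{x. \<exists>m. endless x (g m x)}"
  have V: "x \<in> ?V \<longleftrightarrow> (\<exists>b. endless x b)" for x using endless_g[of x "\<lambda>_. True"] by simp
  have "{x\<in>space borel. \<exists>m. endless x (g m x)} \<in> sets borel" by measurable
  then have "?V \<in> sets borel" by simp
  moreover have "AE x in M. x \<in> pre ?V \<longrightarrow> x \<in> ?V" unfolding pre_def nxt_def using V by (intro AE_I2) blast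
  ultimately have "AE x in M. x \<in> ?V \<longrightarrow> x \<in> pre ?V" using V by (intro AE_pre) blast+
  then show ?case
  proof eventually_elim
    case (elim x)
    then show ?case unfolding V pre_def by auto
  qed
next
  case (Suc i)
  \<comment> \<open>Rational levels keep the number of exceptional null sets countable and still
    separate any two distinct values.\<close>
  define Q where "Q q = {x. \<exists>m. endless x (g m x) \<and> u i (Upair x (g m x)) \<le> real_of_rat q}" for q
  have Q: "x \<in> Q q \<longleftrightarrow> (\<exists>b. endless x b \<and> u i (Upair x b) \<le> real_of_rat q)" for x q
    unfolding Q_def using endless_g[of x "\<lambda>b. u i (Upair x b) \<le> real_of_rat q"] by simp
  have "AE x in M. x \<in> Q q \<longrightarrow> x \<in> pre (Q q)" for q
  proof (rule AE_pre)
    have "{x\<in>space borel. \<exists>m. endless x (g m x) \<and> u i (Upair x (g m x)) \<le> real_of_rat q} \<in> sets borel" by measurable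
    then show "Q q \<in> sets borel" by (simp add: Q_def)
    show "\<exists>c. endless y c" if "y \<in> Q q" for y using that Q by blast
    show "AE x in M. x \<in> pre (Q q) \<longrightarrow> x \<in> Q q"
      using Suc.IH
    proof eventually_elim
      case (elim x)
      show ?case
      proof
        assume "x \<in> pre (Q q)"
        then obtain y c where y: "nxt x y" "endless y c" "u i (Upair y c) \<le> real_of_rat q" unfolding pre_def Q by blast
        then obtain b c' where b: "endless x b" "endless y c'" "b \<in> comp (Up (Upair y c')) y" unfolding nxt_def by blast
        have "c' = c" using endless_unique y(2) b(2) by blast
        then have gt: "gt (Upair y c) (Upair x b)"
          using ray_increasing[OF endless_ray[OF b(1)] endless_ray[OF y(2)]] b(3) by blast
        obtain z d where z: "nxt x z" "endless z d" "\<forall>j<i. u j (Upair x b) = u j (Upair z d)" using elim b(1) by blast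
        have "z = y" using nxt_unique z(1) y(1) by blast
        moreover from this have "d = c" using endless_unique z(2) y(2) by blast
        ultimately have "u i (Upair x b) \<le> u i (Upair y c)" using z(3) by (intro gt_le[OF gt]) simp
        then show "x \<in> Q q" using Q b(1) y(3) by (metis order_trans)
      qed
    qed
  qed
  then have "AE x in M. \<forall>q. x \<in> Q q \<longrightarrow> x \<in> pre (Q q)" by (simp add: AE_all_countable)
  with Suc.IH show ?case
  proof eventually_elim
    case (elim x)
    show ?case
    proof (intro allI impI)
      fix b assume b: "endless x b"
      obtain y c where y: "nxt x y" "endless y c" "\<forall>j<i. u j (Upair x b) = u j (Upair y c)" using elim(1) b by blast
      obtain b' c' where b': "endless x b'" "endless y c'" "b' \<in> comp (Up (Upair y c')) y" using y(1) unfolding nxt_def by blast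
      have "c' = c" "b' = b" using endless_unique y(2) b b' by blast+
      then have gt: "gt (Upair y c) (Upair x b)"
        using ray_increasing[OF endless_ray[OF b] endless_ray[OF y(2)]] b'(3) by blast
      have le: "u i (Upair x b) \<le> u i (Upair y c)" using y(3) by (intro gt_le[OF gt]) simp
      have "u i (Upair y c) \<le> u i (Upair x b)"
      proof (rule ccontr)
        assume "\<not> ?thesis"
        then obtain q where q: "u i (Upair x b) < real_of_rat q" "real_of_rat q < u i (Upair y c)"
          using of_rat_dense[of "u i (Upair x b)" "u i (Upair y c)"] by auto
        then have "x \<in> Q q" using Q b less_imp_le by blast
        then have "x \<in> pre (Q q)" using elim(2) by blast
        then obtain z d where z: "nxt x z" "endless z d" "u i (Upair z d) \<le> real_of_rat q" unfolding pre_def Q by blast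
        have "z = y" using nxt_unique z(1) y(1) by blast
        moreover from this have "d = c" using endless_unique z(2) y(2) by blast
        ultimately show False using z(3) q(2) by simp
      qed
      then have "u i (Upair x b) = u i (Upair y c)" using le by simp
      then have "\<forall>j<Suc i. u j (Upair x b) = u j (Upair y c)" using y(3) by (auto simp: less_Suc_eq)
      then show "\<exists>y c. nxt x y \<and> endless y c \<and> (\<forall>j<Suc i. u j (Upair x b) = u j (Upair y c))" using y by blast
    qed
  qed
qed

text \<open>Along an endless chain the edges strictly increase, while mass transport forbids a drift of any coordinate.\<close>
lemma AE_not_endless: "AE x in M. \<forall>b. \<not> endless x b"
proof -
  have "AE x in M. \<forall>i b. endless x b \<longrightarrow> (\<exists>y c. nxt x y \<and> endless y c \<and> (\<forall>j<i. u j (Upair x b) = u j (Upair y c)))"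
    using AE_nxt_weights by (simp add: AE_all_countable)
  then show ?thesis
  proof eventually_elim
    case (elim x)
    show ?case
    proof (intro allI notI)
      fix b assume b: "endless x b"
      obtain y c where y: "nxt x y" "endless y c" using elim b by blast
      obtain b' c' where b': "endless x b'" "endless y c'" "b' \<in> comp (Up (Upair y c')) y" using y(1) unfolding nxt_def by blast
      have "c' = c" "b' = b" using endless_unique y(2) b b' by blast+
      then have "gt (Upair y c) (Upair x b)"
        using ray_increasing[OF endless_ray[OF b] endless_ray[OF y(2)]] b'(3) by blast
      then obtain k where k: "u k (Upair y c) > u k (Upair x b)" by (auto simp: gt_def)
      obtain z d where z: "nxt x z" "endless z d" "\<forall>j<Suc k. u j (Upair x b) = u j (Upair z d)" using elim b by blast
      have "z = y" using nxt_unique z(1) y(1) by blast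
      moreover from this have "d = c" using endless_unique z(2) y(2) by blast
      ultimately show False using z(3) k by auto
    qed
  qed
qed

lemma eta_INT_cut: "emeasure (eta M E) (\<Inter>n. cut n) = 0"
proof -
  have "(\<Inter>n. cut n) \<in> sets (eta M E)" using cut_uprod_sets by (intro sets.countable_INT) (auto simp: sets_eta)
  then have S: "(\<Inter>n. cut n) \<in> uprod_sets" by (simp add: sets_eta)
  \<comment> \<open>The edge may be endless from either end, so the null set has to be excluded on
    the whole component of \<open>x\<close>.\<close>
  have "AE x in M. \<forall>y\<in>comp E x. \<forall>b. \<not> endless y b" by (rule AE_comp[OF AE_not_endless])
  then have "AE x in M. edeg (\<Inter>n. cut n) x = 0"
  proof eventually_elim
    case (elim x)
    have empty: "{y. Upair x y \<in> (\<Inter>n. cut n) \<inter> E} = {}"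
    proof (rule equals0I)
      fix y assume "y \<in> {y. Upair x y \<in> (\<Inter>n. cut n) \<inter> E}"
      then have y: "\<And>n. Upair x y \<in> cut n" "Upair x y \<in> E" by auto
      have "endless x y \<or> endless y x" by (rule in_all_cuts[OF y(1)])
      then show False using elim comp_refl[of x E] Upair_in_comp[OF y(2)] by blast
    qed
    show ?case unfolding edeg_def empty by (simp add: ecard_finite)
  qed
  then have "(\<integral>\<^sup>+x. edeg (\<Inter>n. cut n) x \<partial>M) = (\<integral>\<^sup>+x. 0 \<partial>M)" by (rule nn_integral_cong_AE)
  then show ?thesis by (simp add: emeasure_eta[OF S])
qed

theorem hyperfinite_wmsf: "hyperfinite M E wmsf"
  unfolding hyperfinite_def
proof (intro allI impI)
  fix e :: real assume "e > 0"
  have "(\<lambda>n. emeasure (eta M E) (cut n)) \<longlonglongrightarrow> emeasure (eta M E) (\<Inter>n. cut n)"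
    using cut_uprod_sets cut_antimono by (intro Lim_emeasure_decseq decseq_SucI) (auto simp: sets_eta)
  then have "\<forall>\<^sub>F n in sequentially. emeasure (eta M E) (cut n) < ennreal e"
    unfolding eta_INT_cut by (rule order_tendstoD(2)) (simp add: \<open>e > 0\<close>)
  then obtain n where "emeasure (eta M E) (cut n) < ennreal e" by (auto simp: eventually_sequentially)
  then show "\<exists>S\<in>sets (eta M E). S \<subseteq> wmsf \<and> emeasure (eta M E) S \<le> ennreal e \<and> (\<forall>x. finite (comp (wmsf - S) x))"
    using cut_uprod_sets cut_subset finite_components_wmsf_cut
    by (intro bexI[of _ "cut n"]) (auto simp: sets_eta)
qed

lemma superlevel_spanning:
  assumes "finite (comp (wmsf \<inter> {e \<in> E. t < w e}) x)"
  shows "comp (wmsf \<inter> {e \<in> E. t < w e}) x = comp {e \<in> E. t < w e} x"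
proof (rule wmsf_spanning[OF _ _ assms])
  fix d e assume e: "e \<in> {e \<in> E. t < w e}" "d \<in> E" "gt d e"
  have "w e \<le> w d" using gt_le[OF e(3), of 0] by (simp add: u_0)
  then show "d \<in> {e \<in> E. t < w e}" using e by auto
qed blast

lemma superlevel_uprod_sets: "{e \<in> E. t < w e} \<in> uprod_sets"
proof -
  have "{e \<in> space (eta M E). t < w e} \<in> sets (eta M E)" using w_measurable by measurable
  then have "{e. t < w e} \<in> uprod_sets" by (simp add: sets_eta)
  moreover have "{e \<in> E. t < w e} = E \<inter> {e. t < w e}" by blast
  ultimately show ?thesis using E_uprod_sets by (simp add: uprod_sets_Int)
qed

theorem rho_superlevel: "rho M E {e \<in> E. t < w e} \<le> measure (eta M E) (wmsf \<inter> {e \<in> E. t < w e})"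
proof -
  let ?U = "{e \<in> E. t < w e}"
  have meas: "wmsf \<inter> ?U \<in> uprod_sets" using wmsf_uprod_sets superlevel_uprod_sets by (rule uprod_sets_Int)
  have sub: "wmsf \<inter> ?U \<subseteq> E" by blast
  have "icomp (wmsf \<inter> ?U) x = icomp ?U x" for x
  proof (cases "finite (comp (wmsf \<inter> ?U) x)")
    case True then show ?thesis using superlevel_spanning[OF True] by (simp add: icomp_def)
  next
    case False
    then have "infinite (comp ?U x)" using finite_subset[OF comp_mono[of "wmsf \<inter> ?U" ?U]] by blast
    then show ?thesis using False by (simp add: icomp_def)
  qed
  then have "rho M E ?U = rho M E (wmsf \<inter> ?U)" using rho_icomp[OF sub] rho_icomp[of ?U] by auto
  also have "\<dots> \<le> measure (eta M E) (wmsf \<inter> ?U)"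
    by (rule hyperfinite_rho_le_eta[OF meas sub hyperfinite_subset[OF hyperfinite_wmsf _ meas]]) blast
  finally show ?thesis .
qed

end

section \<open>Functionals on \<open>L\<^sup>1\<close>\<close>

lemma L1_bounded_functionalD:
  assumes "L1_bounded_functional N \<Lambda>"
  obtains K where "K > 0" "\<And>f. integrable N f \<Longrightarrow> \<bar>\<Lambda> f\<bar> \<le> K * (\<integral>x. \<bar>f x\<bar> \<partial>N)"
proof -
  obtain K where K: "\<And>f. integrable N f \<Longrightarrow> \<bar>\<Lambda> f\<bar> \<le> K * (\<integral>x. \<bar>f x\<bar> \<partial>N)"
    using assms unfolding L1_bounded_functional_def by blast
  have "\<bar>\<Lambda> f\<bar> \<le> max K 1 * (\<integral>x. \<bar>f x\<bar> \<partial>N)" if "integrable N f" for f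
  proof -
    have "K * (\<integral>x. \<bar>f x\<bar> \<partial>N) \<le> max K 1 * (\<integral>x. \<bar>f x\<bar> \<partial>N)" by (intro mult_right_mono) auto
    then show ?thesis using K[OF that] by linarith
  qed
  then show thesis using that[of "max K 1"] by simp
qed

lemma L1_linear_0:
  assumes "L1_linear N \<Lambda>"
  shows "\<Lambda> (\<lambda>x. 0) = 0"
proof -
  have "\<Lambda> (\<lambda>x. c * f x) = c * \<Lambda> f" if "integrable N f" for c f
    using assms that unfolding L1_linear_def by blast
  from this[of "\<lambda>x. 0" 0] show ?thesis by simp
qed

lemma L1_linear_diff:
  assumes "L1_linear N \<Lambda>" and f: "integrable N f" and h: "integrable N h"
  shows "\<Lambda> (\<lambda>x. f x - h x) = \<Lambda> f - \<Lambda> h"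
proof -
  have "integrable N (\<lambda>x. (-1) * h x)" using h by simp
  then have "\<Lambda> (\<lambda>x. f x + (-1) * h x) = \<Lambda> f + \<Lambda> (\<lambda>x. (-1) * h x)" using assms(1) f unfolding L1_linear_def by blast
  also have "\<Lambda> (\<lambda>x. (-1) * h x) = (-1) * \<Lambda> h" using assms(1) h unfolding L1_linear_def by blast
  finally show ?thesis by simp
qed

lemma topspace_weak_L1: "topspace (weak_L1 N) = {f. integrable N f}"
proof -
  have "L1_bounded_functional N (\<lambda>_. 0)" by (auto simp: L1_bounded_functional_def L1_linear_def intro: exI[of _ 0])
  then have "{f. integrable N f \<and> (0::real) \<in> UNIV} \<in> {{f. integrable N f \<and> \<Lambda> f \<in> U} | \<Lambda> U. L1_bounded_functional N \<Lambda> \<and> open U}"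
    by blast
  then have "{f. integrable N f} \<subseteq> topspace (weak_L1 N)" unfolding weak_L1_def topology_generated_by_topspace by auto
  moreover have "topspace (weak_L1 N) \<subseteq> {f. integrable N f}" unfolding weak_L1_def topology_generated_by_topspace by auto
  ultimately show ?thesis by blast
qed

text \<open>Each generating set is the preimage of an open set under a norm bounded functional, and
  norm openness survives finite intersections and unions.\<close>

lemma weakly_open_norm_open:
  assumes "openin (weak_L1 N) V" "f \<in> V"
  shows "\<exists>r>0. \<forall>h. integrable N h \<longrightarrow> (\<integral>x. \<bar>h x - f x\<bar> \<partial>N) < r \<longrightarrow> h \<in> V"
proof -
  let ?S = "{{f. integrable N f \<and> \<Lambda> f \<in> U} | \<Lambda> U. L1_bounded_functional N \<Lambda> \<and> open U}"
  have "generate_topology_on ?S V" using assms(1) unfolding weak_L1_def openin_topology_generated_by_iff .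
  then show ?thesis using assms(2)
  proof (induction arbitrary: f)
    case (Int A B)
    obtain r where r: "r > 0" "\<And>h. integrable N h \<Longrightarrow> (\<integral>x. \<bar>h x - f x\<bar> \<partial>N) < r \<Longrightarrow> h \<in> A" using Int by blast
    obtain s where s: "s > 0" "\<And>h. integrable N h \<Longrightarrow> (\<integral>x. \<bar>h x - f x\<bar> \<partial>N) < s \<Longrightarrow> h \<in> B" using Int by blast
    show ?case using r s by (intro exI[of _ "min r s"]) auto
  next
    case (UN K)
    then obtain k where k: "k \<in> K" "f \<in> k" by blast
    then obtain r where "r > 0" "\<And>h. integrable N h \<Longrightarrow> (\<integral>x. \<bar>h x - f x\<bar> \<partial>N) < r \<Longrightarrow> h \<in> k" using UN.IH by blast
    then show ?case using k by blast
  next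
    case (Basis V)
    then obtain \<Lambda> U where V: "V = {f. integrable N f \<and> \<Lambda> f \<in> U}" "L1_bounded_functional N \<Lambda>" "open U" by blast
    then have f: "integrable N f" "\<Lambda> f \<in> U" using Basis by auto
    obtain e where e: "e > 0" "ball (\<Lambda> f) e \<subseteq> U" using V(3) f(2) open_contains_ball by blast
    obtain K where K: "K > 0" "\<And>f. integrable N f \<Longrightarrow> \<bar>\<Lambda> f\<bar> \<le> K * (\<integral>x. \<bar>f x\<bar> \<partial>N)" using L1_bounded_functionalD[OF V(2)] by blast
    have lin: "L1_linear N \<Lambda>" using V(2) by (simp add: L1_bounded_functional_def)
    have "h \<in> V" if h: "integrable N h" "(\<integral>x. \<bar>h x - f x\<bar> \<partial>N) < e / K" for h
    proof -
      have "\<bar>\<Lambda> h - \<Lambda> f\<bar> \<le> K * (\<integral>x. \<bar>h x - f x\<bar> \<partial>N)"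
        using K(2)[of "\<lambda>x. h x - f x"] h f L1_linear_diff[OF lin h(1) f(1)] by simp
      also have "\<dots> < e" using h(2) K(1) by (simp add: field_simps)
      finally have "\<Lambda> h \<in> ball (\<Lambda> f) e" by (simp add: dist_real_def abs_minus_commute)
      then show ?thesis using e V h by blast
    qed
    then show ?case using e K by (intro exI[of _ "e / K"]) auto
  qed simp
qed

text \<open>The preimage of the unit interval around 0 contains a norm ball around 0; rescaling an
  arbitrary function into that ball yields the bound.\<close>

theorem weakly_continuous_bounded:
  assumes lin: "L1_linear N \<Lambda>" and cont: "continuous_map (weak_L1 N) euclideanreal \<Lambda>"
  shows "L1_bounded_functional N \<Lambda>"
proof -
  let ?V = "{f \<in> topspace (weak_L1 N). \<Lambda> f \<in> ball 0 1}"
  have "openin (weak_L1 N) ?V" by (rule openin_continuous_map_preimage[OF cont]) simp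
  moreover have "(\<lambda>x. 0) \<in> ?V" using L1_linear_0[OF lin] by (simp add: topspace_weak_L1)
  ultimately obtain r where r: "r > 0" "\<And>h. integrable N h \<Longrightarrow> (\<integral>x. \<bar>h x - 0\<bar> \<partial>N) < r \<Longrightarrow> h \<in> ?V"
    using weakly_open_norm_open by blast
  have "\<bar>\<Lambda> h\<bar> \<le> 2 / r * (\<integral>x. \<bar>h x\<bar> \<partial>N)" if h: "integrable N h" for h
  proof (rule ccontr)
    assume "\<not> ?thesis"
    then have less: "2 / r * (\<integral>x. \<bar>h x\<bar> \<partial>N) < \<bar>\<Lambda> h\<bar>" by simp
    moreover have "0 \<le> 2 / r * (\<integral>x. \<bar>h x\<bar> \<partial>N)" using r by simp
    ultimately have pos: "0 < \<bar>\<Lambda> h\<bar>" by linarith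
    let ?c = "1 / \<bar>\<Lambda> h\<bar>"
    have "(\<integral>x. \<bar>?c * h x - 0\<bar> \<partial>N) = ?c * (\<integral>x. \<bar>h x\<bar> \<partial>N)" by (simp add: abs_mult)
    also have "\<dots> < r"
    proof -
      have "2 * (\<integral>x. \<bar>h x\<bar> \<partial>N) < r * \<bar>\<Lambda> h\<bar>" using less r(1) by (simp add: field_simps)
      moreover have "0 \<le> (\<integral>x. \<bar>h x\<bar> \<partial>N)" by simp
      ultimately have "(\<integral>x. \<bar>h x\<bar> \<partial>N) < r * \<bar>\<Lambda> h\<bar>" by linarith
      then show ?thesis using pos by (simp add: field_simps)
    qed
    finally have "(\<lambda>x. ?c * h x) \<in> ?V" using h by (intro r(2)) auto
    then have "\<bar>\<Lambda> (\<lambda>x. ?c * h x)\<bar> < 1" by (simp add: dist_real_def)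
    moreover have "\<Lambda> (\<lambda>x. ?c * h x) = ?c * \<Lambda> h" using lin h unfolding L1_linear_def by blast
    ultimately show False using pos by (simp add: abs_mult)
  qed
  then show ?thesis using lin unfolding L1_bounded_functional_def by blast
qed

lemma bounded_functional_continuous:
  assumes "L1_bounded_functional N \<Lambda>"
  shows "continuous_map (weak_L1 N) euclideanreal \<Lambda>"
  unfolding continuous_map_def
proof (intro conjI allI impI)
  show "\<Lambda> \<in> topspace (weak_L1 N) \<rightarrow> topspace euclideanreal" by simp
  fix U :: "real set" assume "openin euclideanreal U"
  then show "openin (weak_L1 N) {f \<in> topspace (weak_L1 N). \<Lambda> f \<in> U}"
    unfolding topspace_weak_L1 unfolding weak_L1_def
    by (intro topology_generated_by_Basis) (use assms in auto)
qed

lemma L1_bounded_functional_integral: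
  assumes [measurable]: "\<phi> \<in> borel_measurable N" and K: "\<And>x. \<bar>\<phi> x\<bar> \<le> K"
  shows "integrable N f \<Longrightarrow> integrable N (\<lambda>x. \<phi> x * f x)"
    and "L1_bounded_functional N (\<lambda>f. \<integral>x. \<phi> x * f x \<partial>N)"
proof -
  have bd: "\<bar>\<phi> x * f x\<bar> \<le> K * \<bar>f x\<bar>" for f x using K by (simp add: abs_mult mult_right_mono)
  have int: "integrable N (\<lambda>x. \<phi> x * f x)" if [measurable]: "integrable N f" for f
  proof (rule Bochner_Integration.integrable_bound)
    show "integrable N (\<lambda>x. K * \<bar>f x\<bar>)" using that by simp
    show "AE x in N. norm (\<phi> x * f x) \<le> norm (K * \<bar>f x\<bar>)" using bd by (intro AE_I2) (metis abs_ge_self order_trans real_norm_def)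
  qed measurable
  then show "integrable N f \<Longrightarrow> integrable N (\<lambda>x. \<phi> x * f x)" .
  have "\<bar>\<integral>x. \<phi> x * f x \<partial>N\<bar> \<le> K * (\<integral>x. \<bar>f x\<bar> \<partial>N)" if f: "integrable N f" for f
  proof -
    have "\<bar>\<integral>x. \<phi> x * f x \<partial>N\<bar> \<le> (\<integral>x. \<bar>\<phi> x * f x\<bar> \<partial>N)" by (rule integral_abs_bound)
    also have "\<dots> \<le> (\<integral>x. K * \<bar>f x\<bar> \<partial>N)" using int[OF f] f bd by (intro integral_mono) auto
    finally show ?thesis by simp
  qed
  moreover have "(\<integral>x. \<phi> x * (f x + h x) \<partial>N) = (\<integral>x. \<phi> x * f x \<partial>N) + (\<integral>x. \<phi> x * h x \<partial>N)"
    if "integrable N f" "integrable N h" for f h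
    using int[OF that(1)] int[OF that(2)] by (simp add: distrib_left)
  moreover have "(\<integral>x. \<phi> x * (c * f x) \<partial>N) = c * (\<integral>x. \<phi> x * f x \<partial>N)" for c f
    by (simp add: mult.left_commute[of _ c])
  ultimately show "L1_bounded_functional N (\<lambda>f. \<integral>x. \<phi> x * f x \<partial>N)"
    unfolding L1_bounded_functional_def L1_linear_def by blast
qed

text \<open>Duality of L^1 and L^infinity on a finite measure space: the values of the functional on
  indicators define a signed measure, whose Radon-Nikodym density represents the functional on
  simple functions and then, by continuity, everywhere.\<close>

theorem (in finite_measure) L1_functional_density:
  assumes bd: "L1_bounded_functional M \<Lambda>"
  shows "\<exists>\<phi>\<in>borel_measurable M. \<exists>K. (\<forall>x. \<bar>\<phi> x\<bar> \<le> K) \<and> (\<forall>f. integrable M f \<longrightarrow> \<Lambda> f = (\<integral>x. \<phi> x * f x \<partial>M))"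
proof -
  obtain K where K: "K > 0" "\<And>f. integrable M f \<Longrightarrow> \<bar>\<Lambda> f\<bar> \<le> K * (\<integral>x. \<bar>f x\<bar> \<partial>M)" using L1_bounded_functionalD[OF bd] by blast
  have lin: "L1_linear M \<Lambda>" using bd by (simp add: L1_bounded_functional_def)
  have add: "\<Lambda> (\<lambda>x. f x + h x) = \<Lambda> f + \<Lambda> h" if "integrable M f" "integrable M h" for f h
    using lin that unfolding L1_linear_def by blast
  have scale: "\<Lambda> (\<lambda>x. c * f x) = c * \<Lambda> f" if "integrable M f" for c f
    using lin that unfolding L1_linear_def by blast
  define \<nu> where "\<nu> A = \<Lambda> (indicator A) + K * measure M A" for A
  have intI: "integrable M (indicator A :: 'a \<Rightarrow> real)" if "A \<in> sets M" for A
    using that emeasure_finite by (simp add: less_top[symmetric])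
  have ind: "\<bar>\<Lambda> (indicator A)\<bar> \<le> K * measure M A" if "A \<in> sets M" for A
    using K(2)[OF intI[OF that]] that by simp
  have \<nu>0: "0 \<le> \<nu> A" and \<nu>K: "\<nu> A \<le> 2 * K * measure M A" if "A \<in> sets M" for A
    using ind[OF that] unfolding \<nu>_def by linarith+
  have \<nu>_Un: "\<nu> (A \<union> B) = \<nu> A + \<nu> B" if "A \<in> sets M" "B \<in> sets M" "A \<inter> B = {}" for A B
  proof -
    have "indicator (A \<union> B) = (\<lambda>x. indicator A x + indicator B x :: real)"
      using that(3) by (auto simp: indicator_def fun_eq_iff)
    then have "\<Lambda> (indicator (A \<union> B)) = \<Lambda> (indicator A) + \<Lambda> (indicator B)"
      using add[OF intI[OF that(1)] intI[OF that(2)]] by simp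
    then show ?thesis using finite_measure_Union[OF that] by (simp add: \<nu>_def distrib_left)
  qed
  define Nu where "Nu = measure_of (space M) (sets M) (\<lambda>A. ennreal (\<nu> A))"
  have \<nu>_empty: "\<nu> {} = 0" using \<nu>0[of "{}"] \<nu>K[of "{}"] by simp
  have "countably_additive (sets M) (\<lambda>A. ennreal (\<nu> A))"
  proof (rule countably_additiveI)
    fix A :: "nat \<Rightarrow> 'a set" assume A: "range A \<subseteq> sets M" "disjoint_family A" "(\<Union>i. A i) \<in> sets M"
    have [measurable]: "A i \<in> sets M" for i using A by auto
    have fin: "\<nu> (\<Union>i<n. A i) = (\<Sum>i<n. \<nu> (A i))" for n
    proof (induction n)
      case (Suc n)
      have "\<nu> ((\<Union>i<n. A i) \<union> A n) = \<nu> (\<Union>i<n. A i) + \<nu> (A n)"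
      proof (intro \<nu>_Un)
        have "A i \<inter> A n = {}" if "i < n" for i using disjoint_family_onD[OF A(2), of i n] that by simp
        then show "(\<Union>i<n. A i) \<inter> A n = {}" by blast
      qed auto
      then show ?case using Suc by (simp add: lessThan_Suc Un_commute)
    qed (simp add: \<nu>_empty)
    have split: "\<nu> (\<Union>i. A i) = (\<Sum>i<n. \<nu> (A i)) + \<nu> ((\<Union>i. A i) - (\<Union>i<n. A i))" for n
    proof -
      have "(\<Union>i. A i) = (\<Union>i<n. A i) \<union> ((\<Union>i. A i) - (\<Union>i<n. A i))" by blast
      then have "\<nu> (\<Union>i. A i) = \<nu> ((\<Union>i<n. A i) \<union> ((\<Union>i. A i) - (\<Union>i<n. A i)))" by (rule arg_cong)
      also have "\<dots> = \<nu> (\<Union>i<n. A i) + \<nu> ((\<Union>i. A i) - (\<Union>i<n. A i))" by (rule \<nu>_Un) auto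
      finally show ?thesis using fin by simp
    qed
    \<comment> \<open>Countable additivity: the remainder after \<open>n\<close> sets is dominated
      by \<open>2 * K\<close> times its measure, which tends to 0 in a finite measure space.\<close>
    have "(\<lambda>n. measure M ((\<Union>i. A i) - (\<Union>i<n. A i))) \<longlonglongrightarrow> measure M (\<Inter>n. (\<Union>i. A i) - (\<Union>i<n. A i))"
      by (rule finite_Lim_measure_decseq) (auto simp: decseq_def)
    moreover have "(\<Inter>n. (\<Union>i. A i) - (\<Union>i<n. A i)) = {}" by blast
    ultimately have "(\<lambda>n. measure M ((\<Union>i. A i) - (\<Union>i<n. A i))) \<longlonglongrightarrow> 0" by (simp only: measure_empty)
    then have lim0: "(\<lambda>n. 2 * K * measure M ((\<Union>i. A i) - (\<Union>i<n. A i))) \<longlonglongrightarrow> 0" by (intro tendsto_mult_right_zero)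
    have "(\<lambda>n. \<nu> ((\<Union>i. A i) - (\<Union>i<n. A i))) \<longlonglongrightarrow> 0"
    proof (rule tendsto_sandwich[OF _ _ tendsto_const lim0])
      show "\<forall>\<^sub>F n in sequentially. 0 \<le> \<nu> ((\<Union>i. A i) - (\<Union>i<n. A i))" by (intro always_eventually allI \<nu>0) auto
      show "\<forall>\<^sub>F n in sequentially. \<nu> ((\<Union>i. A i) - (\<Union>i<n. A i)) \<le> 2 * K * measure M ((\<Union>i. A i) - (\<Union>i<n. A i))"
        by (intro always_eventually allI \<nu>K) auto
    qed
    then have "(\<lambda>n. \<nu> (\<Union>i. A i) - \<nu> ((\<Union>i. A i) - (\<Union>i<n. A i))) \<longlonglongrightarrow> \<nu> (\<Union>i. A i) - 0" by (intro tendsto_diff tendsto_const)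
    moreover have "\<nu> (\<Union>i. A i) - \<nu> ((\<Union>i. A i) - (\<Union>i<n. A i)) = (\<Sum>i<n. \<nu> (A i))" for n using split[of n] by simp
    ultimately have "(\<lambda>n. \<Sum>i<n. \<nu> (A i)) \<longlonglongrightarrow> \<nu> (\<Union>i. A i)" by simp
    then have "(\<lambda>i. \<nu> (A i)) sums \<nu> (\<Union>i. A i)" by (simp add: sums_def)
    then show "(\<Sum>i. ennreal (\<nu> (A i))) = ennreal (\<nu> (\<Union>i. A i))"
      using \<nu>0 by (intro suminf_ennreal_eq) auto
  qed
  then have Nu: "emeasure Nu A = ennreal (\<nu> A)" if "A \<in> sets M" for A
    unfolding Nu_def using that \<nu>_empty by (intro emeasure_measure_of_sigma sets.sigma_algebra_axioms) (auto simp: positive_def)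
  have sets_Nu: "sets Nu = sets M" unfolding Nu_def by (simp add: sets.sigma_sets_eq)
  have "absolutely_continuous M Nu" unfolding absolutely_continuous_def
  proof
    fix A assume A: "A \<in> null_sets M"
    then have "measure M A = 0" by (simp add: measure_def null_setsD1)
    then have "\<nu> A = 0" using \<nu>0[of A] \<nu>K[of A] A by auto
    then show "A \<in> null_sets Nu" using A Nu by (intro null_setsI) (auto simp: sets_Nu)
  qed
  then obtain q where q[measurable]: "q \<in> borel_measurable M" and dq: "density M q = Nu"
    using Radon_Nikodym sets_Nu by blast
  \<comment> \<open>The density \<open>q\<close> is at most \<open>2 * K\<close> only almost
    everywhere. Truncation makes the bound hold at every point, and subtracting \<open>K\<close>
    undoes the shift made in \<open>\<nu>\<close>.\<close>
  define \<psi> where "\<psi> x = enn2real (min (q x) (ennreal (2 * K))) - K" for x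
  have [measurable]: "\<psi> \<in> borel_measurable M" unfolding \<psi>_def by measurable
  have K0: "0 \<le> 2 * K" using K by simp
  have \<psi>K: "\<bar>\<psi> x\<bar> \<le> K" for x
  proof -
    have "enn2real (min (q x) (ennreal (2 * K))) \<le> 2 * K"
      using K0 by (intro enn2real_leI) auto
    moreover have "0 \<le> enn2real (min (q x) (ennreal (2 * K)))" by simp
    ultimately show ?thesis unfolding \<psi>_def by linarith
  qed
  have "AE x in M. q x \<le> ennreal (2 * K)"
  proof -
    let ?A = "{x \<in> space M. ennreal (2 * K) < q x}"
    have A: "?A \<in> sets M" by measurable
    have le: "(\<integral>\<^sup>+x. q x * indicator ?A x \<partial>M) \<le> (\<integral>\<^sup>+x. ennreal (2 * K) * indicator ?A x \<partial>M)"
    proof -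
      have "(\<integral>\<^sup>+x. q x * indicator ?A x \<partial>M) = ennreal (\<nu> ?A)" using Nu[OF A] emeasure_density[OF q A] dq by simp
      also have "\<dots> \<le> ennreal (2 * K * measure M ?A)" by (intro ennreal_leI \<nu>K A)
      also have "\<dots> = (\<integral>\<^sup>+x. ennreal (2 * K) * indicator ?A x \<partial>M)"
        using A K0 by (simp add: nn_integral_cmult_indicator emeasure_eq_measure ennreal_mult)
      finally show ?thesis .
    qed
    have "AE x in M. q x * indicator ?A x \<le> ennreal (2 * K) * indicator ?A x"
    proof (rule ccontr)
      assume neg: "\<not> ?thesis"
      have fin: "(\<integral>\<^sup>+x. ennreal (2 * K) * indicator ?A x \<partial>M) \<noteq> \<infinity>"
        using A by (simp add: nn_integral_cmult_indicator ennreal_mult_eq_top_iff emeasure_eq_measure)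
      have "(\<integral>\<^sup>+x. ennreal (2 * K) * indicator ?A x \<partial>M) < (\<integral>\<^sup>+x. q x * indicator ?A x \<partial>M)"
        by (rule nn_integral_less[OF _ _ fin _ neg]) (auto split: split_indicator)
      then show False using le by simp
    qed
    then show ?thesis
    proof (rule AE_mp, intro AE_I2 impI)
      fix x assume "x \<in> space M" "q x * indicator ?A x \<le> ennreal (2 * K) * indicator ?A x"
      then show "q x \<le> ennreal (2 * K)" by (cases "x \<in> ?A") (auto simp: not_less)
    qed
  qed
  then have q\<psi>: "AE x in M. q x = ennreal (\<psi> x + K)"
  proof eventually_elim
    case (elim x)
    then have "q x < top" using ennreal_less_top order_le_less_trans by blast
    then show ?case using elim by (simp add: \<psi>_def min_absorb1)
  qed
  note int_\<psi> = L1_bounded_functional_integral(1)[of \<psi> M K, OF _ \<psi>K]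
  have base: "\<Lambda> (indicator A) = (\<integral>x. \<psi> x * indicator A x \<partial>M)" if A[measurable]: "A \<in> sets M" for A
  proof -
    have int: "integrable M (\<lambda>x. \<psi> x * indicator A x)" by (rule int_\<psi>[OF _ intI[OF A]]) measurable
    have int': "integrable M (\<lambda>x. (\<psi> x + K) * indicator A x)"
      using int intI[OF A] by (simp add: distrib_right)
    have pos: "0 \<le> \<psi> x + K" for x using \<psi>K[of x] by linarith
    have "ennreal (\<nu> A) = (\<integral>\<^sup>+x. q x * indicator A x \<partial>M)" using Nu[OF A] emeasure_density[OF q A] dq by simp
    also have "\<dots> = (\<integral>\<^sup>+x. ennreal ((\<psi> x + K) * indicator A x) \<partial>M)"
      by (rule nn_integral_cong_AE) (use q\<psi> in eventually_elim, auto split: split_indicator)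
    also have "\<dots> = ennreal (\<integral>x. (\<psi> x + K) * indicator A x \<partial>M)"
      using pos by (intro nn_integral_eq_integral[OF int']) auto
    finally have "\<nu> A = (\<integral>x. (\<psi> x + K) * indicator A x \<partial>M)"
      using \<nu>0[OF A] pos by (subst (asm) ennreal_inj) (auto intro!: integral_nonneg_AE)
    also have "\<dots> = (\<integral>x. \<psi> x * indicator A x \<partial>M) + K * measure M A"
      using int intI[OF A] by (simp add: distrib_right)
    finally show ?thesis by (simp add: \<nu>_def)
  qed
  have "\<Lambda> f = (\<integral>x. \<psi> x * f x \<partial>M)" if "integrable M f" for f :: "'a \<Rightarrow> real"
    using that
  proof (induction rule: integrable_induct)
    case (base A c)
    have "\<Lambda> (\<lambda>x. c * indicator A x) = c * (\<integral>x. \<psi> x * indicator A x \<partial>M)"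
      using scale[OF intI[OF base(1)]] \<open>\<And>A. A \<in> sets M \<Longrightarrow> \<Lambda> (indicator A) = _\<close>[OF base(1)] by simp
    also have "\<dots> = (\<integral>x. \<psi> x * (c * indicator A x) \<partial>M)" by (simp add: mult.left_commute[of _ c])
    finally show ?case by (simp add: mult.commute[of c])
  next
    case (add f h)
    have "integrable M (\<lambda>x. \<psi> x * f x)" "integrable M (\<lambda>x. \<psi> x * h x)" by (intro int_\<psi> add.hyps; measurable)+
    then show ?case using \<open>\<And>f h. integrable M f \<Longrightarrow> integrable M h \<Longrightarrow> \<Lambda> (\<lambda>x. f x + h x) = _\<close>[OF add.hyps] add.IH
      by (simp add: distrib_left)
  next
    case (lim f s)
    note [measurable] = borel_measurable_integrable[OF lim.hyps(1)] borel_measurable_integrable[OF lim.hyps(4)]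
    have dom: "(\<lambda>i. \<integral>x. \<bar>s i x - f x\<bar> \<partial>M) \<longlonglongrightarrow> (\<integral>x. 0 \<partial>M)"
    \<comment> \<open>The approximants satisfy |s i| \<le> 2 |f|, hence |s i - f| \<le> 3
      |f|.\<close>
    proof (rule integral_dominated_convergence[where w="\<lambda>x. 3 * \<bar>f x\<bar>"])
      show "AE x in M. (\<lambda>i. \<bar>s i x - f x\<bar>) \<longlonglongrightarrow> 0"
        using lim.hyps(2) by (intro AE_I2 tendsto_rabs_zero) (simp add: LIM_zero)
      show "AE x in M. norm \<bar>s i x - f x\<bar> \<le> 3 * \<bar>f x\<bar>" for i
      proof (intro AE_I2)
        fix x assume "x \<in> space M"
        then have "\<bar>s i x\<bar> \<le> 2 * \<bar>f x\<bar>" using lim.hyps(3)[of x i] by simp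
        then show "norm \<bar>s i x - f x\<bar> \<le> 3 * \<bar>f x\<bar>" by simp
      qed
    qed (use lim.hyps(4) in \<open>measurable, auto\<close>)
    have close: "\<bar>\<Lambda> (s i) - \<Lambda> f\<bar> \<le> K * (\<integral>x. \<bar>s i x - f x\<bar> \<partial>M)" for i
      using K(2)[of "\<lambda>x. s i x - f x"] lim.hyps(1)[of i] lim.hyps(4) L1_linear_diff[OF lin lim.hyps(1)[of i] lim.hyps(4)] by simp
    have close': "\<bar>\<Lambda> (s i) - (\<integral>x. \<psi> x * f x \<partial>M)\<bar> \<le> K * (\<integral>x. \<bar>s i x - f x\<bar> \<partial>M)" for i
    proof -
      have ints: "integrable M (\<lambda>x. \<psi> x * s i x)" "integrable M (\<lambda>x. \<psi> x * f x)" by (intro int_\<psi> lim.hyps; measurable)+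
      have "\<Lambda> (s i) - (\<integral>x. \<psi> x * f x \<partial>M) = (\<integral>x. \<psi> x * (s i x - f x) \<partial>M)"
        using ints lim.IH[of i] by (simp add: right_diff_distrib)
      moreover have "\<bar>\<integral>x. \<psi> x * (s i x - f x) \<partial>M\<bar> \<le> (\<integral>x. K * \<bar>s i x - f x\<bar> \<partial>M)"
      proof (rule order_trans[OF integral_abs_bound])
        show "(\<integral>x. \<bar>\<psi> x * (s i x - f x)\<bar> \<partial>M) \<le> (\<integral>x. K * \<bar>s i x - f x\<bar> \<partial>M)"
        proof (rule integral_mono)
          show "integrable M (\<lambda>x. \<bar>\<psi> x * (s i x - f x)\<bar>)"
            using ints by (intro integrable_abs) (simp add: right_diff_distrib)
          show "integrable M (\<lambda>x. K * \<bar>s i x - f x\<bar>)" using lim.hyps(1)[of i] lim.hyps(4) by simp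
          show "\<bar>\<psi> x * (s i x - f x)\<bar> \<le> K * \<bar>s i x - f x\<bar>" for x using \<psi>K by (simp add: abs_mult mult_right_mono)
        qed
      qed
      ultimately show ?thesis by simp
    qed
    have K0: "(\<lambda>i. K * (\<integral>x. \<bar>s i x - f x\<bar> \<partial>M)) \<longlonglongrightarrow> 0" using dom by (intro tendsto_mult_right_zero) simp
    have "(\<lambda>i. \<Lambda> (s i) - \<Lambda> f) \<longlonglongrightarrow> 0"
      by (rule Lim_null_comparison[OF _ K0]) (use close in auto)
    moreover have "(\<lambda>i. \<Lambda> (s i) - (\<integral>x. \<psi> x * f x \<partial>M)) \<longlonglongrightarrow> 0"
      by (rule Lim_null_comparison[OF _ K0]) (use close' in auto)
    ultimately show ?case by (metis LIM_zero_cancel LIMSEQ_unique)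
  qed
  then show ?thesis using \<psi>K by (intro bexI[of _ \<psi>]) auto
qed

text \<open>\<open>ennreal\<close> discards negative values, so only levels t > 0 contribute. An
  inequality between two measures on all superlevel sets thereby becomes an inequality between
  integrals.\<close>

lemma layer_cake:
  fixes w :: "'a \<Rightarrow> real"
  assumes "sigma_finite_measure P" and [measurable]: "w \<in> borel_measurable P"
  shows "(\<integral>\<^sup>+x. ennreal (w x) \<partial>P) = (\<integral>\<^sup>+t. indicator {0<..} t * emeasure P {x \<in> space P. t < w x} \<partial>lborel)"
proof -
  interpret P: sigma_finite_measure P by fact
  interpret pair_sigma_finite P lborel ..
  have "ennreal (w x) = (\<integral>\<^sup>+t. indicator {p. 0 < snd p \<and> snd p < w (fst p)} (x, t) \<partial>lborel)" for x
  proof -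
    have "(\<integral>\<^sup>+t. indicator {p. 0 < snd p \<and> snd p < w (fst p)} (x, t) \<partial>lborel) = (\<integral>\<^sup>+t. indicator {0<..<w x} t \<partial>lborel)"
      by (intro nn_integral_cong) (auto split: split_indicator)
    also have "\<dots> = emeasure lborel {0<..<w x}" by simp
    also have "\<dots> = ennreal (w x)" by (cases "0 \<le> w x") (auto simp: ennreal_neg)
    finally show ?thesis ..
  qed
  then have "(\<integral>\<^sup>+x. ennreal (w x) \<partial>P) = (\<integral>\<^sup>+x. (\<integral>\<^sup>+t. indicator {p. 0 < snd p \<and> snd p < w (fst p)} (x, t) \<partial>lborel) \<partial>P)" by simp
  also have "\<dots> = (\<integral>\<^sup>+t. (\<integral>\<^sup>+x. indicator {p. 0 < snd p \<and> snd p < w (fst p)} (x, t) \<partial>P) \<partial>lborel)"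
  proof (rule Fubini'[symmetric])
    have eq: "(\<lambda>(x, y). indicator {p. 0 < snd p \<and> snd p < w (fst p)} (x, y) :: ennreal)
      = (\<lambda>p. if 0 < snd p \<and> snd p < w (fst p) then 1 else 0)" by (auto simp: fun_eq_iff)
    show "(\<lambda>(x, y). indicator {p. 0 < snd p \<and> snd p < w (fst p)} (x, y) :: ennreal) \<in> borel_measurable (P \<Otimes>\<^sub>M lborel)"
      unfolding eq by measurable
  qed
  also have "\<dots> = (\<integral>\<^sup>+t. indicator {0<..} t * emeasure P {x \<in> space P. t < w x} \<partial>lborel)"
  proof (rule nn_integral_cong)
    fix t :: real
    have "(\<integral>\<^sup>+x. indicator {p. 0 < snd p \<and> snd p < w (fst p)} (x, t) \<partial>P) = (\<integral>\<^sup>+x. indicator {0<..} t * indicator {x \<in> space P. t < w x} x \<partial>P)"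
      by (intro nn_integral_cong) (auto split: split_indicator)
    also have "\<dots> = indicator {0<..} t * emeasure P {x \<in> space P. t < w x}"
      by (subst nn_integral_cmult) auto
    finally show "(\<integral>\<^sup>+x. indicator {p. 0 < snd p \<and> snd p < w (fst p)} (x, t) \<partial>P) = indicator {0<..} t * emeasure P {x \<in> space P. t < w x}" .
  qed
  finally show ?thesis .
qed

section \<open>Exposed points\<close>

lemma AE_nonneg_if_set_integrals_nonneg:
  fixes f :: "'e \<Rightarrow> real"
  assumes f[measurable]: "integrable N f" and nonneg: "\<And>A. A \<in> sets N \<Longrightarrow> 0 \<le> (\<integral>x\<in>A. f x \<partial>N)"
  shows "AE x in N. 0 \<le> f x"
proof -
  let ?A = "{x \<in> space N. f x < 0}"
  have A[measurable]: "?A \<in> sets N" by measurable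
  have int: "integrable N (\<lambda>x. - (indicator ?A x * f x))"
    using integrable_mult_indicator[OF A f] by simp
  have pos: "AE x in N. 0 \<le> - (indicator ?A x * f x)" by (intro AE_I2) (auto split: split_indicator)
  have "(\<integral>x. - (indicator ?A x * f x) \<partial>N) \<le> 0" using nonneg[OF A] by (simp add: set_lebesgue_integral_def)
  moreover have "0 \<le> (\<integral>x. - (indicator ?A x * f x) \<partial>N)" by (rule integral_nonneg_AE[OF pos])
  ultimately have "(\<integral>x. - (indicator ?A x * f x) \<partial>N) = 0" by linarith
  then have "AE x in N. - (indicator ?A x * f x) = 0" using integral_nonneg_eq_0_iff_AE[OF int pos] by blast
  then show ?thesis
  proof (rule AE_mp, intro AE_I2 impI)
    fix x assume "x \<in> space N" "- (indicator ?A x * f x) = 0"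
    then show "0 \<le> f x" by (cases "x \<in> ?A") auto
  qed
qed

context graphing_space
begin

lemma set_integral_within_E:
  assumes A: "A \<in> uprod_sets" and f: "integrable (eta M E) f"
  shows "(\<integral>e\<in>A. f e \<partial>eta M E) = (\<integral>e\<in>A \<inter> E. f e \<partial>eta M E)"
proof -
  have [measurable]: "A \<in> sets (eta M E)" "A \<inter> E \<in> sets (eta M E)" "f \<in> borel_measurable (eta M E)"
    using A E_uprod_sets f by (auto simp: sets_eta intro: uprod_sets_Int)
  show ?thesis unfolding set_lebesgue_integral_def
  proof (rule integral_cong_AE)
    show "AE e in eta M E. indicat_real A e *\<^sub>R f e = indicat_real (A \<inter> E) e *\<^sub>R f e"
      using AE_eta_E by eventually_elim (auto split: split_indicator)
  qed measurable
qed

lemma mm_plus_integrable: "\<alpha> \<in> mm_plus M E \<Longrightarrow> integrable (eta M E) \<alpha>"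
  by (simp add: mm_plus_def)

lemma mm_plus_bounds:
  assumes "\<alpha> \<in> mm_plus M E" "A \<in> uprod_sets" "A \<subseteq> E"
  shows "0 \<le> (\<integral>e\<in>A. \<alpha> e \<partial>eta M E)" "(\<integral>e\<in>A. \<alpha> e \<partial>eta M E) \<le> rho M E A"
  using assms by (auto simp: mm_plus_def sets_eta)

lemma mm_plus_AE_nonneg:
  assumes \<alpha>: "\<alpha> \<in> mm_plus M E"
  shows "AE e in eta M E. 0 \<le> \<alpha> e"
proof (rule AE_nonneg_if_set_integrals_nonneg[OF mm_plus_integrable[OF \<alpha>]])
  fix A assume "A \<in> sets (eta M E)"
  then have A: "A \<in> uprod_sets" by (simp add: sets_eta)
  show "0 \<le> (\<integral>e\<in>A. \<alpha> e \<partial>eta M E)"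
    unfolding set_integral_within_E[OF A mm_plus_integrable[OF \<alpha>]]
    by (rule mm_plus_bounds(1)[OF \<alpha> uprod_sets_Int[OF A E_uprod_sets]]) simp
qed

lemma set_integral_indicator:
  assumes A: "A \<in> uprod_sets" and F: "F \<in> uprod_sets"
  shows "(\<integral>e\<in>A. indicat_real F e \<partial>eta M E) = measure (eta M E) (A \<inter> F)"
proof -
  have "(\<integral>e\<in>A. indicat_real F e \<partial>eta M E) = (\<integral>e. indicator (A \<inter> F) e \<partial>eta M E)"
    unfolding set_lebesgue_integral_def by (intro Bochner_Integration.integral_cong) (auto split: split_indicator)
  also have "\<dots> = measure (eta M E) (A \<inter> F)"
    using A F by (simp add: sets_eta uprod_sets_Int)
  finally show ?thesis .
qed

lemma integrable_indicator: "F \<in> uprod_sets \<Longrightarrow> integrable (eta M E) (indicator F :: _ \<Rightarrow> real)"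
  using eta.emeasure_finite by (simp add: sets_eta less_top[symmetric])

lemma indicator_mm_plus:
  assumes F: "F \<in> uprod_sets" "F \<subseteq> E" and hyp: "hyperfinite M E F" and acyc: "acyclic_edges F"
  shows "indicator F \<in> mm_plus M E"
  unfolding mm_plus_def mem_Collect_eq
proof (intro conjI ballI impI)
  show "integrable (eta M E) (indicator F :: _ \<Rightarrow> real)" by (rule integrable_indicator[OF F(1)])
  fix A assume "A \<in> sets (eta M E)" and AE: "A \<subseteq> E"
  then have A: "A \<in> uprod_sets" by (simp add: sets_eta)
  have AF: "A \<inter> F \<in> uprod_sets" "A \<inter> F \<subseteq> E" using A F AE by (auto intro: uprod_sets_Int)
  show "0 \<le> (\<integral>e\<in>A. indicat_real F e \<partial>eta M E)" using set_integral_indicator[OF A F(1)] by simp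
  have "measure (eta M E) (A \<inter> F) \<le> rho M E (A \<inter> F)"
    by (rule hyperfinite_acyclic_eta_le_rho[OF AF]) (auto intro: hyperfinite_subset[OF hyp _ AF(1)] acyclic_edges_subset[OF acyc])
  also have "\<dots> \<le> rho M E A" by (rule rho_mono[OF AF(1) A AE]) simp
  finally show "(\<integral>e\<in>A. indicat_real F e \<partial>eta M E) \<le> rho M E A" using set_integral_indicator[OF A F(1)] by simp
qed

lemma is_restriction_AE:
  assumes F: "F \<in> uprod_sets" and \<alpha>: "integrable (eta M E) \<alpha>" and r: "is_restriction (eta M E) \<alpha> F"
  shows "AE e in eta M E. \<alpha> e = indicator F e"
  by (rule density_unique_real[OF \<alpha> integrable_indicator[OF F]])
    (use r set_integral_indicator[OF _ F] in \<open>auto simp: is_restriction_def sets_eta\<close>)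

lemma AE_is_restriction:
  assumes F: "F \<in> uprod_sets" and \<alpha>: "integrable (eta M E) \<alpha>" and eq: "AE e in eta M E. indicator F e = \<alpha> e"
  shows "is_restriction (eta M E) \<alpha> F"
  unfolding is_restriction_def
proof
  fix A assume A[measurable]: "A \<in> sets (eta M E)"
  have [measurable]: "F \<in> sets (eta M E)" "\<alpha> \<in> borel_measurable (eta M E)" using F \<alpha> by (auto simp: sets_eta)
  have "(\<integral>e\<in>A. \<alpha> e \<partial>eta M E) = (\<integral>e\<in>A. indicat_real F e \<partial>eta M E)"
    unfolding set_lebesgue_integral_def
  proof (rule integral_cong_AE)
    show "AE e in eta M E. indicat_real A e *\<^sub>R \<alpha> e = indicat_real A e *\<^sub>R indicator F e"
      using eq by eventually_elim simp
  qed measurable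
  then show "(\<integral>e\<in>A. \<alpha> e \<partial>eta M E) = measure (eta M E) (A \<inter> F)"
    using set_integral_indicator[OF _ F, of A] A by (simp add: sets_eta)
qed

text \<open>Every competitor \<open>y\<close> is nonnegative, and at most 1 on \<open>F\<close>.
  Hence \<open>\<phi>\<close> has the sign of the difference of the indicator and \<open>y\<close>,
  and the gap between the two values of the functional is exactly their L^1 distance. The general
  \<open>C\<close> serves both convex sets at once.\<close>

theorem hyperfinite_restriction_exposed:
  assumes C: "C \<subseteq> mm_plus M E" and \<alpha>: "\<alpha> \<in> C" and F: "F \<in> uprod_sets" "F \<subseteq> E"
    and r: "is_restriction (eta M E) \<alpha> F" and hyp: "hyperfinite M E F"
  shows "exposed_point_L1 (eta M E) C \<alpha>"
proof -
  have [measurable]: "F \<in> sets (eta M E)" using F by (simp add: sets_eta)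
  have \<alpha>F: "AE e in eta M E. \<alpha> e = indicator F e"
    using is_restriction_AE[OF F(1) _ r] mm_plus_integrable \<alpha> C by blast
  define \<phi> where "\<phi> e = (if e \<in> F then 1 else - 1 :: real)" for e
  have [measurable]: "\<phi> \<in> borel_measurable (eta M E)" unfolding \<phi>_def by measurable
  define \<Lambda> where "\<Lambda> f = (\<integral>e. \<phi> e * f e \<partial>eta M E)" for f
  have bd: "L1_bounded_functional (eta M E) \<Lambda>" unfolding \<Lambda>_def
    by (rule L1_bounded_functional_integral(2)[where K=1]) (auto simp: \<phi>_def)
  have int\<phi>: "integrable (eta M E) (\<lambda>e. \<phi> e * f e)" if "integrable (eta M E) f" for f
    by (rule L1_bounded_functional_integral(1)[where K=1]) (auto simp: \<phi>_def that)
  have \<Lambda>\<alpha>: "\<Lambda> \<alpha> = \<Lambda> (indicator F)" unfolding \<Lambda>_def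
  proof (rule integral_cong_AE)
    have "integrable (eta M E) \<alpha>" using mm_plus_integrable \<alpha> C by blast
    then show "(\<lambda>e. \<phi> e * \<alpha> e) \<in> borel_measurable (eta M E)" by measurable
    show "AE e in eta M E. \<phi> e * \<alpha> e = \<phi> e * indicator F e" using \<alpha>F by eventually_elim simp
  qed measurable
  have "\<Lambda> y < \<Lambda> \<alpha>" if y: "y \<in> C" and ne: "\<not> (AE e in eta M E. y e = \<alpha> e)" for y
  proof -
    have y_mm: "y \<in> mm_plus M E" using y C by blast
    note y_int = mm_plus_integrable[OF y_mm]
    \<comment> \<open>The bound \<open>y\<close> \<le> 1 on \<open>F\<close> is tested on sets
      \<open>A \<inter> F\<close>, where the integral of \<open>y\<close> is at most the rank and
      the rank is at most the edge measure by hyperfiniteness.\<close>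
    have "AE e in eta M E. 0 \<le> indicator F e * (1 - y e)"
    proof (rule AE_nonneg_if_set_integrals_nonneg)
      have yF: "integrable (eta M E) (\<lambda>e. indicator F e * y e)" using integrable_mult_indicator[OF _ y_int, of F] by simp
      then show "integrable (eta M E) (\<lambda>e. indicator F e * (1 - y e))"
        using integrable_indicator[OF F(1)] by (simp add: right_diff_distrib)
      fix A assume "A \<in> sets (eta M E)"
      then have AF: "A \<inter> F \<in> uprod_sets" "A \<inter> F \<subseteq> E" using F by (auto simp: sets_eta intro: uprod_sets_Int)
      have i: "integrable (eta M E) (indicator (A \<inter> F) :: _ \<Rightarrow> real)" by (rule integrable_indicator[OF AF(1)])
      have iy: "integrable (eta M E) (\<lambda>e. indicator (A \<inter> F) e * y e)"
        using integrable_mult_indicator[OF _ y_int, of "A \<inter> F"] AF(1) by (simp add: sets_eta)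
      have "(\<integral>e\<in>A. indicator F e * (1 - y e) \<partial>eta M E) = (\<integral>e. indicator (A \<inter> F) e - indicator (A \<inter> F) e * y e \<partial>eta M E)"
        unfolding set_lebesgue_integral_def by (intro Bochner_Integration.integral_cong) (auto split: split_indicator)
      also have "\<dots> = measure (eta M E) (A \<inter> F) - (\<integral>e\<in>A \<inter> F. y e \<partial>eta M E)"
        using i iy AF(1) by (simp add: set_lebesgue_integral_def sets_eta)
      finally have eq: "(\<integral>e\<in>A. indicator F e * (1 - y e) \<partial>eta M E) = measure (eta M E) (A \<inter> F) - (\<integral>e\<in>A \<inter> F. y e \<partial>eta M E)" .
      have "rho M E (A \<inter> F) \<le> measure (eta M E) (A \<inter> F)"
        by (rule hyperfinite_rho_le_eta[OF AF]) (rule hyperfinite_subset[OF hyp _ AF(1)], simp)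
      then show "0 \<le> (\<integral>e\<in>A. indicator F e * (1 - y e) \<partial>eta M E)"
        unfolding eq using mm_plus_bounds(2)[OF y_mm AF] by simp
    qed
    with mm_plus_AE_nonneg[OF y_mm]
    have abs: "AE e in eta M E. \<phi> e * (indicator F e - y e) = \<bar>indicator F e - y e\<bar>"
      by eventually_elim (auto simp: \<phi>_def split: split_indicator)
    have id: "integrable (eta M E) (\<lambda>e. indicator F e - y e)" using integrable_indicator[OF F(1)] y_int by simp
    have "\<Lambda> (indicator F) - \<Lambda> y = (\<integral>e. \<phi> e * (indicator F e - y e) \<partial>eta M E)"
      unfolding \<Lambda>_def using int\<phi>[OF integrable_indicator[OF F(1)]] int\<phi>[OF y_int] by (simp add: right_diff_distrib)
    also have "\<dots> = (\<integral>e. \<bar>indicator F e - y e\<bar> \<partial>eta M E)"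
      by (rule integral_cong_AE) (use id abs in auto)
    finally have diff: "\<Lambda> (indicator F) - \<Lambda> y = (\<integral>e. \<bar>indicator F e - y e\<bar> \<partial>eta M E)" .
    have "(\<integral>e. \<bar>indicator F e - y e\<bar> \<partial>eta M E) \<noteq> 0"
    proof
      assume "(\<integral>e. \<bar>indicator F e - y e\<bar> \<partial>eta M E) = 0"
      then have "AE e in eta M E. \<bar>indicator F e - y e\<bar> = 0"
        using integral_nonneg_eq_0_iff_AE[OF integrable_abs[OF id]] by simp
      with \<alpha>F have "AE e in eta M E. y e = \<alpha> e" by eventually_elim simp
      then show False using ne by simp
    qed
    moreover have "0 \<le> (\<integral>e. \<bar>indicator F e - y e\<bar> \<partial>eta M E)" by simp
    ultimately show ?thesis using diff \<Lambda>\<alpha> by linarith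
  qed
  then show ?thesis unfolding exposed_point_L1_def
    using \<alpha> bd bounded_functional_continuous[OF bd] by (auto simp: L1_bounded_functional_def)
qed

lemma acyclic_forest: "acyclic_edges F \<Longrightarrow> forest M E F"
  by (simp add: acyclic_edges_def forest_def)

text \<open>Exposedness in the form in which it is applied: a competitor that does at least as well
  as \<alpha> must coincide with it almost everywhere.\<close>

lemma exposed_functional:
  assumes "exposed_point_L1 (eta M E) C \<alpha>"
  obtains \<phi> K where "\<phi> \<in> borel_measurable (eta M E)" "\<And>e. \<bar>\<phi> e\<bar> \<le> K"
    "\<And>y. y \<in> C \<Longrightarrow> integrable (eta M E) y \<Longrightarrow> integrable (eta M E) \<alpha> \<Longrightarrow>
       (\<integral>e. \<phi> e * \<alpha> e \<partial>eta M E) \<le> (\<integral>e. \<phi> e * y e \<partial>eta M E) \<Longrightarrow> AE e in eta M E. y e = \<alpha> e"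
proof -
  obtain \<Lambda> where \<Lambda>: "L1_linear (eta M E) \<Lambda>" "continuous_map (weak_L1 (eta M E)) euclideanreal \<Lambda>"
    "\<And>y. y \<in> C \<Longrightarrow> \<not> (AE e in eta M E. y e = \<alpha> e) \<Longrightarrow> \<Lambda> y < \<Lambda> \<alpha>"
    using assms unfolding exposed_point_L1_def by blast
  obtain \<phi> K where \<phi>: "\<phi> \<in> borel_measurable (eta M E)" "\<And>e. \<bar>\<phi> e\<bar> \<le> K"
    "\<And>f. integrable (eta M E) f \<Longrightarrow> \<Lambda> f = (\<integral>e. \<phi> e * f e \<partial>eta M E)"
    using eta.L1_functional_density[OF weakly_continuous_bounded[OF \<Lambda>(1,2)]] by blast
  show thesis
  proof (rule that[OF \<phi>(1,2)])
    fix y assume y: "y \<in> C" "integrable (eta M E) y" "integrable (eta M E) \<alpha>"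
      "(\<integral>e. \<phi> e * \<alpha> e \<partial>eta M E) \<le> (\<integral>e. \<phi> e * y e \<partial>eta M E)"
    then have "\<Lambda> \<alpha> \<le> \<Lambda> y" using \<phi>(3) by simp
    then show "AE e in eta M E. y e = \<alpha> e" using \<Lambda>(3)[OF y(1)] by fastforce
  qed
qed

end

context weighted_graphing
begin

text \<open>On a superlevel set the \<alpha>-mass is bounded by the rank, and the rank by the
  measure of the forest inside it. \<open>layer_cake\<close> for the two densities integrates this
  over the positive levels, which is why the positive part of the weight appears.\<close>

theorem wmsf_maximizes:
  assumes \<alpha>: "\<alpha> \<in> mm_plus M E" and K: "\<And>e. \<bar>w e\<bar> \<le> K"
  shows "(\<integral>e. max 0 (w e) * \<alpha> e \<partial>eta M E) \<le> (\<integral>e. max 0 (w e) * indicator wmsf e \<partial>eta M E)"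
proof -
  note \<alpha>_int = mm_plus_integrable[OF \<alpha>]
  note [measurable] = w_measurable borel_measurable_integrable[OF \<alpha>_int]
  have [measurable]: "wmsf \<in> sets (eta M E)" using wmsf_uprod_sets by (simp add: sets_eta)
  have bound: "\<bar>max 0 (w e)\<bar> \<le> K" for e using K[of e] by (auto simp: max_def)
  define P where "P = density (eta M E) (\<lambda>e. ennreal (\<alpha> e))"
  define Q where "Q = density (eta M E) (\<lambda>e. ennreal (indicator wmsf e))"
  have fin: "finite_measure (density (eta M E) (\<lambda>e. ennreal (f e)))" if f: "integrable (eta M E) f" "AE e in eta M E. 0 \<le> f e" for f
  proof (rule finite_measureI)
    have [measurable]: "f \<in> borel_measurable (eta M E)" using f by simp
    have "emeasure (density (eta M E) (\<lambda>e. ennreal (f e))) (space (eta M E)) = (\<integral>\<^sup>+e. ennreal (f e) \<partial>eta M E)"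
      using sets.top[of "eta M E"] by (subst emeasure_density) (auto intro!: nn_integral_cong)
    also have "\<dots> = ennreal (\<integral>e. f e \<partial>eta M E)" by (rule nn_integral_eq_integral[OF f])
    finally show "emeasure (density (eta M E) (\<lambda>e. ennreal (f e))) (space (density (eta M E) (\<lambda>e. ennreal (f e)))) \<noteq> \<infinity>" by simp
  qed
  have ind_int: "integrable (eta M E) (indicator wmsf :: _ \<Rightarrow> real)" by (rule integrable_indicator[OF wmsf_uprod_sets])
  have ind_nn: "AE e in eta M E. 0 \<le> (indicator wmsf e :: real)" by simp
  interpret P: finite_measure P unfolding P_def by (rule fin[OF \<alpha>_int mm_plus_AE_nonneg[OF \<alpha>]])
  interpret Q: finite_measure Q unfolding Q_def by (rule fin[OF ind_int ind_nn])
  have le: "emeasure P {e \<in> space P. t < w e} \<le> emeasure Q {e \<in> space Q. t < w e}" for t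
  proof -
    let ?A = "{e. t < w e}" and ?U = "{e \<in> E. t < w e}"
    have "{e \<in> space (eta M E). t < w e} \<in> sets (eta M E)" by measurable
    then have A: "?A \<in> sets (eta M E)" by simp
    have A': "?A \<in> uprod_sets" using A by (simp add: sets_eta)
    have AU: "?A \<inter> E = ?U" by blast
    have "emeasure P ?A = (\<integral>\<^sup>+e. ennreal (indicator ?A e * \<alpha> e) \<partial>eta M E)"
      unfolding P_def using A by (subst emeasure_density) (auto intro!: nn_integral_cong split: split_indicator)
    also have "\<dots> = ennreal (\<integral>e\<in>?A. \<alpha> e \<partial>eta M E)"
      unfolding set_lebesgue_integral_def real_scaleR_def
    proof (rule nn_integral_eq_integral)
      show "integrable (eta M E) (\<lambda>e. indicator ?A e * \<alpha> e)" using integrable_mult_indicator[OF A \<alpha>_int] by simp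
      show "AE e in eta M E. 0 \<le> indicator ?A e * \<alpha> e" using mm_plus_AE_nonneg[OF \<alpha>] by eventually_elim simp
    qed
    also have "(\<integral>e\<in>?A. \<alpha> e \<partial>eta M E) = (\<integral>e\<in>?U. \<alpha> e \<partial>eta M E)"
      unfolding set_integral_within_E[OF A' \<alpha>_int] AU ..
    also have "ennreal \<dots> \<le> ennreal (measure (eta M E) (wmsf \<inter> ?U))"
      by (intro ennreal_leI order_trans[OF mm_plus_bounds(2)[OF \<alpha> superlevel_uprod_sets] rho_superlevel]) blast
    also have "wmsf \<inter> ?U = ?A \<inter> wmsf" using wmsf_subset by blast
    also have "ennreal (measure (eta M E) (?A \<inter> wmsf)) = (\<integral>\<^sup>+e. indicator (?A \<inter> wmsf) e \<partial>eta M E)"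
      using A by (simp add: eta.emeasure_eq_measure)
    also have "\<dots> = emeasure Q ?A"
      unfolding Q_def using A by (subst emeasure_density)
        (auto simp del: nn_integral_indicator intro!: nn_integral_cong split: split_indicator)
    finally show ?thesis by (simp add: P_def Q_def)
  qed
  have w_PQ: "w \<in> borel_measurable P" "w \<in> borel_measurable Q" unfolding P_def Q_def by measurable
  have PQ: "(\<integral>\<^sup>+e. ennreal (w e) \<partial>P) \<le> (\<integral>\<^sup>+e. ennreal (w e) \<partial>Q)"
    unfolding layer_cake[OF P.sigma_finite_measure_axioms w_PQ(1)] layer_cake[OF Q.sigma_finite_measure_axioms w_PQ(2)]
    by (intro nn_integral_mono mult_left_mono le) simp
  have weighted: "(\<integral>\<^sup>+e. ennreal (w e) \<partial>density (eta M E) (\<lambda>e. ennreal (f e))) = ennreal (\<integral>e. max 0 (w e) * f e \<partial>eta M E)"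
    if f: "integrable (eta M E) f" "AE e in eta M E. 0 \<le> f e" for f
  proof -
    have [measurable]: "f \<in> borel_measurable (eta M E)" using f by simp
    have "(\<integral>\<^sup>+e. ennreal (w e) \<partial>density (eta M E) (\<lambda>e. ennreal (f e))) = (\<integral>\<^sup>+e. ennreal (f e) * ennreal (w e) \<partial>eta M E)"
      by (rule nn_integral_density) measurable
    also have "\<dots> = (\<integral>\<^sup>+e. ennreal (max 0 (w e) * f e) \<partial>eta M E)"
    proof (rule nn_integral_cong_AE)
      show "AE e in eta M E. ennreal (f e) * ennreal (w e) = ennreal (max 0 (w e) * f e)"
        using f(2)
      proof eventually_elim
        case (elim e)
        have "ennreal (w e) = ennreal (max 0 (w e))" by simp
        then show ?case using elim by (simp add: ennreal_mult mult.commute)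
      qed
    qed
    also have "\<dots> = ennreal (\<integral>e. max 0 (w e) * f e \<partial>eta M E)"
    proof (rule nn_integral_eq_integral)
      show "integrable (eta M E) (\<lambda>e. max 0 (w e) * f e)"
        by (rule L1_bounded_functional_integral(1)[OF _ bound f(1)]) measurable
      show "AE e in eta M E. 0 \<le> max 0 (w e) * f e" using f(2) by eventually_elim simp
    qed
    finally show ?thesis .
  qed
  have "ennreal (\<integral>e. max 0 (w e) * \<alpha> e \<partial>eta M E) \<le> ennreal (\<integral>e. max 0 (w e) * indicator wmsf e \<partial>eta M E)"
    using PQ unfolding P_def Q_def weighted[OF \<alpha>_int mm_plus_AE_nonneg[OF \<alpha>]] weighted[OF ind_int ind_nn] .
  then show ?thesis by (subst (asm) ennreal_le_iff) (auto intro!: integral_nonneg_AE)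
qed

text \<open>With positive weights the superlevel set at 0 is all of \<open>E\<close>. The spanning
  property then holds for \<open>E\<close> itself, and the forest attains the full rank.\<close>

lemma positive_wmsf_basis:
  assumes pos: "\<And>e. 0 < w e"
  shows "indicator wmsf \<in> bmm_plus M E" "essential_spanning_forest M E wmsf"
proof -
  have E: "{e \<in> E. 0 < w e} = E" using pos by blast
  have EU: "E \<in> uprod_sets" by (rule E_uprod_sets)
  have int: "wmsf \<inter> E = wmsf" using wmsf_subset by blast
  have "rho M E E \<le> measure (eta M E) wmsf" using rho_superlevel[of 0] unfolding E int .
  moreover have "measure (eta M E) wmsf \<le> rho M E wmsf"
    by (rule hyperfinite_acyclic_eta_le_rho[OF wmsf_uprod_sets wmsf_subset hyperfinite_wmsf acyclic_wmsf])
  moreover have "rho M E wmsf \<le> rho M E E" by (rule rho_mono[OF wmsf_uprod_sets EU order_refl wmsf_subset])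
  ultimately have "measure (eta M E) (E \<inter> wmsf) = rho M E E" using int by (simp add: Int_commute)
  then show "indicator wmsf \<in> bmm_plus M E"
    unfolding bmm_plus_def using indicator_mm_plus[OF wmsf_uprod_sets wmsf_subset hyperfinite_wmsf acyclic_wmsf]
      set_integral_indicator[OF EU wmsf_uprod_sets] by simp
  have span: "finite (comp wmsf x) \<Longrightarrow> comp wmsf x = comp E x" for x
    using superlevel_spanning[of 0 x] unfolding E int .
  show "essential_spanning_forest M E wmsf"
    unfolding essential_spanning_forest_def
  proof (intro conjI AE_I2 impI wmsf_subset acyclic_forest acyclic_wmsf)
    fix x
    show "comp wmsf x = comp E x" if "finite (comp E x)"
      by (rule span[OF finite_subset[OF comp_mono[OF wmsf_subset] that]])
    show "infinite (comp wmsf x)" if "infinite (comp E x)"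
    proof
      assume fin: "finite (comp wmsf x)"
      then show False using that unfolding span[OF fin] by simp
    qed
  qed
qed

end

context graphing_space
begin

theorem exposed_mm_plus:
  assumes \<alpha>: "\<alpha> \<in> mm_plus M E" and exp: "exposed_point_L1 (eta M E) (mm_plus M E) \<alpha>"
  shows "\<exists>F\<in>sets (eta M E). F \<subseteq> E \<and> is_restriction (eta M E) \<alpha> F \<and> forest M E F \<and> hyperfinite M E F"
proof -
  obtain \<phi> K where \<phi>: "\<phi> \<in> borel_measurable (eta M E)" "\<And>e. \<bar>\<phi> e\<bar> \<le> K"
    and uniq: "\<And>y. y \<in> mm_plus M E \<Longrightarrow> integrable (eta M E) y \<Longrightarrow> integrable (eta M E) \<alpha> \<Longrightarrow>
       (\<integral>e. \<phi> e * \<alpha> e \<partial>eta M E) \<le> (\<integral>e. \<phi> e * y e \<partial>eta M E) \<Longrightarrow> AE e in eta M E. y e = \<alpha> e"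
    using exposed_functional[OF exp] by blast
  interpret weighted_graphing M E \<phi> by unfold_locales (rule \<phi>)
  \<comment> \<open>Edges with nonpositive density cannot raise the value. Dropping them turns the
    integral of the positive part over the forest into the integral of \<open>\<phi>\<close> over
    \<open>?F\<close>.\<close>
  let ?F = "wmsf \<inter> {e \<in> E. 0 < \<phi> e}"
  have F: "?F \<in> uprod_sets" "?F \<subseteq> E" using wmsf_uprod_sets superlevel_uprod_sets by (auto intro: uprod_sets_Int)
  have hyp: "hyperfinite M E ?F" by (rule hyperfinite_subset[OF hyperfinite_wmsf _ F(1)]) simp
  have acyc: "acyclic_edges ?F" by (rule acyclic_edges_subset[OF acyclic_wmsf]) simp
  note \<alpha>_int = mm_plus_integrable[OF \<alpha>]
  have "(\<integral>e. \<phi> e * \<alpha> e \<partial>eta M E) \<le> (\<integral>e. max 0 (\<phi> e) * \<alpha> e \<partial>eta M E)"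
  proof (rule integral_mono_AE)
    note [measurable] = \<phi>(1)
    show "integrable (eta M E) (\<lambda>e. \<phi> e * \<alpha> e)" by (rule L1_bounded_functional_integral(1)[OF \<phi> \<alpha>_int])
    show "integrable (eta M E) (\<lambda>e. max 0 (\<phi> e) * \<alpha> e)"
    proof (rule L1_bounded_functional_integral(1)[OF _ _ \<alpha>_int])
      show "\<bar>max 0 (\<phi> e)\<bar> \<le> K" for e using \<phi>(2)[of e] by (auto simp: max_def)
    qed measurable
    show "AE e in eta M E. \<phi> e * \<alpha> e \<le> max 0 (\<phi> e) * \<alpha> e"
      using mm_plus_AE_nonneg[OF \<alpha>] by eventually_elim (intro mult_right_mono, auto)
  qed
  also have "\<dots> \<le> (\<integral>e. max 0 (\<phi> e) * indicator wmsf e \<partial>eta M E)" by (rule wmsf_maximizes[OF \<alpha> \<phi>(2)])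
  also have "\<dots> = (\<integral>e. \<phi> e * indicator ?F e \<partial>eta M E)"
    using wmsf_subset by (intro Bochner_Integration.integral_cong) (auto simp: max_def split: split_indicator)
  finally have "AE e in eta M E. indicator ?F e = \<alpha> e"
    by (rule uniq[OF indicator_mm_plus[OF F hyp acyc] integrable_indicator[OF F(1)] \<alpha>_int])
  then have "is_restriction (eta M E) \<alpha> ?F" by (rule AE_is_restriction[OF F(1) \<alpha>_int])
  then show ?thesis using F hyp acyclic_forest[OF acyc] by (intro bexI[of _ ?F]) (auto simp: sets_eta)
qed

theorem exposed_bmm_plus:
  assumes \<alpha>: "\<alpha> \<in> bmm_plus M E" and exp: "exposed_point_L1 (eta M E) (bmm_plus M E) \<alpha>"
  shows "\<exists>F\<in>sets (eta M E). F \<subseteq> E \<and> is_restriction (eta M E) \<alpha> F \<and> essential_spanning_forest M E F \<and> hyperfinite M E F"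
proof -
  obtain \<phi> K where \<phi>[measurable]: "\<phi> \<in> borel_measurable (eta M E)" and K: "\<And>e. \<bar>\<phi> e\<bar> \<le> K"
    and uniq: "\<And>y. y \<in> bmm_plus M E \<Longrightarrow> integrable (eta M E) y \<Longrightarrow> integrable (eta M E) \<alpha> \<Longrightarrow>
       (\<integral>e. \<phi> e * \<alpha> e \<partial>eta M E) \<le> (\<integral>e. \<phi> e * y e \<partial>eta M E) \<Longrightarrow> AE e in eta M E. y e = \<alpha> e"
    using exposed_functional[OF exp] by blast
  \<comment> \<open>Since \<open>\<phi>\<close> is at least \<open>- K\<close>, the shifted weight
    is at least 1. On \<open>bmm_plus\<close> the shift changes every value of the functional by the
    same amount \<open>c * rho M E E\<close>.\<close>
  define c where "c = K + 1"
  define w where "w e = \<phi> e + c" for e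
  have w_pos: "0 < w e" for e using K[of e] by (simp add: w_def c_def)
  have w_bound: "\<bar>w e\<bar> \<le> K + c" for e using K[of e] w_pos[of e] by (simp add: w_def)
  interpret weighted_graphing M E w by unfold_locales (simp add: w_def[abs_def])
  have \<alpha>_mm: "\<alpha> \<in> mm_plus M E" and \<alpha>_E: "(\<integral>e\<in>E. \<alpha> e \<partial>eta M E) = rho M E E" using \<alpha> by (auto simp: bmm_plus_def)
  note \<alpha>_int = mm_plus_integrable[OF \<alpha>_mm]
  note F = positive_wmsf_basis[OF w_pos]
  note F_int = integrable_indicator[OF wmsf_uprod_sets]
  have total: "(\<integral>e. w e * f e \<partial>eta M E) = (\<integral>e. \<phi> e * f e \<partial>eta M E) + c * rho M E E" if f: "f \<in> bmm_plus M E" for f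
  proof -
    have fi: "integrable (eta M E) f" using f by (simp add: bmm_plus_def mm_plus_def)
    have U: "(UNIV :: 'a uprod set) \<in> uprod_sets" by (simp add: uprod_sets_def)
    have "(\<integral>e. f e \<partial>eta M E) = (\<integral>e\<in>UNIV. f e \<partial>eta M E)" by (simp add: set_lebesgue_integral_def)
    also have "\<dots> = rho M E E" using set_integral_within_E[OF U fi] f by (simp add: bmm_plus_def)
    finally have "(\<integral>e. f e \<partial>eta M E) = rho M E E" .
    moreover have "integrable (eta M E) (\<lambda>e. \<phi> e * f e)" by (rule L1_bounded_functional_integral(1)[OF \<phi> K fi])
    ultimately show ?thesis using fi by (simp add: w_def distrib_right)
  qed
  have max: "max 0 (w e) = w e" for e using w_pos[of e] by simp
  have "(\<integral>e. w e * \<alpha> e \<partial>eta M E) \<le> (\<integral>e. w e * indicator wmsf e \<partial>eta M E)"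
    using wmsf_maximizes[OF \<alpha>_mm w_bound] unfolding max .
  then have "(\<integral>e. \<phi> e * \<alpha> e \<partial>eta M E) \<le> (\<integral>e. \<phi> e * indicator wmsf e \<partial>eta M E)"
    unfolding total[OF \<alpha>] total[OF F(1)] by simp
  then have "AE e in eta M E. indicator wmsf e = \<alpha> e" by (rule uniq[OF F(1) F_int \<alpha>_int])
  then have "is_restriction (eta M E) \<alpha> wmsf" by (rule AE_is_restriction[OF wmsf_uprod_sets \<alpha>_int])
  then show ?thesis using wmsf_uprod_sets wmsf_subset F(2) hyperfinite_wmsf by (intro bexI[of _ wmsf]) (auto simp: sets_eta)
qed

end

theorem theorem1p2:
  fixes M :: "'a::polish_space measure" and E :: "'a uprod set"
  assumes "graphing M E"
  shows "(\<forall>\<alpha>\<in>mm_plus M E.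
            exposed_point_L1 (eta M E) (mm_plus M E) \<alpha> \<longleftrightarrow>
            (\<exists>F\<in>sets (eta M E). F \<subseteq> E \<and> is_restriction (eta M E) \<alpha> F \<and>
                forest M E F \<and> hyperfinite M E F))
       \<and> (\<forall>\<alpha>\<in>bmm_plus M E.
            exposed_point_L1 (eta M E) (bmm_plus M E) \<alpha> \<longleftrightarrow>
            (\<exists>F\<in>sets (eta M E). F \<subseteq> E \<and> is_restriction (eta M E) \<alpha> F \<and>
                essential_spanning_forest M E F \<and> hyperfinite M E F))"
proof -
  interpret graphing_space M E by unfold_locales (rule assms)
  have bmm: "bmm_plus M E \<subseteq> mm_plus M E" by (auto simp: bmm_plus_def)
  show ?thesis
  proof (intro conjI ballI iffI)
    fix \<alpha> assume "\<alpha> \<in> mm_plus M E" "exposed_point_L1 (eta M E) (mm_plus M E) \<alpha>"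
    then show "\<exists>F\<in>sets (eta M E). F \<subseteq> E \<and> is_restriction (eta M E) \<alpha> F \<and> forest M E F \<and> hyperfinite M E F"
      by (rule exposed_mm_plus)
  next
    fix \<alpha> assume "\<alpha> \<in> mm_plus M E"
      "\<exists>F\<in>sets (eta M E). F \<subseteq> E \<and> is_restriction (eta M E) \<alpha> F \<and> forest M E F \<and> hyperfinite M E F"
    then show "exposed_point_L1 (eta M E) (mm_plus M E) \<alpha>"
      using hyperfinite_restriction_exposed[OF order_refl] by (auto simp: sets_eta)
  next
    fix \<alpha> assume "\<alpha> \<in> bmm_plus M E" "exposed_point_L1 (eta M E) (bmm_plus M E) \<alpha>"
    then show "\<exists>F\<in>sets (eta M E). F \<subseteq> E \<and> is_restriction (eta M E) \<alpha> F \<and> essential_spanning_forest M E F \<and> hyperfinite M E F"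
      by (rule exposed_bmm_plus)
  next
    fix \<alpha> assume "\<alpha> \<in> bmm_plus M E"
      "\<exists>F\<in>sets (eta M E). F \<subseteq> E \<and> is_restriction (eta M E) \<alpha> F \<and> essential_spanning_forest M E F \<and> hyperfinite M E F"
    then show "exposed_point_L1 (eta M E) (bmm_plus M E) \<alpha>"
      using hyperfinite_restriction_exposed[OF bmm] by (auto simp: sets_eta)
  qed
qed

end
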